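(* (1) (Planar billiards) If a $C^\infty$-smooth local projective billiard $(\alpha_1,\alpha_2,\alpha_3)$ in the Euclidean plane $\mathbb{R}^2$ is $3$-reflective, then it is right-spherical. (2) (Multidimensional billiards) If $d\ge3$, there are no $C^\infty$-smooth $3$-pseudo-reflective local projective billiards $(\alpha_1,\alpha_2,\alpha_3)$ in $\mathbb{R}^d$.
   Context: $\mathbb{P}(T\mathbb{R}^d)$ is the set of pairs $(p,L)$ with $p\in\mathbb{R}^d$ and $L\subset\mathbb{R}^d$ a line through $p$. A line-framed hypersurface over a hypersurface $a\subset\mathbb{R}^d$ is a regularly embedded connected $(d-1)$-dimensional submanifold $\alpha\subset\mathbb{P}(T\mathbb{R}^d)$ which projects diffeomorphically onto the regularly embedded hypersurface $a$ via $(p,L)\mapsto p$ and such that for every $(p,L)\in\alpha$ the line $L=:L(p)$ is transverse to $T_pa$. Projective reflection law on $\alpha$ at $p\in a$: an oriented line $\ell\ni p$ transverse to $a$ is reflected into an oriented line $\ell'\ni p$ if $\ell,\ell',L(p)$ lie in one plane $\mathcal{P}$, the quadruple of lines $(\ell,\ell',L(p),T_pa\cap\mathcal{P})$ is harmonic (i.e. $\ell,\ell'$ are exchanged by the non-trivial projective involution of the pencil of lines of $\mathcal{P}$ through $p$ fixing $L(p)$ and $T_pa\cap\mathcal{P}$), and $\ell,\ell'$ have opposite orientations with respect to $T_pa$ (they point to opposite sides of $T_pa$). A local projective billiard $(\alpha_1,\alpha_2,\alpha_3)$ in $\mathbb{R}^d$ consists of line-framed hypersurfaces over hypersurfaces $a_1,a_2,a_3$;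 it is $C^\infty$-smooth if all $\alpha_j$ are. A $3$-periodic orbit is a triple $(p_1,p_2,p_3)$ with $p_j\in a_j$ such that for every $j$ (modulo $3$): $p_j\ne p_{j+1}$; the line $p_jp_{j+1}$ is transverse to $a_j$ and $a_{j+1}$; and the line $p_jp_{j+1}$, oriented from $p_j$ to $p_{j+1}$, is obtained from $p_{j-1}p_j$, oriented from $p_{j-1}$ to $p_j$, by the projective reflection law on $\alpha_j$ at $p_j$. The billiard is $3$-reflective if there is a non-empty open subset $U_1\times U_2\subset a_1\times a_2$ such that every $(p_1,p_2)\in U_1\times U_2$ extends to a $3$-periodic orbit $(p_1,p_2,p_3)$; it is $3$-pseudo-reflective if the same holds with $U_1\times U_2$ replaced by a subset of $a_1\times a_2$ of non-zero Lebesgue measure. Given three non-collinear points $P_1,P_2,P_3\in\mathbb{RP}^2$ (with $\mathbb{R}^2\subset\mathbb{RP}^2$, indices modulo $3$), the right-spherical billiard based at $P_1,P_2,P_3$ has as $j$-th boundary the line $P_jP_{j+1}$ endowed with the field of lines $p\mapsto pP_{j+2}$, for $j=1,2,3$. A local projective billiard $(\alpha_1,\alpha_2,\alpha_3)$ in $\mathbb{R}^2$ is right-spherical if it has a $3$-periodic orbit $(p_1,p_2,p_3)$ such that, for some right-spherical billiard, for each $j$ the line-framed curve $\alpha_j$ coincides in a neighborhood of $(p_j,L_j(p_j))$ with the boundary of that right-spherical billiard, i.e. near $p_j$ the curve $a_j$ lies on $P_jP_{j+1}$ and its field of lines is $p\mapsto pP_{j+2}$. *)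

theory Defs
  imports "HOL-Analysis.Analysis"
begin

section \<open>Smooth maps and embedded submanifolds of Euclidean spaces\<close>

text \<open>Both predicates are meant for open \<open>S\<close>.\<close>

fun ck_on :: "nat \<Rightarrow> ('a::euclidean_space \<Rightarrow> 'b::euclidean_space) \<Rightarrow> 'a set \<Rightarrow> bool" where
  "ck_on 0 f S \<longleftrightarrow> continuous_on S f"
| "ck_on (Suc k) f S \<longleftrightarrow>
     (\<forall>x\<in>S. f differentiable (at x)) \<and> (\<forall>v. ck_on k (\<lambda>x. frechet_derivative f (at x) v) S)"

definition smooth_on :: "('a::euclidean_space \<Rightarrow> 'b::euclidean_space) \<Rightarrow> 'a set \<Rightarrow> bool" where
  "smooth_on f S \<longleftrightarrow> (\<forall>k. ck_on k f S)"

text \<open>Smoothness of a map on an arbitrary subset (in particular on an embedded submanifold):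
  local existence of smooth extensions to the ambient space.\<close>

definition smooth_on_subset :: "('a::euclidean_space \<Rightarrow> 'b::euclidean_space) \<Rightarrow> 'a set \<Rightarrow> bool" where
  "smooth_on_subset f S \<longleftrightarrow>
     (\<forall>x\<in>S. \<exists>U g. open U \<and> x \<in> U \<and> smooth_on g U \<and> (\<forall>y\<in>S \<inter> U. g y = f y))"

definition slice_chart ::
  "'a::euclidean_space set \<Rightarrow> nat \<Rightarrow> 'a set \<Rightarrow> ('a \<Rightarrow> 'a) \<Rightarrow> 'a set \<Rightarrow> bool" where
  "slice_chart S k U \<phi> T \<longleftrightarrow>
     open U \<and> open (\<phi> ` U) \<and> inj_on \<phi> U \<and>
     smooth_on \<phi> U \<and> smooth_on (inv_into U \<phi>) (\<phi> ` U) \<and>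
     subspace T \<and> dim T = k \<and> \<phi> ` (S \<inter> U) = \<phi> ` U \<inter> T"

definition submanifold :: "nat \<Rightarrow> 'a::euclidean_space set \<Rightarrow> bool" where
  "submanifold k S \<longleftrightarrow> (\<forall>x\<in>S. \<exists>U \<phi> T. x \<in> U \<and> slice_chart S k U \<phi> T)"

text \<open>The tangent space is a linear subspace (of velocities of smooth curves in \<open>S\<close>);
  the affine tangent space is its translate by \<open>p\<close>.\<close>

definition tangent_space :: "'a::euclidean_space set \<Rightarrow> 'a \<Rightarrow> 'a set" where
  "tangent_space S p =
     {v. \<exists>(\<gamma>::real \<Rightarrow> 'a) e. e > 0 \<and> smooth_on \<gamma> {-e<..<e} \<and> (\<forall>t\<in>{-e<..<e}. \<gamma> t \<in> S) \<and>
         \<gamma> 0 = p \<and> (\<gamma> has_vector_derivative v) (at 0)}"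

text \<open>Lebesgue measurable subsets and Lebesgue null subsets \<open>E\<close> of a \<open>k\<close>-dimensional submanifold
  \<open>S\<close> are defined in charts. A subset \<open>A\<close> of the \<open>k\<close>-dimensional subspace \<open>T\<close> is measurable
  (null) for the \<open>k\<close>-dimensional Lebesgue measure of \<open>T\<close> iff the cylinder \<open>A + T\<^sup>\<bottom>\<close> is measurable
  (null) in the ambient space.\<close>

definition cylinder :: "'a::euclidean_space set \<Rightarrow> 'a set \<Rightarrow> 'a set" where
  "cylinder T A = {y + z | y z. y \<in> A \<and> z \<in> orthogonal_comp T}"

definition measurable_in_submanifold :: "nat \<Rightarrow> 'a::euclidean_space set \<Rightarrow> 'a set \<Rightarrow> bool" where
  "measurable_in_submanifold k S E \<longleftrightarrow> E \<subseteq> S \<and>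
     (\<forall>U \<phi> T. slice_chart S k U \<phi> T \<longrightarrow> cylinder T (\<phi> ` (E \<inter> U)) \<in> sets lebesgue)"

definition null_in_submanifold :: "nat \<Rightarrow> 'a::euclidean_space set \<Rightarrow> 'a set \<Rightarrow> bool" where
  "null_in_submanifold k S E \<longleftrightarrow> E \<subseteq> S \<and>
     (\<forall>U \<phi> T. slice_chart S k U \<phi> T \<longrightarrow> cylinder T (\<phi> ` (E \<inter> U)) \<in> null_sets lebesgue)"


section \<open>The projectivized tangent bundle of a Euclidean space\<close>

definition is_line :: "'a::euclidean_space set \<Rightarrow> bool" where
  "is_line L \<longleftrightarrow> affine L \<and> aff_dim L = 1"

definition line_through :: "'a::euclidean_space \<Rightarrow> 'a \<Rightarrow> 'a set" where
  "line_through p q = affine hull {p, q}"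

definition direction :: "'a::euclidean_space \<Rightarrow> 'a set \<Rightarrow> 'a set" where
  "direction p L = {v. p + v \<in> L}"

definition PT :: "('a::euclidean_space \<times> 'a set) set" where
  "PT = {(p, L). is_line L \<and> p \<in> L}"

text \<open>The topology of \<^term>\<open>PT\<close> is the quotient topology for the map that sends \<open>(p, v)\<close> with
  \<open>v \<noteq> 0\<close> to \<open>p\<close> and the line through \<open>p\<close> directed by \<open>v\<close>.\<close>

definition open_in_PT :: "('a::euclidean_space \<times> 'a set) set \<Rightarrow> bool" where
  "open_in_PT W \<longleftrightarrow> W \<subseteq> PT \<and> open {(p, v). v \<noteq> 0 \<and> (p, line_through p (p + v)) \<in> W}"

definition PT_topology :: "('a::euclidean_space \<times> 'a set) topology" where
  "PT_topology = topology open_in_PT"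

lemma istopology_open_in_PT: "istopology (open_in_PT :: ('a::euclidean_space \<times> 'a set) set \<Rightarrow> bool)"
  unfolding istopology_def
proof (intro conjI allI impI)
  fix V W :: "('a \<times> 'a set) set"
  assume "open_in_PT V" "open_in_PT W"
  moreover have "{(p, v). v \<noteq> 0 \<and> (p, line_through p (p + v)) \<in> V \<inter> W} =
      {(p, v). v \<noteq> 0 \<and> (p, line_through p (p + v)) \<in> V} \<inter>
      {(p, v). v \<noteq> 0 \<and> (p, line_through p (p + v)) \<in> W}"
    by auto
  ultimately show "open_in_PT (V \<inter> W)"
    unfolding open_in_PT_def by (auto intro: open_Int)
next
  fix \<W> :: "('a \<times> 'a set) set set"
  assume "\<forall>W\<in>\<W>. open_in_PT W"
  moreover have "{(p, v). v \<noteq> 0 \<and> (p, line_through p (p + v)) \<in> \<Union>\<W>} =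
      (\<Union>W\<in>\<W>. {(p, v). v \<noteq> 0 \<and> (p, line_through p (p + v)) \<in> W})"
    by auto
  ultimately show "open_in_PT (\<Union>\<W>)"
    unfolding open_in_PT_def by (auto intro!: open_UN)
qed

lemma openin_PT_topology: "openin PT_topology W \<longleftrightarrow> open_in_PT W"
  by (simp add: PT_topology_def topology_inverse' istopology_open_in_PT)

text \<open>The smooth structure of \<^term>\<open>PT\<close> is given by the standard affine charts of the projective
  space of directions, one for each vector \<open>u\<close> of the standard basis: on the lines whose direction
  is not orthogonal to \<open>u\<close>, the chart sends \<open>(p, L)\<close> to \<open>(p, v)\<close>, where \<open>v\<close> is the direction vector
  of \<open>L\<close> with \<open>v \<bullet> u = 1\<close>. It takes values in an affine subspace of \<open>'a \<times> 'a\<close>; a subset of an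
  affine subspace is a submanifold of it iff it is one of the ambient Euclidean space.\<close>

definition PT_dom :: "'a::euclidean_space \<Rightarrow> ('a \<times> 'a set) set" where
  "PT_dom u = {(p, L). (p, L) \<in> PT \<and> (\<exists>v\<in>direction p L. v \<bullet> u \<noteq> 0)}"

definition PT_chart :: "'a::euclidean_space \<Rightarrow> 'a \<times> 'a set \<Rightarrow> 'a \<times> 'a" where
  "PT_chart u = (\<lambda>(p, L). (p, THE v. v \<in> direction p L \<and> v \<bullet> u = 1))"

definition PT_submanifold :: "nat \<Rightarrow> ('a::euclidean_space \<times> 'a set) set \<Rightarrow> bool" where
  "PT_submanifold k \<alpha> \<longleftrightarrow>
     \<alpha> \<subseteq> PT \<and> (\<forall>u\<in>Basis. submanifold k (PT_chart u ` (\<alpha> \<inter> PT_dom u)))"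

definition smooth_into_PT ::
  "('a::euclidean_space \<Rightarrow> 'a \<times> 'a set) \<Rightarrow> 'a set \<Rightarrow> bool" where
  "smooth_into_PT s S \<longleftrightarrow>
     (\<forall>p\<in>S. \<exists>u\<in>Basis. \<exists>U. open U \<and> p \<in> U \<and> s ` (S \<inter> U) \<subseteq> PT_dom u \<and>
        smooth_on_subset (PT_chart u \<circ> s) (S \<inter> U))"


section \<open>Line-framed hypersurfaces and the projective reflection law\<close>

text \<open>Transversality of two linear subspaces.\<close>

definition transverse :: "'a::euclidean_space set \<Rightarrow> 'a set \<Rightarrow> bool" where
  "transverse V W \<longleftrightarrow> span (V \<union> W) = UNIV"

text \<open>The projection \<open>fst\<close> is smooth on all of \<^term>\<open>PT\<close>, so it restricts to a diffeomorphism from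
  \<open>\<alpha>\<close> onto its image \<open>a\<close> iff it is injective on \<open>\<alpha>\<close> and the inverse map is smooth on \<open>a\<close>.\<close>

definition line_framed_hypersurface :: "('a::euclidean_space \<times> 'a set) set \<Rightarrow> bool" where
  "line_framed_hypersurface \<alpha> \<longleftrightarrow>
     PT_submanifold (DIM('a) - 1) \<alpha> \<and>
     connectedin PT_topology \<alpha> \<and>
     submanifold (DIM('a) - 1) (fst ` \<alpha>) \<and>
     inj_on fst \<alpha> \<and> smooth_into_PT (inv_into \<alpha> fst) (fst ` \<alpha>) \<and>
     (\<forall>(p, L)\<in>\<alpha>. transverse (direction p L) (tangent_space (fst ` \<alpha>) p))"

text \<open>Lines through \<open>p\<close> in a plane through \<open>p\<close> are represented by their directions, the
  one-dimensional subspaces of the two-dimensional direction \<open>P\<close> of the plane. Projective maps of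
  this pencil are induced by linear automorphisms of \<open>P\<close>.\<close>

definition pencil_involution :: "'a::euclidean_space set \<Rightarrow> ('a \<Rightarrow> 'a) \<Rightarrow> bool" where
  "pencil_involution P f \<longleftrightarrow>
     linear f \<and> f ` P = P \<and>
     (\<exists>c. \<forall>x\<in>P. f (f x) = c *\<^sub>R x) \<and> \<not> (\<exists>c. \<forall>x\<in>P. f x = c *\<^sub>R x)"

definition harmonic_lines ::
  "'a::euclidean_space set \<Rightarrow> 'a set \<Rightarrow> 'a set \<Rightarrow> 'a set \<Rightarrow> 'a set \<Rightarrow> bool" where
  "harmonic_lines P A B C D \<longleftrightarrow>
     (\<exists>f. pencil_involution P f \<and> f ` A = B \<and> f ` B = A \<and> f ` C = C \<and> f ` D = D)"

definition opposite_sides :: "'a::euclidean_space set \<Rightarrow> 'a \<Rightarrow> 'a \<Rightarrow> bool" where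
  "opposite_sides H v w \<longleftrightarrow> (\<exists>n. H = {x. n \<bullet> x = 0} \<and> (n \<bullet> v) * (n \<bullet> w) < 0)"

text \<open>Oriented lines through \<open>p\<close> are represented by direction vectors: the line directed by \<open>v\<close>
  is reflected into the line directed by \<open>w\<close>. Only the classes of \<open>v\<close> and \<open>w\<close> modulo positive
  scalars matter.\<close>

definition reflects ::
  "('a::euclidean_space \<times> 'a set) set \<Rightarrow> 'a \<Rightarrow> 'a \<Rightarrow> 'a \<Rightarrow> bool" where
  "reflects \<alpha> p v w \<longleftrightarrow>
     (let H = tangent_space (fst ` \<alpha>) p in
      v \<noteq> 0 \<and> w \<noteq> 0 \<and> transverse (span {v}) H \<and>
      (\<exists>L P. (p, L) \<in> \<alpha> \<and>
         subspace P \<and> dim P = 2 \<and> v \<in> P \<and> w \<in> P \<and> direction p L \<subseteq> P \<and>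
         harmonic_lines P (span {v}) (span {w}) (direction p L) (H \<inter> P)) \<and>
      opposite_sides H v w)"


section \<open>Local projective billiards with three boundaries\<close>

text \<open>The three boundaries and the vertices of an orbit are indexed by the type \<^typ>\<open>3\<close>, whose
  arithmetic is modulo 3 (so the index \<open>3\<close> is \<open>0\<close>). All boundaries are \<open>C\<^sup>\<infinity>\<close>-smooth.\<close>

definition smooth_projective_billiard :: "(3 \<Rightarrow> ('a::euclidean_space \<times> 'a set) set) \<Rightarrow> bool" where
  "smooth_projective_billiard \<alpha> \<longleftrightarrow> (\<forall>j. line_framed_hypersurface (\<alpha> j))"

definition periodic_orbit :: "(3 \<Rightarrow> ('a::euclidean_space \<times> 'a set) set) \<Rightarrow> (3 \<Rightarrow> 'a) \<Rightarrow> bool" where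
  "periodic_orbit \<alpha> p \<longleftrightarrow>
     (\<forall>j. p j \<in> fst ` \<alpha> j \<and> p j \<noteq> p (j + 1) \<and>
        transverse (direction (p j) (line_through (p j) (p (j + 1))))
          (tangent_space (fst ` \<alpha> j) (p j)) \<and>
        transverse (direction (p (j + 1)) (line_through (p j) (p (j + 1))))
          (tangent_space (fst ` \<alpha> (j + 1)) (p (j + 1))) \<and>
        reflects (\<alpha> j) (p j) (p j - p (j - 1)) (p (j + 1) - p j))"

definition reflective :: "(3 \<Rightarrow> ('a::euclidean_space \<times> 'a set) set) \<Rightarrow> bool" where
  "reflective \<alpha> \<longleftrightarrow>
     (\<exists>U1 U2. openin (top_of_set (fst ` \<alpha> 1)) U1 \<and> openin (top_of_set (fst ` \<alpha> 2)) U2 \<and>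
        U1 \<times> U2 \<noteq> {} \<and>
        (\<forall>(p1, p2)\<in>U1 \<times> U2. \<exists>p. periodic_orbit \<alpha> p \<and> p 1 = p1 \<and> p 2 = p2))"

definition pseudo_reflective :: "(3 \<Rightarrow> ('a::euclidean_space \<times> 'a set) set) \<Rightarrow> bool" where
  "pseudo_reflective \<alpha> \<longleftrightarrow>
     (\<exists>E. E \<subseteq> fst ` \<alpha> 1 \<times> fst ` \<alpha> 2 \<and>
        measurable_in_submanifold (2 * (DIM('a) - 1)) (fst ` \<alpha> 1 \<times> fst ` \<alpha> 2) E \<and>
        \<not> null_in_submanifold (2 * (DIM('a) - 1)) (fst ` \<alpha> 1 \<times> fst ` \<alpha> 2) E \<and>
        (\<forall>(p1, p2)\<in>E. \<exists>p. periodic_orbit \<alpha> p \<and> p 1 = p1 \<and> p 2 = p2))"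


section \<open>Right-spherical billiards\<close>

text \<open>Points (lines) of the real projective plane are the one-dimensional (two-dimensional)
  subspaces of \<open>\<real>\<^sup>3\<close>; the affine plane is embedded by \<open>(x, y) \<mapsto> [x : y : 1]\<close>.\<close>

definition homogeneous :: "real^2 \<Rightarrow> real^3" where
  "homogeneous x = vector [x $ 1, x $ 2, 1]"

definition affine_part :: "(real^3) set \<Rightarrow> (real^2) set" where
  "affine_part X = {x. homogeneous x \<in> X}"

definition rp2_point :: "(real^3) set \<Rightarrow> bool" where
  "rp2_point X \<longleftrightarrow> subspace X \<and> dim X = 1"

definition rp2_line :: "(real^3) set \<Rightarrow> bool" where
  "rp2_line X \<longleftrightarrow> subspace X \<and> dim X = 2"

definition rp2_join :: "(real^3) set \<Rightarrow> (real^3) set \<Rightarrow> (real^3) set" where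
  "rp2_join X Y = span (X \<union> Y)"

definition non_collinear :: "(3 \<Rightarrow> (real^3) set) \<Rightarrow> bool" where
  "non_collinear P \<longleftrightarrow> \<not> (\<exists>l. rp2_line l \<and> (\<forall>j. P j \<subseteq> l))"

definition right_spherical_boundary :: "(3 \<Rightarrow> (real^3) set) \<Rightarrow> 3 \<Rightarrow> ((real^2) \<times> (real^2) set) set" where
  "right_spherical_boundary P j =
     {(p, affine_part (rp2_join (span {homogeneous p}) (P (j + 2)))) | p.
        p \<in> affine_part (rp2_join (P j) (P (j + 1)))}"

definition right_spherical :: "(3 \<Rightarrow> ((real^2) \<times> (real^2) set) set) \<Rightarrow> bool" where
  "right_spherical \<alpha> \<longleftrightarrow>
     (\<exists>p P. periodic_orbit \<alpha> p \<and> (\<forall>j. rp2_point (P j)) \<and> non_collinear P \<and>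
        (\<forall>j. \<exists>L N. (p j, L) \<in> \<alpha> j \<and> openin PT_topology N \<and> (p j, L) \<in> N \<and>
           \<alpha> j \<inter> N = right_spherical_boundary P j \<inter> N))"

end

theory Submission
  imports Defs
begin

text \<open>Differentiate the reflection law along the deformations of a triangular orbit \<open>ABC\<close> inside its plane
  that fix one of the vertices. The resulting relations between the motions of the other two vertices
  are compatible only if the framing lines at \<open>A\<close>, \<open>B\<close>, \<open>C\<close> satisfy Ceva's condition. Differentiating this
  condition determines the curvatures of the boundaries (along the plane) up to a common factor, and
  the equality of the mixed second derivatives of \<open>C\<close> as a function of \<open>(A, B)\<close> forces that factor to
  vanish. In the plane the boundaries are therefore straight, and by Ceva's condition every framing
  line passes through the intersection point of the other two boundaries. In higher dimension, as \<open>A\<close>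
  moves inside the plane of the orbit with \<open>B\<close> fixed, the plane is constant to first order while the
  common point of the framing lines at \<open>A\<close> and \<open>B\<close> moves with non-zero speed; this would force all
  tangent directions at \<open>B\<close> into the plane. For pseudo-reflective billiards all this takes place at those
  points of the given set at which every function vanishing on the set has zero derivative; almost
  every point of the set is of this kind.\<close>

section \<open>Maps of class \<open>C\<^sup>k\<close>\<close>

text \<open>The harmonic law becomes additive once direction vectors are scaled to have value 1 on
  the normal covector \<open>n\<close>: the two sides at a vertex are then \<open>M + t / 2\<close>
  and \<open>M - t / 2\<close> with \<open>t\<close> tangent, so \<open>2 M\<close> is the sum of
  the scaled sides, and their difference spans the tangent direction inside the orbit plane. The
  rest is algebra in the six numbers \<open>n_P . (Q - P)\<close>. Transferring the speed of a
  vertex around the triangle gives an equality of cubes, which over the reals is Ceva's condition.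
  Its derivatives in two directions express the curvatures at A and B by the one at C, and the
  symmetry of second derivatives then reads \<open>3 c1 c2 kC = 0\<close>. The obstacle is that the
  orbit conditions hold only on a set \<open>E\<close> that need not be open, while derivatives are
  taken in the ambient space. Each differentiation therefore costs one passage from a set to its
  flat points: the first gives the speeds and Ceva's condition, the second differentiates these, and
  no third one occurs. Hence the final results hold on \<open>flat N (flat N E)\<close>.\<close>

lemma ck_on_cong:
  fixes f g :: "'a::euclidean_space \<Rightarrow> 'b::euclidean_space"
  assumes "open S" "\<And>x. x \<in> S \<Longrightarrow> f x = g x"
  shows "ck_on k f S \<longleftrightarrow> ck_on k g S"
  using assms(2)
proof (induction k arbitrary: f g)
  case 0
  then show ?case
    by (simp cong: continuous_on_cong)
next
  case (Suc k)
  have d: "f differentiable (at x) \<longleftrightarrow> g differentiable (at x)" if "x \<in> S" for x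
    using has_derivative_transform_within_open[OF _ \<open>open S\<close> that] Suc.prems
    unfolding differentiable_def by metis
  have "ck_on k (\<lambda>x. frechet_derivative f (at x) v) S \<longleftrightarrow> ck_on k (\<lambda>x. frechet_derivative g (at x) v) S"
    if "\<forall>x\<in>S. f differentiable (at x)" for v
  proof (rule Suc.IH)
    fix x assume x: "x \<in> S"
    show "frechet_derivative f (at x) v = frechet_derivative g (at x) v"
      using frechet_derivative_transform_within_open[OF _ \<open>open S\<close> x] that x Suc.prems by metis
  qed
  with d show ?case
    by auto
qed

lemma ck_on_subset: "ck_on k f T \<Longrightarrow> S \<subseteq> T \<Longrightarrow> ck_on k f S"
  by (induction k arbitrary: f) (auto intro: continuous_on_subset)

lemma ck_on_Suc_imp: "ck_on (Suc k) f S \<Longrightarrow> ck_on k f S"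
proof (induction k arbitrary: f)
  case 0
  then have "f differentiable_on S"
    unfolding differentiable_on_def ck_on.simps by (meson differentiable_at_withinI)
  then show ?case
    by (simp add: differentiable_imp_continuous_on)
next
  case (Suc k)
  have "\<forall>x\<in>S. f differentiable (at x)" "\<And>v. ck_on (Suc k) (\<lambda>x. frechet_derivative f (at x) v) S"
    using Suc.prems unfolding ck_on.simps(2)[of "Suc k"] by blast+
  with Suc.IH show ?case
    unfolding ck_on.simps(2)[of k] by blast
qed

lemma ck_on_continuous: "ck_on k f S \<Longrightarrow> continuous_on S f"
proof (induction k)
  case (Suc k)
  from Suc.IH[OF ck_on_Suc_imp[OF Suc.prems]] show ?case .
qed simp

lemma ck_on_SucI:
  assumes "open S" "\<And>x. x \<in> S \<Longrightarrow> (f has_derivative f' x) (at x)"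
    and "\<And>v. ck_on k (\<lambda>x. f' x v) S"
  shows "ck_on (Suc k) f S"
proof -
  have "ck_on k (\<lambda>x. frechet_derivative f (at x) v) S" for v
    using assms(3)[of v] ck_on_cong[OF assms(1), of "\<lambda>x. frechet_derivative f (at x) v" "\<lambda>x. f' x v" k]
    by (simp add: frechet_derivative_at[OF assms(2), symmetric])
  moreover have "\<forall>x\<in>S. f differentiable (at x)"
    using assms(2) differentiable_def by blast
  ultimately show ?thesis
    by simp
qed

lemma ck_on_SucD:
  assumes "ck_on (Suc k) f S" "x \<in> S"
  shows "(f has_derivative frechet_derivative f (at x)) (at x)"
  using assms frechet_derivative_works by auto

lemma ck_on_const: "open S \<Longrightarrow> ck_on k (\<lambda>x. c) S"
proof (induction k arbitrary: c)
  case (Suc k)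
  show ?case
    by (rule ck_on_SucI[where f' = "\<lambda>_ _. 0", OF Suc.prems has_derivative_const Suc.IH[OF Suc.prems]])
qed simp

lemma ck_on_bounded_linear:
  assumes "bounded_linear L" "open S"
  shows "ck_on k L S"
proof (cases k)
  case 0
  then show ?thesis
    by (simp add: assms linear_continuous_on)
next
  case (Suc j)
  show ?thesis
    unfolding Suc
    by (rule ck_on_SucI[where f' = "\<lambda>_. L"])
      (use assms in \<open>auto intro: bounded_linear_imp_has_derivative ck_on_const\<close>)
qed

lemma ck_on_bounded_linear_comp:
  assumes "bounded_linear L" "open S"
  shows "ck_on k f S \<Longrightarrow> ck_on k (\<lambda>x. L (f x)) S"
proof (induction k arbitrary: f)
  case 0
  then show ?case
    using bounded_linear.continuous_on[OF assms(1)] by auto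
next
  case (Suc k)
  show ?case
  proof (rule ck_on_SucI[OF \<open>open S\<close>])
    show "((\<lambda>x. L (f x)) has_derivative (\<lambda>v. L (frechet_derivative f (at x) v))) (at x)"
      if "x \<in> S" for x
      by (rule bounded_linear.has_derivative[OF assms(1) ck_on_SucD[OF Suc.prems that]])
    show "ck_on k (\<lambda>x. L (frechet_derivative f (at x) v)) S" for v
      using Suc by auto
  qed
qed

text \<open>For an affine inner map the derivative is again a composition of the same form, with
  \<open>f\<close> replaced by its derivative along the fixed vector \<open>h v\<close>, so the
  induction closes without a higher-order chain rule.\<close>

lemma ck_on_comp_affine:
  assumes "bounded_linear h" "open S"
  shows "ck_on k f S \<Longrightarrow> ck_on k (\<lambda>x. f (c + h x)) {x. c + h x \<in> S}"
proof (induction k arbitrary: f)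
  case 0
  have "continuous_on {x. c + h x \<in> S} (\<lambda>x. c + h x)"
    by (intro continuous_intros linear_continuous_on assms)
  then show ?case
    using 0 by (auto intro: continuous_on_compose2)
next
  case (Suc k)
  have o: "open {x. c + h x \<in> S}"
    using open_vimage[OF assms(2), of "\<lambda>x. c + h x"]
      continuous_on_add[OF continuous_on_const linear_continuous_on[OF assms(1)]]
    by (simp add: vimage_def)
  show ?case
  proof (rule ck_on_SucI[OF o])
    fix x assume "x \<in> {x. c + h x \<in> S}"
    then have f: "(f has_derivative frechet_derivative f (at (c + h x))) (at (c + h x))"
      using ck_on_SucD[OF Suc.prems] by auto
    have "((\<lambda>x. c + h x) has_derivative h) (at x)"
      using bounded_linear_imp_has_derivative[OF assms(1)] by (auto intro!: derivative_eq_intros)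
    from has_derivative_compose[OF this f]
    show "((\<lambda>x. f (c + h x)) has_derivative (\<lambda>v. frechet_derivative f (at (c + h x)) (h v))) (at x)" .
  next
    fix v
    show "ck_on k (\<lambda>x. frechet_derivative f (at (c + h x)) (h v)) {x. c + h x \<in> S}"
      using Suc by auto
  qed
qed

lemma ck_on_add:
  assumes "open S"
  shows "ck_on k f S \<Longrightarrow> ck_on k g S \<Longrightarrow> ck_on k (\<lambda>x. f x + g x) S"
proof (induction k arbitrary: f g)
  case 0
  then show ?case
    by (auto intro: continuous_intros)
next
  case (Suc k)
  show ?case
    by (rule ck_on_SucI[OF assms has_derivative_add[OF ck_on_SucD[OF Suc.prems(1)] ck_on_SucD[OF Suc.prems(2)]]])
      (use Suc in auto)
qed

lemma ck_on_bilinear: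
  assumes "bounded_bilinear B" "open S"
  shows "ck_on k f S \<Longrightarrow> ck_on k g S \<Longrightarrow> ck_on k (\<lambda>x. B (f x) (g x)) S"
proof (induction k arbitrary: f g)
  case 0
  then show ?case
    using bounded_bilinear.continuous_on[OF assms(1)] by auto
next
  case (Suc k)
  show ?case
    by (rule ck_on_SucI[OF assms(2) bounded_bilinear.FDERIV[OF assms(1) ck_on_SucD[OF Suc.prems(1)]
            ck_on_SucD[OF Suc.prems(2)]]])
      (use Suc.prems Suc.prems[THEN ck_on_Suc_imp] in \<open>auto intro!: ck_on_add[OF assms(2)] Suc.IH\<close>)
qed

lemmas ck_on_inner = ck_on_bilinear[OF bounded_bilinear_inner]
lemmas ck_on_scaleR = ck_on_bilinear[OF bounded_bilinear_scaleR]
lemmas ck_on_mult = ck_on_bilinear[OF bounded_bilinear_mult]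

lemma ck_on_minus: "open S \<Longrightarrow> ck_on k f S \<Longrightarrow> ck_on k (\<lambda>x. - f x) S"
  by (rule ck_on_bounded_linear_comp[OF bounded_linear_minus[OF bounded_linear_ident]])

lemma ck_on_diff: "open S \<Longrightarrow> ck_on k f S \<Longrightarrow> ck_on k g S \<Longrightarrow> ck_on k (\<lambda>x. f x - g x) S"
  using ck_on_add[of S k f "\<lambda>x. - g x"] ck_on_minus[of S k g] by simp

text \<open>The derivative of \<open>1 / f\<close> is a product of \<open>1 / f\<close> with itself
  and the derivative of \<open>f\<close>, so the induction hypothesis for \<open>1 / f\<close> gives
  the next order.\<close>

lemma ck_on_inverse:
  fixes f :: "'a::euclidean_space \<Rightarrow> real"
  assumes "open S" "\<And>x. x \<in> S \<Longrightarrow> f x \<noteq> 0"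
  shows "ck_on k f S \<Longrightarrow> ck_on k (\<lambda>x. inverse (f x)) S"
proof (induction k)
  case 0
  with assms show ?case
    by (auto intro!: continuous_intros)
next
  case (Suc k)
  have i: "ck_on k (\<lambda>x. inverse (f x)) S"
    using Suc ck_on_Suc_imp by auto
  show ?case
  proof (rule ck_on_SucI[OF assms(1)])
    show "((\<lambda>x. inverse (f x)) has_derivative
        (\<lambda>v. - (inverse (f x) * frechet_derivative f (at x) v * inverse (f x)))) (at x)" if "x \<in> S" for x
      by (rule Deriv.has_derivative_inverse[OF assms(2)[OF that] ck_on_SucD[OF Suc.prems that]])
    show "ck_on k (\<lambda>x. - (inverse (f x) * frechet_derivative f (at x) v * inverse (f x))) S" for v
      by (intro ck_on_minus ck_on_mult i assms) (use Suc.prems in auto)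
  qed
qed

section \<open>Symmetry of second derivatives\<close>

lemma ck_on_2D:
  assumes "ck_on 2 f S" "x \<in> S"
  shows "(f has_derivative frechet_derivative f (at x)) (at x)"
    and "((\<lambda>x. frechet_derivative f (at x) v) has_derivative
      frechet_derivative (\<lambda>x. frechet_derivative f (at x) v) (at x)) (at x)"
  using assms by (simp_all add: numeral_2_eq_2 frechet_derivative_works[symmetric])

text \<open>The second difference of \<open>f\<close> along \<open>u\<close> and \<open>v\<close> is a value of either iterated derivative, by two
  applications of the mean value theorem.\<close>

lemma second_difference:
  fixes f :: "'a::euclidean_space \<Rightarrow> real"
  assumes S: "\<And>s t. s \<in> {0..h} \<Longrightarrow> t \<in> {0..h} \<Longrightarrow> x + s *\<^sub>R u + t *\<^sub>R v \<in> S"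
    and f: "ck_on 2 f S" and h: "h > 0"
  obtains s t where "s \<in> {0..h}" "t \<in> {0..h}"
    "f (x + h *\<^sub>R u + h *\<^sub>R v) - f (x + h *\<^sub>R u) - f (x + h *\<^sub>R v) + f x =
      h * h * frechet_derivative (\<lambda>y. frechet_derivative f (at y) u) (at (x + s *\<^sub>R u + t *\<^sub>R v)) v"
proof -
  define D where "D y = frechet_derivative f (at y)" for y
  define D2 where "D2 y = frechet_derivative (\<lambda>y. D y u) (at y)" for y
  have Df: "(f has_derivative D y) (at y)" if "y \<in> S" for y
    using ck_on_2D(1)[OF f that] by (simp add: D_def)
  have DDf: "((\<lambda>y. D y u) has_derivative D2 y) (at y)" if "y \<in> S" for y
    using ck_on_2D(2)[OF f that] by (simp add: D_def D2_def)
  define g where "g s = f (x + s *\<^sub>R u + h *\<^sub>R v) - f (x + s *\<^sub>R u)" for s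
  have dg: "(g has_real_derivative D (x + s *\<^sub>R u + h *\<^sub>R v) u - D (x + s *\<^sub>R u) u) (at s)"
    if "0 \<le> s" "s \<le> h" for s
  proof -
    have 1: "((\<lambda>s. f (x + s *\<^sub>R u + h *\<^sub>R v)) has_derivative (\<lambda>r. D (x + s *\<^sub>R u + h *\<^sub>R v) (r *\<^sub>R u))) (at s)"
      by (rule has_derivative_compose[OF _ Df, where f = "\<lambda>s. x + s *\<^sub>R u + h *\<^sub>R v"])
        (use S[of s h] that h in \<open>auto intro!: derivative_eq_intros\<close>)
    have 2: "((\<lambda>s. f (x + s *\<^sub>R u)) has_derivative (\<lambda>r. D (x + s *\<^sub>R u) (r *\<^sub>R u))) (at s)"
      by (rule has_derivative_compose[OF _ Df, where f = "\<lambda>s. x + s *\<^sub>R u"])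
        (use S[of s 0] that h in \<open>auto intro!: derivative_eq_intros\<close>)
    have "linear (D (x + s *\<^sub>R u + h *\<^sub>R v))" "linear (D (x + s *\<^sub>R u))"
      using Df[of "x + s *\<^sub>R u + h *\<^sub>R v"] Df[of "x + s *\<^sub>R u"] S[of s h] S[of s 0] that h
      by (auto simp: has_derivative_def bounded_linear.linear)
    then have "(\<lambda>r. D (x + s *\<^sub>R u + h *\<^sub>R v) (r *\<^sub>R u) - D (x + s *\<^sub>R u) (r *\<^sub>R u)) =
        (*) (D (x + s *\<^sub>R u + h *\<^sub>R v) u - D (x + s *\<^sub>R u) u)"
      by (simp add: fun_eq_iff linear_scale algebra_simps)
    with has_derivative_diff[OF 1 2] show ?thesis
      unfolding g_def has_field_derivative_def by simp
  qed
  obtain s where s: "0 < s" "s < h" "g h - g 0 = (h - 0) * (D (x + s *\<^sub>R u + h *\<^sub>R v) u - D (x + s *\<^sub>R u) u)"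
    using MVT2[OF h dg] by auto
  define k where "k t = D (x + s *\<^sub>R u + t *\<^sub>R v) u" for t
  have dk: "(k has_real_derivative D2 (x + s *\<^sub>R u + t *\<^sub>R v) v) (at t)"
    if "0 \<le> t" "t \<le> h" for t
  proof -
    have in_S: "x + s *\<^sub>R u + t *\<^sub>R v \<in> S"
      using S s that by auto
    have "((\<lambda>t. D (x + s *\<^sub>R u + t *\<^sub>R v) u) has_derivative (\<lambda>r. D2 (x + s *\<^sub>R u + t *\<^sub>R v) (r *\<^sub>R v))) (at t)"
      by (rule has_derivative_compose[where f = "\<lambda>t. x + s *\<^sub>R u + t *\<^sub>R v" and g = "\<lambda>y. D y u"
            and g' = "D2 (x + s *\<^sub>R u + t *\<^sub>R v)", OF _ DDf[OF in_S]])
        (auto intro!: derivative_eq_intros)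
    moreover have "linear (D2 (x + s *\<^sub>R u + t *\<^sub>R v))"
      using DDf[OF in_S] by (auto simp: has_derivative_def bounded_linear.linear)
    then have "(\<lambda>r. D2 (x + s *\<^sub>R u + t *\<^sub>R v) (r *\<^sub>R v)) = (*) (D2 (x + s *\<^sub>R u + t *\<^sub>R v) v)"
      by (simp add: fun_eq_iff linear_scale)
    ultimately show ?thesis
      unfolding k_def has_field_derivative_def by simp
  qed
  obtain t where t: "0 < t" "t < h" "k h - k 0 = (h - 0) * D2 (x + s *\<^sub>R u + t *\<^sub>R v) v"
    using MVT2[OF h dk] by auto
  have "f (x + h *\<^sub>R u + h *\<^sub>R v) - f (x + h *\<^sub>R u) - f (x + h *\<^sub>R v) + f x = g h - g 0"
    by (simp add: g_def)
  also have "\<dots> = h * h * D2 (x + s *\<^sub>R u + t *\<^sub>R v) v"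
    using s(3) t(3) by (simp add: k_def)
  finally show ?thesis
    using that[of s t] s t by (auto simp: D_def D2_def)
qed

text \<open>One and the same second difference is a value of either mixed derivative, but at
  different points of a small parallelogram. Continuity at \<open>x\<close> removes the
  displacement.\<close>

lemma symmetric_second_derivative_real:
  fixes f :: "'a::euclidean_space \<Rightarrow> real"
  assumes S: "open S" "x \<in> S" and f: "ck_on 2 f S"
  shows "frechet_derivative (\<lambda>y. frechet_derivative f (at y) u) (at x) v =
    frechet_derivative (\<lambda>y. frechet_derivative f (at y) v) (at x) u"
proof -
  let ?D = "\<lambda>u v y. frechet_derivative (\<lambda>y. frechet_derivative f (at y) u) (at y) v"
  have cont: "isCont (?D u v) x" for u v
    using f S by (auto simp: numeral_2_eq_2 continuous_on_eq_continuous_at)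
  obtain r where r: "r > 0" "ball x r \<subseteq> S"
    using S openE by blast
  have near: "\<exists>y z. dist y x < d \<and> dist z x < d \<and> ?D u v y = ?D v u z" if "d > 0" for d
  proof -
    \<comment> \<open>The step \<open>h\<close> is chosen so small that the whole parallelogram
      stays within \<open>min r d\<close> of \<open>x\<close>; the summand 1 keeps \<open>c\<close>
      positive when \<open>u\<close> and \<open>v\<close> vanish.\<close>
    define c where "c = norm u + norm v + 1"
    define h where "h = min r d / (2 * c)"
    have c: "c > 0" "c \<ge> norm u + norm v"
      by (auto simp: c_def add_nonneg_pos)
    have h: "h > 0" "h * c < r" "h * c < d"
      using r that c by (auto simp: h_def field_simps min_def)
    have near: "dist (x + s *\<^sub>R a + t *\<^sub>R b) x < min r d"
      if "s \<in> {0..h}" "t \<in> {0..h}" "norm a + norm b = norm u + norm v" for s t a b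
    proof -
      have "dist (x + s *\<^sub>R a + t *\<^sub>R b) x \<le> s * norm a + t * norm b"
        using that norm_triangle_ineq[of "s *\<^sub>R a" "t *\<^sub>R b"] by (simp add: dist_norm)
      also have "\<dots> \<le> h * norm a + h * norm b"
        using that by (intro add_mono mult_right_mono) auto
      also have "\<dots> \<le> h * c"
        using that c h by (simp add: distrib_left[symmetric])
      finally show ?thesis
        using h by simp
    qed
    then have "\<And>s t. s \<in> {0..h} \<Longrightarrow> t \<in> {0..h} \<Longrightarrow> x + s *\<^sub>R u + t *\<^sub>R v \<in> S"
      and "\<And>s t. s \<in> {0..h} \<Longrightarrow> t \<in> {0..h} \<Longrightarrow> x + s *\<^sub>R v + t *\<^sub>R u \<in> S"
      using r by (auto simp: mem_ball dist_commute subset_eq)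
    then obtain s t s' t' where st: "s \<in> {0..h}" "t \<in> {0..h}" "s' \<in> {0..h}" "t' \<in> {0..h}"
      and 1: "f (x + h *\<^sub>R u + h *\<^sub>R v) - f (x + h *\<^sub>R u) - f (x + h *\<^sub>R v) + f x =
          h * h * ?D u v (x + s *\<^sub>R u + t *\<^sub>R v)"
      and 2: "f (x + h *\<^sub>R v + h *\<^sub>R u) - f (x + h *\<^sub>R v) - f (x + h *\<^sub>R u) + f x =
          h * h * ?D v u (x + s' *\<^sub>R v + t' *\<^sub>R u)"
      using second_difference[of h x u v S f] second_difference[of h x v u S f] f h by metis
    have "h * h * ?D u v (x + s *\<^sub>R u + t *\<^sub>R v) = h * h * ?D v u (x + s' *\<^sub>R v + t' *\<^sub>R u)"
      using 1 2 by (simp add: algebra_simps)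
    then have "?D u v (x + s *\<^sub>R u + t *\<^sub>R v) = ?D v u (x + s' *\<^sub>R v + t' *\<^sub>R u)"
      using h by auto
    then show ?thesis
      using near[OF st(1,2)] near[OF st(3,4)] by (metis add.commute min_less_iff_conj)
  qed
  show ?thesis
  proof (rule ccontr)
    assume neq: "?D u v x \<noteq> ?D v u x"
    define e where "e = \<bar>?D u v x - ?D v u x\<bar> / 2"
    have "e > 0"
      using neq by (simp add: e_def)
    obtain d1 where d1: "d1 > 0" "\<And>y. dist y x < d1 \<Longrightarrow> dist (?D u v y) (?D u v x) < e"
      using cont[of u v] \<open>e > 0\<close> unfolding continuous_at_eps_delta by blast
    obtain d2 where d2: "d2 > 0" "\<And>y. dist y x < d2 \<Longrightarrow> dist (?D v u y) (?D v u x) < e"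
      using cont[of v u] \<open>e > 0\<close> unfolding continuous_at_eps_delta by blast
    obtain y z where yz: "dist y x < min d1 d2" "dist z x < min d1 d2" "?D u v y = ?D v u z"
      using near[of "min d1 d2"] d1 d2 by auto
    show False
      using d1(2)[of y] d2(2)[of z] yz dist_triangle_half_r[of "?D u v y" "?D u v x" "2 * e" "?D v u x"]
      by (simp add: dist_real_def e_def)
  qed
qed

lemma symmetric_second_derivative:
  fixes f :: "'a::euclidean_space \<Rightarrow> 'b::euclidean_space"
  assumes S: "open S" "x \<in> S" and f: "ck_on 2 f S"
  shows "frechet_derivative (\<lambda>y. frechet_derivative f (at y) u) (at x) v =
    frechet_derivative (\<lambda>y. frechet_derivative f (at y) v) (at x) u"
proof (rule euclidean_eqI)
  fix b :: 'b assume "b \<in> Basis"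
  have fb: "ck_on 2 (\<lambda>x. f x \<bullet> b) S"
    by (rule ck_on_bounded_linear_comp[OF bounded_linear_inner_left S(1) f])
  have 1: "frechet_derivative (\<lambda>x. f x \<bullet> b) (at y) u = frechet_derivative f (at y) u \<bullet> b" if "y \<in> S" for y u
    using frechet_derivative_at[OF bounded_linear.has_derivative[OF bounded_linear_inner_left ck_on_2D(1)[OF f that]], of b]
    by metis
  have 2: "frechet_derivative (\<lambda>y. frechet_derivative (\<lambda>x. f x \<bullet> b) (at y) u) (at x) v =
      frechet_derivative (\<lambda>y. frechet_derivative f (at y) u) (at x) v \<bullet> b" for u v
  proof -
    have "((\<lambda>y. frechet_derivative f (at y) u \<bullet> b) has_derivative
        (\<lambda>v. frechet_derivative (\<lambda>y. frechet_derivative f (at y) u) (at x) v \<bullet> b)) (at x)"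
      by (rule bounded_linear.has_derivative[OF bounded_linear_inner_left ck_on_2D(2)[OF f S(2)]])
    then have "((\<lambda>y. frechet_derivative (\<lambda>x. f x \<bullet> b) (at y) u) has_derivative
        (\<lambda>v. frechet_derivative (\<lambda>y. frechet_derivative f (at y) u) (at x) v \<bullet> b)) (at x)"
      by (rule has_derivative_transform_within_open[OF _ S]) (simp add: 1)
    from frechet_derivative_at[OF this] show ?thesis
      by metis
  qed
  show "frechet_derivative (\<lambda>y. frechet_derivative f (at y) u) (at x) v \<bullet> b =
    frechet_derivative (\<lambda>y. frechet_derivative f (at y) v) (at x) u \<bullet> b"
    using symmetric_second_derivative_real[OF S fb, of u v] by (simp add: 2)
qed

section \<open>Flat points\<close>

text \<open>At a flat point of \<open>E\<close>, identities that hold on \<open>E\<close> may be differentiated along \<open>N\<close>.\<close>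

definition flat :: "('a::real_normed_vector \<Rightarrow> 'a set) \<Rightarrow> 'a set \<Rightarrow> 'a set" where
  "flat N E = {x\<in>E. \<forall>(g::'a \<Rightarrow> real) g'. (g has_derivative g') (at x) \<and> (\<forall>y\<in>E. g y = 0) \<longrightarrow> (\<forall>v\<in>N x. g' v = 0)}"

lemma flat_subset: "flat N E \<subseteq> E"
  by (auto simp: flat_def)

lemma flat_mono: "E \<subseteq> F \<Longrightarrow> flat N E \<subseteq> flat N F"
  unfolding flat_def by blast

text \<open>A function vanishing only on \<open>E \<inter> W\<close> is cut off to 0 outside
  \<open>W\<close>; this does not affect its derivative at a point of the open set
  \<open>W\<close>.\<close>

lemma flat_Int_open:
  assumes "open W"
  shows "flat N E \<inter> W \<subseteq> flat N (E \<inter> W)"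
proof
  fix x assume x: "x \<in> flat N E \<inter> W"
  have "\<forall>v\<in>N x. g' v = 0" if g: "(g has_derivative g') (at x)" "\<forall>y\<in>E \<inter> W. g y = 0" for g :: "_ \<Rightarrow> real" and g'
  proof -
    have "((\<lambda>y. if y \<in> W then g y else 0) has_derivative g') (at x)"
      by (rule has_derivative_transform_within_open[OF g(1) assms]) (use x in auto)
    moreover have "\<forall>y\<in>E. (if y \<in> W then g y else 0) = 0"
      using g(2) by simp
    ultimately show ?thesis
      using x unfolding flat_def by blast
  qed
  with x show "x \<in> flat N (E \<inter> W)"
    by (auto simp: flat_def)
qed

lemma flatD:
  fixes f g :: "'a::real_normed_vector \<Rightarrow> 'b::euclidean_space"
  assumes x: "x \<in> flat N E" and f: "(f has_derivative f') (at x)" and g: "(g has_derivative g') (at x)"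
    and eq: "\<And>y. y \<in> E \<Longrightarrow> f y = g y" and v: "v \<in> N x"
  shows "f' v = g' v"
proof (rule euclidean_eqI)
  fix b :: 'b
  have "((\<lambda>y. (f y - g y) \<bullet> b) has_derivative (\<lambda>v. (f' v - g' v) \<bullet> b)) (at x)"
    using f g by (auto intro!: derivative_eq_intros)
  moreover have "\<forall>y\<in>E. (f y - g y) \<bullet> b = 0"
    using eq by simp
  ultimately have "(f' v - g' v) \<bullet> b = 0"
    using x v unfolding flat_def by blast
  then show "f' v \<bullet> b = g' v \<bullet> b"
    by (simp add: inner_diff_left)
qed

lemma flatI_curves:
  assumes "x \<in> E"
    and "\<And>v. v \<in> N x \<Longrightarrow> \<exists>\<gamma> e. e > 0 \<and> \<gamma> 0 = x \<and> (\<forall>t\<in>{-e<..<e::real}. \<gamma> t \<in> E) \<and> (\<gamma> has_vector_derivative v) (at 0)"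
  shows "x \<in> flat N E"
proof -
  have "g' v = 0" if g: "(g has_derivative g') (at x)" "\<forall>y\<in>E. g y = 0" and v: "v \<in> N x" for g :: "_ \<Rightarrow> real" and g' v
  proof -
    obtain \<gamma> e where \<gamma>: "e > 0" "\<gamma> 0 = x" "\<forall>t\<in>{-e<..<e::real}. \<gamma> t \<in> E" "(\<gamma> has_vector_derivative v) (at 0)"
      using assms(2)[OF v] by blast
    have "((\<lambda>t. g (\<gamma> t)) has_derivative (\<lambda>r. g' (r *\<^sub>R v))) (at 0)"
      using has_derivative_compose[where f = \<gamma> and f' = "\<lambda>r. r *\<^sub>R v" and x = 0 and g = g and g' = g'] \<gamma>(2,4) g(1)
      by (simp add: has_vector_derivative_def)
    moreover have "((\<lambda>t. g (\<gamma> t)) has_derivative (\<lambda>r. 0)) (at 0)"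
      by (rule has_derivative_transform_within_open[OF has_derivative_const[where c = 0] open_greaterThanLessThan[of "-e" e]])
        (use \<gamma> g in auto)
    ultimately have "(\<lambda>r. g' (r *\<^sub>R v)) = (\<lambda>r. 0)"
      by (rule has_derivative_unique)
    then show ?thesis
      by (metis scaleR_one)
  qed
  with assms(1) show ?thesis
    by (auto simp: flat_def)
qed

text \<open>A test function on \<open>E\<close> is pulled back along \<open>F\<close> to a test
  function on \<open>K\<close>. As the derivative of \<open>F\<close> reaches all of
  \<open>N (F x)\<close>, flatness in every direction on \<open>K\<close> becomes flatness along
  \<open>N\<close> on \<open>E\<close>. This transports the almost-everywhere statement from a
  Euclidean space to a submanifold.\<close>

lemma flat_image:
  assumes "F ` K \<subseteq> E"
    and "\<And>x. x \<in> K \<Longrightarrow> \<exists>F'. (F has_derivative F') (at x) \<and> N (F x) \<subseteq> range F'"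
  shows "F ` flat (\<lambda>_. UNIV) K \<subseteq> flat N E"
proof clarify
  fix x assume x: "x \<in> flat (\<lambda>_. UNIV) K"
  then have "x \<in> K"
    using flat_subset by blast
  then obtain F' where F': "(F has_derivative F') (at x)" "N (F x) \<subseteq> range F'"
    using assms(2) by blast
  have "g' v = 0" if g: "(g has_derivative g') (at (F x))" "\<forall>y\<in>E. g y = 0" and v: "v \<in> N (F x)" for g :: "_ \<Rightarrow> real" and g' v
  proof -
    obtain w where w: "v = F' w"
      using F' v by blast
    have "((\<lambda>y. g (F y)) has_derivative (\<lambda>v. g' (F' v))) (at x)"
      by (rule has_derivative_compose[OF F'(1) g(1)])
    moreover have "\<forall>y\<in>K. g (F y) = 0"
      using g(2) assms(1) by blast
    ultimately show ?thesis
      using x w unfolding flat_def by blast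
  qed
  with assms(1) \<open>x \<in> K\<close> show "F x \<in> flat N E"
    by (auto simp: flat_def)
qed

section \<open>Non-flat points form a null set\<close>

lemma thin_slab:
  fixes w :: "'a::euclidean_space"
  assumes "w \<noteq> 0" "e > 0"
  obtains \<epsilon> where "\<epsilon> > 0" "{z \<in> ball 0 1. \<bar>w \<bullet> z\<bar> \<le> \<epsilon>} \<in> lmeasurable"
    "measure lebesgue {z \<in> ball 0 1. \<bar>w \<bullet> z\<bar> \<le> \<epsilon>} < e"
proof -
  define A where "A i = {z \<in> ball 0 (1::real). \<bar>w \<bullet> z\<bar> \<le> 1 / real (Suc i)}" for i
  have A: "A i \<in> lmeasurable" for i
  proof -
    have "A i = ball 0 1 \<inter> {z. \<bar>w \<bullet> z\<bar> \<le> 1 / real (Suc i)}"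
      by (auto simp: A_def)
    moreover have "closed {z. \<bar>w \<bullet> z\<bar> \<le> 1 / real (Suc i)}"
      by (intro closed_Collect_le continuous_intros)
    ultimately show ?thesis
      by (simp add: fmeasurable_Int_fmeasurable borel_closed)
  qed
  \<comment> \<open>The slabs decrease to a set inside a hyperplane, which is null, so their
    measures tend to 0.\<close>
  have "(\<lambda>i. measure lebesgue (A i)) \<longlonglongrightarrow> measure lebesgue (\<Inter>i. A i)"
  proof (rule Lim_measure_decseq)
    show "range A \<subseteq> sets lebesgue"
      using A by auto
    show "decseq A"
    proof (rule decseq_SucI)
      fix i
      have "1 / real (Suc (Suc i)) \<le> 1 / real (Suc i)"
        by (simp add: field_simps)
      then show "A (Suc i) \<le> A i"
        unfolding A_def by auto
    qed
    show "emeasure lebesgue (A i) \<noteq> \<infinity>" for i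
      using A[of i] by (auto simp: fmeasurable_def)
  qed
  moreover have "(\<Inter>i. A i) \<subseteq> {z. w \<bullet> z = 0}"
  proof
    fix z assume z: "z \<in> (\<Inter>i. A i)"
    have "\<bar>w \<bullet> z\<bar> < r" if "r > 0" for r
    proof -
      obtain i where "1 / real (Suc i) < r"
        using \<open>r > 0\<close> nat_approx_posE by metis
      moreover have "\<bar>w \<bullet> z\<bar> \<le> 1 / real (Suc i)"
        using z unfolding A_def by blast
      ultimately show ?thesis
        by linarith
    qed
    then have "w \<bullet> z = 0"
      by (metis less_irrefl zero_less_abs_iff)
    then show "z \<in> {z. w \<bullet> z = 0}"
      by simp
  qed
  then have "negligible (\<Inter>i. A i)"
    using negligible_hyperplane[of w 0] assms(1) negligible_subset by blast
  then have "measure lebesgue (\<Inter>i. A i) = 0"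
    using negligible_imp_measure0 by blast
  ultimately have "\<forall>\<^sub>F i in sequentially. measure lebesgue (A i) < e"
    using assms(2) by (simp add: order_tendstoD)
  then obtain i where "measure lebesgue (A i) < e"
    by (auto simp: eventually_sequentially)
  then show ?thesis
    using that[of "1 / real (Suc i)"] A[of i] by (simp add: A_def)
qed

text \<open>Near a point where a function vanishing on \<open>K\<close> has a non-zero derivative, \<open>K\<close> lies in a thin
  slab, so such points form a set of density zero.\<close>

lemma negligible_nonflat:
  fixes K :: "'a::euclidean_space set"
  shows "negligible (K - flat (\<lambda>_. UNIV) K)" (is "negligible ?N")
  unfolding negligible_eq_zero_density
proof (intro ballI allI impI)
  fix x and r e :: real
  assume x: "x \<in> ?N" and r: "r > 0" and e: "e > 0"
  obtain g :: "'a \<Rightarrow> real" and g' v where g: "(g has_derivative g') (at x)" "\<forall>y\<in>K. g y = 0" and v: "g' v \<noteq> 0"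
    using x by (auto simp: flat_def)
  have "linear g'"
    using g(1) by (simp add: has_derivative_def bounded_linear.linear)
  define w where "w = adjoint g' 1"
  have w: "g' y = w \<bullet> y" for y
    using adjoint_works[OF \<open>linear g'\<close>, of y 1] by (simp add: w_def inner_commute)
  have "w \<noteq> 0"
    using v w by auto
  \<comment> \<open>The slab is chosen in the unit ball; scaling by \<open>d\<close> preserves the
    ratio of the measures of slab and ball.\<close>
  have "e * measure lebesgue (ball (0::'a) 1) > 0"
    using e by (simp add: content_ball_pos)
  then obtain \<epsilon> where \<epsilon>: "\<epsilon> > 0" and S: "{z \<in> ball 0 1. \<bar>w \<bullet> z\<bar> \<le> \<epsilon>} \<in> lmeasurable"
    "measure lebesgue {z \<in> ball 0 1. \<bar>w \<bullet> z\<bar> \<le> \<epsilon>} < e * measure lebesgue (ball (0::'a) 1)"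
    using thin_slab[OF \<open>w \<noteq> 0\<close>] by blast
  define S where "S = {z \<in> ball 0 1. \<bar>w \<bullet> z\<bar> \<le> \<epsilon>}"
  obtain d0 where d0: "d0 > 0" "\<And>y. norm (y - x) < d0 \<Longrightarrow> norm (g y - g x - g' (y - x)) \<le> \<epsilon> * norm (y - x)"
    using g(1) \<epsilon> unfolding has_derivative_at_alt by blast
  define d where "d = min d0 r"
  have d: "d > 0" "d \<le> r" "d \<le> d0"
    using d0 r by (auto simp: d_def)
  have image_S: "(\<lambda>z. d *\<^sub>R z + x) ` S = ball x d \<inter> {y. \<bar>w \<bullet> (y - x)\<bar> \<le> \<epsilon> * d}"
  proof (intro equalityI subsetI)
    fix y assume "y \<in> ball x d \<inter> {y. \<bar>w \<bullet> (y - x)\<bar> \<le> \<epsilon> * d}"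
    then have "\<bar>w \<bullet> (y - x)\<bar> / d \<le> \<epsilon>" "norm (y - x) / d < 1"
      using d by (simp_all add: field_simps dist_norm norm_minus_commute)
    then have "(1 / d) *\<^sub>R (y - x) \<in> S"
      using d unfolding S_def by (simp add: abs_mult del: scaleR_diff_right)
    moreover have "y = d *\<^sub>R ((1 / d) *\<^sub>R (y - x)) + x"
      using d by simp
    ultimately show "y \<in> (\<lambda>z. d *\<^sub>R z + x) ` S"
      by blast
  next
    fix y assume "y \<in> (\<lambda>z. d *\<^sub>R z + x) ` S"
    then show "y \<in> ball x d \<inter> {y. \<bar>w \<bullet> (y - x)\<bar> \<le> \<epsilon> * d}"
      using d \<epsilon> by (auto simp: S_def dist_norm abs_mult mult.commute)
  qed
  show "\<exists>d. 0 < d \<and> d \<le> r \<and> (\<exists>U. ?N \<inter> ball x d \<subseteq> U \<and> U \<in> lmeasurable \<and>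
      measure lebesgue U < e * measure lebesgue (ball x d))"
  proof (intro exI conjI)
    show "0 < d" "d \<le> r"
      by (fact d)+
    show "?N \<inter> ball x d \<subseteq> (\<lambda>z. d *\<^sub>R z + x) ` S"
    proof
      fix y assume y: "y \<in> ?N \<inter> ball x d"
      then have n: "norm (y - x) < d"
        by (simp add: dist_norm norm_minus_commute)
      \<comment> \<open>Both \<open>g y\<close> and \<open>g x\<close> vanish, so the remainder
        estimate bounds the linear term alone.\<close>
      have "\<bar>w \<bullet> (y - x)\<bar> \<le> \<epsilon> * norm (y - x)"
        using d0(2)[of y] n d y x g(2) by (simp add: w)
      also have "\<dots> \<le> \<epsilon> * d"
        using n \<epsilon> by simp
      finally show "y \<in> (\<lambda>z. d *\<^sub>R z + x) ` S"
        using n unfolding image_S by (simp add: dist_norm norm_minus_commute)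
    qed
    have "closed {y. \<bar>w \<bullet> (y - x)\<bar> \<le> \<epsilon> * d}"
      by (intro closed_Collect_le continuous_intros)
    then show "(\<lambda>z. d *\<^sub>R z + x) ` S \<in> lmeasurable"
      unfolding image_S by (simp add: fmeasurable_Int_fmeasurable borel_closed)
    have "measure lebesgue ((\<lambda>z. d *\<^sub>R z + x) ` S) = d ^ DIM('a) * measure lebesgue S"
      using measure_lebesgue_affine[of d x S] d by (simp add: add.commute)
    also have "\<dots> < d ^ DIM('a) * (e * measure lebesgue (ball (0::'a) 1))"
      using S(2) d by (simp add: S_def)
    also have "\<dots> = e * measure lebesgue (ball x d)"
      using content_ball_conv_unit_ball[of d x] d by simp
    finally show "measure lebesgue ((\<lambda>z. d *\<^sub>R z + x) ` S) < e * measure lebesgue (ball x d)" .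
  qed
qed

section \<open>Infinitesimal deformations of a triangular orbit\<close>

text \<open>\<open>h\<^sub>P\<^sub>Q\<close> stands for the value on \<open>Q - P\<close> of the normal covector \<open>n\<^sub>P\<close>. The hypothesis on \<open>dQ\<close> and \<open>dR\<close>
  is the derivative of the reflection law at a fixed vertex \<open>P\<close>.\<close>

lemma variation_fixed_vertex:
  fixes P Q R nP nQ nR dQ dR :: "'a::real_inner"
  assumes h: "hPQ = nP \<bullet> (Q - P)" "hPR = nP \<bullet> (R - P)" "hQP = nQ \<bullet> (P - Q)" "hQR = nQ \<bullet> (R - Q)"
      "hRP = nR \<bullet> (P - R)" "hRQ = nR \<bullet> (Q - R)"
    and nz: "hPQ \<noteq> 0" "hPR \<noteq> 0" "hQP \<noteq> 0" "hQR \<noteq> 0" "hRP \<noteq> 0" "hRQ \<noteq> 0"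
    and var: "(1 / hPQ) *\<^sub>R dQ + (1 / hPR) *\<^sub>R dR =
        (nP \<bullet> dQ / hPQ\<^sup>2) *\<^sub>R (Q - P) + (nP \<bullet> dR / hPR\<^sup>2) *\<^sub>R (R - P)"
    and dQ: "dQ = k *\<^sub>R ((1 / hQR) *\<^sub>R (R - Q) - (1 / hQP) *\<^sub>R (P - Q))"
    and dR: "nR \<bullet> dR = 0"
  shows "dR = - (k * (hPR\<^sup>2 * hRQ / (hPQ\<^sup>2 * hQR))) *\<^sub>R ((1 / hRP) *\<^sub>R (P - R) - (1 / hRQ) *\<^sub>R (Q - R))"
proof -
  define e1 e2 where "e1 = Q - P" and "e2 = R - P"
  have e: "Q - P = e1" "R - P = e2" "P - Q = - e1" "R - Q = e2 - e1" "P - R = - e2" "Q - R = e1 - e2"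
    by (simp_all add: e1_def e2_def)
  define z where "z = nP \<bullet> dR / hPR"
  have dQ': "dQ = (k * (1 / hQP - 1 / hQR)) *\<^sub>R e1 + (k / hQR) *\<^sub>R e2"
    unfolding dQ e by (simp add: algebra_simps)
  have nPdQ: "nP \<bullet> dQ = k * ((hPR - hPQ) / hQR + hPQ / hQP)"
    unfolding dQ' h(1,2) e by (simp add: inner_add_right algebra_simps diff_divide_distrib)
  have "dR = hPR *\<^sub>R ((1 / hPR) *\<^sub>R dR)"
    using nz by simp
  also have "(1 / hPR) *\<^sub>R dR = (nP \<bullet> dQ / hPQ\<^sup>2) *\<^sub>R e1 + (nP \<bullet> dR / hPR\<^sup>2) *\<^sub>R e2 - (1 / hPQ) *\<^sub>R dQ"
    using var unfolding e by (simp add: algebra_simps)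
  also have "hPR *\<^sub>R \<dots> = (k * hPR\<^sup>2 / (hPQ\<^sup>2 * hQR)) *\<^sub>R e1 + (z - k * hPR / (hPQ * hQR)) *\<^sub>R e2"
  proof -
    have 1: "hPR * (nP \<bullet> dQ / hPQ\<^sup>2) - hPR / hPQ * (k * (1 / hQP - 1 / hQR)) = k * hPR\<^sup>2 / (hPQ\<^sup>2 * hQR)"
      unfolding nPdQ using nz by (simp add: field_simps power2_eq_square)
    have 2: "hPR * (nP \<bullet> dR / hPR\<^sup>2) - hPR / hPQ * (k / hQR) = z - k * hPR / (hPQ * hQR)"
      unfolding z_def using nz by (simp add: field_simps power2_eq_square)
    show ?thesis
      unfolding dQ' 1[symmetric] 2[symmetric] nPdQ[unfolded dQ', symmetric]
      by (simp add: algebra_simps)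
  qed
  \<comment> \<open>The law at \<open>P\<close> controls only the direction of \<open>R\<close> as
    seen from \<open>P\<close>, so the component of \<open>dR\<close> along \<open>R - P\<close> is
    still open here; tangency at \<open>R\<close> fixes it next.\<close>
  finally obtain y where y: "dR = (k * hPR\<^sup>2 / (hPQ\<^sup>2 * hQR)) *\<^sub>R e1 + y *\<^sub>R e2"
    by blast
  have "nR \<bullet> e1 = hRQ - hRP" "nR \<bullet> e2 = - hRP"
    unfolding h e by (simp_all add: inner_diff_right)
  with dR have "k * hPR\<^sup>2 / (hPQ\<^sup>2 * hQR) * (hRQ - hRP) - y * hRP = 0"
    unfolding y by (simp add: inner_add_right)
  then have "y = k * hPR\<^sup>2 / (hPQ\<^sup>2 * hQR) * (hRQ / hRP - 1)"
    using nz by (simp add: field_simps)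
  then have "y = k * hPR\<^sup>2 / (hPQ\<^sup>2 * hQR) * (hRQ / hRP - 1)"
    using nz by (simp add: field_simps)
  also have "\<dots> = k * (hPR\<^sup>2 * hRQ / (hPQ\<^sup>2 * hQR)) * (1 / hRP - 1 / hRQ)"
    using nz by (simp add: right_diff_distrib)
  finally have 3: "y = k * (hPR\<^sup>2 * hRQ / (hPQ\<^sup>2 * hQR)) * (1 / hRP - 1 / hRQ)" .
  have 4: "k * hPR\<^sup>2 / (hPQ\<^sup>2 * hQR) = k * (hPR\<^sup>2 * hRQ / (hPQ\<^sup>2 * hQR)) * (1 / hRQ)"
    using nz by (simp add: field_simps)
  show ?thesis
    unfolding y 3 4 e by (simp only: scaleR_scaleR[symmetric] scaleR_left_diff_distrib scaleR_right_diff_distrib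
        scaleR_minus_left scaleR_minus_right) (simp add: algebra_simps)
qed

text \<open>\<open>p, q, r, s, t, u\<close> stand for \<open>hAB, hAC, hBC, hBA, hCA, hCB\<close>.
  The hypothesis compares one transfer factor of velocities with the product of the other two;
  cleared of denominators it equates the cubes of the two cyclic products, and real cube roots are
  unique.\<close>

lemma menelaus_cubes:
  fixes p q r s t u :: real
  assumes nz: "p \<noteq> 0" "q \<noteq> 0" "r \<noteq> 0" "s \<noteq> 0" "t \<noteq> 0" "u \<noteq> 0"
    and eq: "r\<^sup>2 * t / (s\<^sup>2 * q) = q\<^sup>2 * u / (p\<^sup>2 * r) * (u\<^sup>2 * s / (t\<^sup>2 * p))"
  shows "p * r * t = q * u * s"
proof -
  have "(p * r * t) ^ 3 = (q * u * s) ^ 3"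
    using eq nz by (simp add: field_simps power2_eq_square power3_eq_cube)
  then show ?thesis
    using odd_real_root_power_cancel[of 3] by (metis odd_numeral)
qed

text \<open>\<open>X\<close> and \<open>Y\<close> mark derivatives along \<open>(0, tB)\<close> and
  \<open>(tA, 0)\<close>. The pairs \<open>a1, a2\<close>, \<open>b1, b2\<close>,
  \<open>k1, k2\<close> are the derivatives of the normals at A, B, C paired with the sides there,
  so the conclusions say that the curvature terms \<open>kA\<close>, \<open>kB\<close>,
  \<open>kC\<close> vanish. All other terms cancel and leave a linear system:
  \<open>kB = c2 kC\<close>, \<open>kA = c1 kC\<close>,
  \<open>2 c1 kB + 2 c2 kA = c1 c2 kC\<close>.\<close>

lemma curvature_relations:
  fixes p q r s t u c1 c2 :: real
  assumes nz: "p \<noteq> 0" "q \<noteq> 0" "r \<noteq> 0" "s \<noteq> 0" "t \<noteq> 0" "u \<noteq> 0"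
    and men: "p * r * t = q * u * s"
    and c: "c1 = r\<^sup>2 * t / (s\<^sup>2 * q)" "c2 = q\<^sup>2 * u / (p\<^sup>2 * r)"
    and X: "pX = (q - p) / r + p / s" "qX = - c2 * (- q / t - (p - q) / u)"
      "rX = b2 - c2 * (- (r - s) / t + r / u)" "sX = b1" "tX = - c2 * k1"
      "uX = - c2 * k2 + (- u / r + (u - t) / s)"
    and Y: "pY = a1" "qY = a2 - c1 * (- q / t - (p - q) / u)" "rY = - c1 * (- (r - s) / t + r / u)"
      "sY = - s / p - (r - s) / q" "tY = - c1 * k1 + ((u - t) / p + t / q)" "uY = - c1 * k2"
    and menX: "pX / p + rX / r + tX / t = qX / q + uX / u + sX / s"
    and menY: "pY / p + rY / r + tY / t = qY / q + uY / u + sY / s"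
    and int: "6 * r / (q * s) * c2 + c1 * (2 * rX / r + tX / t - 2 * sX / s - qX / q)
      - c2 * (2 * qY / q + uY / u - 2 * pY / p - rY / r) = 0"
  shows "a1 / p - a2 / q = 0" "b2 / r - b1 / s = 0" "k1 / t - k2 / u = 0"
proof -
  have u: "u = p * r * t / (q * s)"
    using men nz by (simp add: field_simps)
  have c': "c1 = r\<^sup>2 * t / (s\<^sup>2 * q)" "c2 = q * t / (p * s)"
    using nz unfolding c u by (simp_all add: field_simps power2_eq_square)
  have 1: "b2 / r - b1 / s = c2 * (k1 / t - k2 / u)"
  proof -
    \<comment> \<open>This is \<open>menX\<close> with the curvature terms deleted. It is an
      identity, so subtracting it leaves the curvature terms alone.\<close>
    have "((q - p) / r + p / s) / p - c2 * (- (r - s) / t + r / u) / r =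
        - c2 * (- q / t - (p - q) / u) / q + (- u / r + (u - t) / s) / u"
      using nz unfolding c' u by (simp add: field_simps)
    with menX show ?thesis
      unfolding X by (simp add: add_divide_distrib diff_divide_distrib algebra_simps)
  qed
  have 2: "a1 / p - a2 / q = c1 * (k1 / t - k2 / u)"
  proof -
    have "- c1 * (- (r - s) / t + r / u) / r + ((u - t) / p + t / q) / t =
        - c1 * (- q / t - (p - q) / u) / q + (- s / p - (r - s) / q) / s"
      using nz unfolding c' u by (simp add: field_simps power2_eq_square)
    with menY show ?thesis
      unfolding Y by (simp add: add_divide_distrib diff_divide_distrib algebra_simps)
  qed
  have 3: "2 * c1 * (b2 / r - b1 / s) + 2 * c2 * (a1 / p - a2 / q) - c1 * c2 * (k1 / t - k2 / u) = 0"
  proof -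
    have "6 * r / (q * s) * c2 + 3 * c1 * c2 * ((- q / t - (p - q) / u) / q - (- (r - s) / t + r / u) / r) = 0"
      using nz unfolding c' u by (simp add: field_simps power2_eq_square)
    with int show ?thesis
      using nz unfolding X Y by (simp add: add_divide_distrib diff_divide_distrib algebra_simps)
  qed
  have "3 * c1 * c2 * (k1 / t - k2 / u) = 0"
    using 3 unfolding 1 2 by (simp add: algebra_simps)
  moreover have "c1 \<noteq> 0" "c2 \<noteq> 0"
    using nz unfolding c by auto
  ultimately show "k1 / t - k2 / u = 0"
    by simp
  with 1 2 show "a1 / p - a2 / q = 0" "b2 / r - b1 / s = 0"
    by simp_all
qed

text \<open>With \<open>p, q, r, s, t, u\<close> for \<open>h\<^sub>A\<^sub>B, h\<^sub>A\<^sub>C, h\<^sub>B\<^sub>C, h\<^sub>B\<^sub>A, h\<^sub>C\<^sub>A, h\<^sub>C\<^sub>B\<close>, the left-hand sides are the derivatives of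
  \<open>t\<^sub>A\<close> along \<open>(0, t\<^sub>B)\<close>, of \<open>t\<^sub>B\<close> along \<open>(t\<^sub>A, 0)\<close>, and of \<open>t\<^sub>C\<close> along their combination that fixes \<open>C\<close>.\<close>

lemma tangent_variations:
  fixes p q r s t u c1 c2 :: real and e1 e2 :: "'a::real_vector"
  assumes nz: "p \<noteq> 0" "q \<noteq> 0" "r \<noteq> 0" "s \<noteq> 0" "t \<noteq> 0" "u \<noteq> 0"
    and men: "p * r * t = q * u * s"
    and c: "c1 = r\<^sup>2 * t / (s\<^sup>2 * q)" "c2 = q\<^sup>2 * u / (p\<^sup>2 * r)"
    and tA: "tA = (1 / p) *\<^sub>R e1 - (1 / q) *\<^sub>R e2"
    and tB: "tB = (1 / r) *\<^sub>R (e2 - e1) - (1 / s) *\<^sub>R (- e1)"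
    and tC: "tC = (1 / t) *\<^sub>R (- e2) - (1 / u) *\<^sub>R (e1 - e2)"
  shows "(1 / p) *\<^sub>R tB - (((q - p) / r + p / s) / p\<^sup>2) *\<^sub>R e1 -
      ((1 / q) *\<^sub>R (- c2 *\<^sub>R tC) - (- c2 * (- q / t - (p - q) / u) / q\<^sup>2) *\<^sub>R e2) =
      - (2 * q / (p * r)) *\<^sub>R tA" (is ?A)
    and "(1 / r) *\<^sub>R (- c1 *\<^sub>R tC) - (- c1 * (- (r - s) / t + r / u) / r\<^sup>2) *\<^sub>R (e2 - e1) -
      ((1 / s) *\<^sub>R tA - ((- s / p - (r - s) / q) / s\<^sup>2) *\<^sub>R (- e1)) = (2 * r / (q * s)) *\<^sub>R tB" (is ?B)
    and "(1 / t) *\<^sub>R (- c2 *\<^sub>R tA) - (- c2 * ((u - t) / p + t / q) / t\<^sup>2) *\<^sub>R (- e2) -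
      ((1 / u) *\<^sub>R (c1 *\<^sub>R tB) - (c1 * (- u / r + (u - t) / s) / u\<^sup>2) *\<^sub>R (e1 - e2)) =
      (2 * r / (q * s) * c2) *\<^sub>R tC" (is ?C)
proof -
  have u: "u = p * r * t / (q * s)"
    using men nz by (simp add: field_simps)
  have c': "c1 = r\<^sup>2 * t / (s\<^sup>2 * q)" "c2 = q * t / (p * s)"
    using nz unfolding c u by (simp_all add: field_simps power2_eq_square)
  have t': "tA = (1 / p) *\<^sub>R e1 + (- 1 / q) *\<^sub>R e2" "tB = (1 / s - 1 / r) *\<^sub>R e1 + (1 / r) *\<^sub>R e2"
    "tC = (- 1 / u) *\<^sub>R e1 + (1 / u - 1 / t) *\<^sub>R e2"
    unfolding tA tB tC by (simp_all add: algebra_simps)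
  have eq: "x = y" if "x = a *\<^sub>R e1 + b *\<^sub>R e2" "y = c *\<^sub>R e1 + d *\<^sub>R e2" "a = c" "b = d" for x y a b c d
    using that by simp
  show ?A
  proof (rule eq)
    show "(1 / p) *\<^sub>R tB - (((q - p) / r + p / s) / p\<^sup>2) *\<^sub>R e1 -
      ((1 / q) *\<^sub>R (- c2 *\<^sub>R tC) - (- c2 * (- q / t - (p - q) / u) / q\<^sup>2) *\<^sub>R e2) =
      (1 / p * (1 / s - 1 / r) - ((q - p) / r + p / s) / p\<^sup>2 + c2 / q * (- 1 / u)) *\<^sub>R e1 +
      (1 / p * (1 / r) + c2 / q * (1 / u - 1 / t) + - c2 * (- q / t - (p - q) / u) / q\<^sup>2) *\<^sub>R e2"
      unfolding t' by (simp add: algebra_simps)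
    show "- (2 * q / (p * r)) *\<^sub>R tA = (- (2 * q / (p * r)) * (1 / p)) *\<^sub>R e1 + (- (2 * q / (p * r)) * (- 1 / q)) *\<^sub>R e2"
      unfolding t' by (simp add: algebra_simps)
  qed (use nz in \<open>simp_all add: c' u field_simps power2_eq_square\<close>)
  show ?B
  proof (rule eq)
    show "(1 / r) *\<^sub>R (- c1 *\<^sub>R tC) - (- c1 * (- (r - s) / t + r / u) / r\<^sup>2) *\<^sub>R (e2 - e1) -
      ((1 / s) *\<^sub>R tA - ((- s / p - (r - s) / q) / s\<^sup>2) *\<^sub>R (- e1)) =
      (- c1 / r * (- 1 / u) + - c1 * (- (r - s) / t + r / u) / r\<^sup>2 - 1 / s * (1 / p) - (- s / p - (r - s) / q) / s\<^sup>2) *\<^sub>R e1 +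
      (- c1 / r * (1 / u - 1 / t) - - c1 * (- (r - s) / t + r / u) / r\<^sup>2 - 1 / s * (- 1 / q)) *\<^sub>R e2"
      unfolding t' by (simp add: algebra_simps)
    show "(2 * r / (q * s)) *\<^sub>R tB = (2 * r / (q * s) * (1 / s - 1 / r)) *\<^sub>R e1 + (2 * r / (q * s) * (1 / r)) *\<^sub>R e2"
      unfolding t' by (simp only: scaleR_add_right scaleR_scaleR)
  qed (use nz in \<open>simp_all add: c' u field_simps power2_eq_square\<close>)
  show ?C
  proof (rule eq)
    show "(1 / t) *\<^sub>R (- c2 *\<^sub>R tA) - (- c2 * ((u - t) / p + t / q) / t\<^sup>2) *\<^sub>R (- e2) -
      ((1 / u) *\<^sub>R (c1 *\<^sub>R tB) - (c1 * (- u / r + (u - t) / s) / u\<^sup>2) *\<^sub>R (e1 - e2)) =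
      (- c2 / t * (1 / p) - c1 / u * (1 / s - 1 / r) + c1 * (- u / r + (u - t) / s) / u\<^sup>2) *\<^sub>R e1 +
      (- c2 / t * (- 1 / q) + - c2 * ((u - t) / p + t / q) / t\<^sup>2 - c1 / u * (1 / r)
        - c1 * (- u / r + (u - t) / s) / u\<^sup>2) *\<^sub>R e2"
      unfolding t' by (simp add: algebra_simps)
    show "(2 * r / (q * s) * c2) *\<^sub>R tC = (2 * r / (q * s) * c2 * (- 1 / u)) *\<^sub>R e1 + (2 * r / (q * s) * c2 * (1 / u - 1 / t)) *\<^sub>R e2"
      unfolding t' by (simp only: scaleR_add_right scaleR_scaleR)
  qed (use nz in \<open>simp_all add: c' u field_simps power2_eq_square\<close>)
qed

text \<open>Class \<open>ck_on 2\<close> makes the derivative differentiable for each fixed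
  direction. Expanding the direction field in the standard basis reduces a moving direction to fixed
  ones with differentiable coefficients.\<close>

lemma frechet_derivative_field:
  fixes f :: "'a::euclidean_space \<Rightarrow> 'b::euclidean_space"
  assumes f: "ck_on 2 f W" and W: "open W" "x \<in> W" and V: "(V has_derivative V') (at x)"
  shows "((\<lambda>y. frechet_derivative f (at y) (V y)) has_derivative
    (\<lambda>v. frechet_derivative (\<lambda>y. frechet_derivative f (at y) (V x)) (at x) v + frechet_derivative f (at x) (V' v))) (at x)"
proof -
  let ?D = "\<lambda>y. frechet_derivative f (at y)" and ?D2 = "\<lambda>b. frechet_derivative (\<lambda>y. frechet_derivative f (at y) b) (at x)"
  have lin: "linear (?D y)" if "y \<in> W" for y
    using ck_on_2D(1)[OF f that] by (simp add: has_derivative_def bounded_linear.linear)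
  have expand: "?D y u = (\<Sum>b\<in>Basis. (u \<bullet> b) *\<^sub>R ?D y b)" if "y \<in> W" for y u
  proof -
    have "?D y (\<Sum>b\<in>Basis. (u \<bullet> b) *\<^sub>R b) = (\<Sum>b\<in>Basis. (u \<bullet> b) *\<^sub>R ?D y b)"
      using lin[OF that] by (simp add: linear_sum linear_scale)
    then show ?thesis
      by (simp only: euclidean_representation)
  qed
  have D2: "((\<lambda>y. ?D y b) has_derivative ?D2 b) (at x)" for b
    by (rule ck_on_2D(2)[OF f W(2)])
  have D2V: "?D2 (V x) = (\<lambda>v. \<Sum>b\<in>Basis. (V x \<bullet> b) *\<^sub>R ?D2 b v)"
  proof -
    have "((\<lambda>y. \<Sum>b\<in>Basis. (V x \<bullet> b) *\<^sub>R ?D y b) has_derivative (\<lambda>v. \<Sum>b\<in>Basis. (V x \<bullet> b) *\<^sub>R ?D2 b v)) (at x)"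
      by (intro has_derivative_sum has_derivative_scaleR_right D2)
    then have "((\<lambda>y. ?D y (V x)) has_derivative (\<lambda>v. \<Sum>b\<in>Basis. (V x \<bullet> b) *\<^sub>R ?D2 b v)) (at x)"
      by (rule has_derivative_transform_within_open[OF _ W]) (rule expand[symmetric])
    then show ?thesis
      using D2 has_derivative_unique by blast
  qed
  have "((\<lambda>y. \<Sum>b\<in>Basis. (V y \<bullet> b) *\<^sub>R ?D y b) has_derivative
      (\<lambda>v. \<Sum>b\<in>Basis. (V x \<bullet> b) *\<^sub>R ?D2 b v + (V' v \<bullet> b) *\<^sub>R ?D x b)) (at x)"
    by (intro has_derivative_sum has_derivative_scaleR bounded_linear.has_derivative[OF bounded_linear_inner_left] D2 V)
  then have "((\<lambda>y. ?D y (V y)) has_derivative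
      (\<lambda>v. \<Sum>b\<in>Basis. (V x \<bullet> b) *\<^sub>R ?D2 b v + (V' v \<bullet> b) *\<^sub>R ?D x b)) (at x)"
    by (rule has_derivative_transform_within_open[OF _ W]) (rule expand[symmetric])
  moreover have "(\<lambda>v. \<Sum>b\<in>Basis. (V x \<bullet> b) *\<^sub>R ?D2 b v + (V' v \<bullet> b) *\<^sub>R ?D x b) =
      (\<lambda>v. ?D2 (V x) v + ?D x (V' v))"
    unfolding D2V expand[OF W(2), of "V' _"] by (simp only: sum.distrib)
  ultimately show ?thesis
    by simp
qed

lemma has_derivative_covector:
  fixes n :: "'a::euclidean_space \<Rightarrow> 'a"
  assumes "n differentiable (at (P x))" "(P has_derivative P') (at x)" "(Q has_derivative Q') (at x)"
  shows "((\<lambda>x. n (P x) \<bullet> (Q x - P x)) has_derivative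
    (\<lambda>v. frechet_derivative n (at (P x)) (P' v) \<bullet> (Q x - P x) + n (P x) \<bullet> (Q' v - P' v))) (at x)"
proof -
  have "((\<lambda>x. n (P x)) has_derivative (\<lambda>v. frechet_derivative n (at (P x)) (P' v))) (at x)"
    using has_derivative_compose[OF assms(2)] assms(1) frechet_derivative_works by blast
  from has_derivative_inner[OF this has_derivative_diff[OF assms(3,2)]] show ?thesis
    by (simp add: add.commute)
qed

lemma has_derivative_scaled_edge:
  fixes h :: "'a::real_normed_vector \<Rightarrow> real" and P Q :: "'a \<Rightarrow> 'b::real_normed_vector"
  assumes "(h has_derivative h') (at x)" "(P has_derivative P') (at x)" "(Q has_derivative Q') (at x)" "h x \<noteq> 0"
  shows "((\<lambda>x. (1 / h x) *\<^sub>R (Q x - P x)) has_derivative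
    (\<lambda>v. (1 / h x) *\<^sub>R (Q' v - P' v) - (h' v / (h x)\<^sup>2) *\<^sub>R (Q x - P x))) (at x)"
proof -
  have "((\<lambda>x. inverse (h x) *\<^sub>R (Q x - P x)) has_derivative
      (\<lambda>v. inverse (h x) *\<^sub>R (Q' v - P' v) + (- (inverse (h x) * h' v * inverse (h x))) *\<^sub>R (Q x - P x))) (at x)"
    by (rule has_derivative_scaleR[OF Deriv.has_derivative_inverse[OF assms(4,1)] has_derivative_diff[OF assms(3,2)]])
  then show ?thesis
    by (simp add: inverse_eq_divide power2_eq_square)
qed

text \<open>At a vertex at rest the derivatives of \<open>n\<close> and \<open>M\<close> are applied
  to 0 and drop out, so only the value of \<open>n\<close> at the vertex enters, not its extension
  off the boundary.\<close>

lemma frame_variation: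
  fixes n M :: "'a::euclidean_space \<Rightarrow> 'a" and P Q R :: "'b::real_normed_vector \<Rightarrow> 'a"
  assumes x: "x \<in> flat N E" and v: "v \<in> N x"
    and diff: "n differentiable (at (P x))" "M differentiable (at (P x))"
    and der: "(P has_derivative P') (at x)" "(Q has_derivative Q') (at x)" "(R has_derivative R') (at x)"
    and nz: "n (P x) \<bullet> (Q x - P x) \<noteq> 0" "n (P x) \<bullet> (R x - P x) \<noteq> 0"
    and refl: "\<And>y. y \<in> E \<Longrightarrow> 2 *\<^sub>R M (P y) = (1 / (n (P y) \<bullet> (Q y - P y))) *\<^sub>R (Q y - P y) + (1 / (n (P y) \<bullet> (R y - P y))) *\<^sub>R (R y - P y)"
    and fixed: "P' v = 0"
  shows "(1 / (n (P x) \<bullet> (Q x - P x))) *\<^sub>R Q' v + (1 / (n (P x) \<bullet> (R x - P x))) *\<^sub>R R' v =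
    (n (P x) \<bullet> Q' v / (n (P x) \<bullet> (Q x - P x))\<^sup>2) *\<^sub>R (Q x - P x) + (n (P x) \<bullet> R' v / (n (P x) \<bullet> (R x - P x))\<^sup>2) *\<^sub>R (R x - P x)"
proof -
  have "((\<lambda>x. M (P x)) has_derivative (\<lambda>v. frechet_derivative M (at (P x)) (P' v))) (at x)"
    using has_derivative_compose[OF der(1)] diff(2) frechet_derivative_works by blast
  then have 1: "((\<lambda>x. 2 *\<^sub>R M (P x)) has_derivative (\<lambda>v. 2 *\<^sub>R frechet_derivative M (at (P x)) (P' v))) (at x)"
    by (rule has_derivative_scaleR_right)
  have lin: "linear (frechet_derivative M (at (P x)))" "linear (frechet_derivative n (at (P x)))"
    using diff by (simp_all add: linear_frechet_derivative)
  note hq = has_derivative_covector[OF diff(1) der(1,2)] and hr = has_derivative_covector[OF diff(1) der(1,3)]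
  note 2 = has_derivative_add[OF has_derivative_scaled_edge[OF hq der(1,2) nz(1)] has_derivative_scaled_edge[OF hr der(1,3) nz(2)]]
  show ?thesis
    using flatD[OF x 1 2 refl v] lin by (simp add: fixed linear_0 algebra_simps)
qed

text \<open>Derivatives are carried in the form \<open>f x * a v\<close> with \<open>a\<close> the
  logarithmic derivative. Logarithmic derivatives add, and both sides of Ceva's condition as well as
  \<open>c1\<close> and \<open>c2\<close> are monomials in the six numbers \<open>hAB\<close>, ...,
  \<open>hCB\<close>.\<close>

lemma has_log_derivative_mult:
  fixes f g :: "'a::real_normed_vector \<Rightarrow> real"
  assumes "(f has_derivative (\<lambda>v. f x * a v)) (at x)" "(g has_derivative (\<lambda>v. g x * b v)) (at x)"
  shows "((\<lambda>x. f x * g x) has_derivative (\<lambda>v. f x * g x * (a v + b v))) (at x)"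
  by (rule has_derivative_eq_rhs[OF has_derivative_mult[OF assms]]) (simp add: algebra_simps)

lemma has_log_derivative_divide:
  fixes f g :: "'a::real_normed_vector \<Rightarrow> real"
  assumes "(f has_derivative (\<lambda>v. f x * a v)) (at x)" "(g has_derivative (\<lambda>v. g x * b v)) (at x)" "g x \<noteq> 0"
  shows "((\<lambda>x. f x / g x) has_derivative (\<lambda>v. f x / g x * (a v - b v))) (at x)"
  by (rule has_derivative_eq_rhs[OF has_derivative_divide'[OF assms]]) (use assms(3) in \<open>simp add: fun_eq_iff field_simps\<close>)

lemma has_log_derivative:
  fixes f :: "'a::real_normed_vector \<Rightarrow> real"
  assumes "(f has_derivative f') (at x)" "f x \<noteq> 0"
  shows "(f has_derivative (\<lambda>v. f x * (f' v / f x))) (at x)"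
  using assms by simp

lemma has_derivative_quotient:
  fixes p q r s :: "'a::real_normed_vector \<Rightarrow> real"
  assumes d: "(p has_derivative p') (at x)" "(q has_derivative q') (at x)" "(r has_derivative r') (at x)" "(s has_derivative s') (at x)"
    and nz: "p x \<noteq> 0" "q x \<noteq> 0" "r x \<noteq> 0" "s x \<noteq> 0"
  shows "((\<lambda>x. (p x)\<^sup>2 * q x / ((r x)\<^sup>2 * s x)) has_derivative
    (\<lambda>v. (p x)\<^sup>2 * q x / ((r x)\<^sup>2 * s x) *
      ((p' v / p x + p' v / p x + q' v / q x) - (r' v / r x + r' v / r x + s' v / s x)))) (at x)"
proof -
  note L = has_log_derivative[OF d(1) nz(1)] has_log_derivative[OF d(2) nz(2)]
    has_log_derivative[OF d(3) nz(3)] has_log_derivative[OF d(4) nz(4)]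
  have "((\<lambda>x. (p x * p x * q x) / (r x * r x * s x)) has_derivative
    (\<lambda>v. p x * p x * q x / (r x * r x * s x) *
      ((p' v / p x + p' v / p x + q' v / q x) - (r' v / r x + r' v / r x + s' v / s x)))) (at x)"
    by (rule has_log_derivative_divide[OF has_log_derivative_mult[OF has_log_derivative_mult[OF L(1,1)] L(2)]
          has_log_derivative_mult[OF has_log_derivative_mult[OF L(3,3)] L(4)]]) (use nz in simp)
  then show ?thesis
    unfolding power2_eq_square .
qed

lemma has_derivative_mult3:
  fixes p q r :: "'a::real_normed_vector \<Rightarrow> real"
  assumes d: "(p has_derivative p') (at x)" "(q has_derivative q') (at x)" "(r has_derivative r') (at x)"
    and nz: "p x \<noteq> 0" "q x \<noteq> 0" "r x \<noteq> 0"
  shows "((\<lambda>x. p x * q x * r x) has_derivative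
    (\<lambda>v. p x * q x * r x * (p' v / p x + q' v / q x + r' v / r x))) (at x)"
  by (rule has_log_derivative_mult[OF has_log_derivative_mult[OF has_log_derivative[OF d(1) nz(1)]
        has_log_derivative[OF d(2) nz(2)]] has_log_derivative[OF d(3) nz(3)]])

text \<open>A pair \<open>x = (A, B)\<close> of vertices on the first two boundaries, with third vertex \<open>C x\<close>; the normal
  fields \<open>n\<^sub>i\<close> and the framings \<open>M\<^sub>i\<close> are extended to the ambient space. The orbit conditions hold on
  \<open>E\<close> only, so they are differentiated at flat points of \<open>E\<close>.\<close>

locale orbit_family =
  fixes n1 n2 n3 M1 M2 M3 :: "'v::euclidean_space \<Rightarrow> 'v" and \<rho> :: "'v \<Rightarrow> real"
    and C :: "'v \<times> 'v \<Rightarrow> 'v" and E W :: "('v \<times> 'v) set" and N :: "'v \<times> 'v \<Rightarrow> ('v \<times> 'v) set"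
  assumes open_W: "open W" and E_W: "E \<subseteq> W" and C2: "ck_on 2 C W"
    and n_diff: "x \<in> W \<Longrightarrow> n1 differentiable (at (fst x))" "x \<in> W \<Longrightarrow> n2 differentiable (at (snd x))"
      "x \<in> W \<Longrightarrow> n3 differentiable (at (C x))"
    and M_diff: "x \<in> W \<Longrightarrow> M1 differentiable (at (fst x))" "x \<in> W \<Longrightarrow> M2 differentiable (at (snd x))"
      "x \<in> W \<Longrightarrow> M3 differentiable (at (C x))"
    and gradient: "x \<in> W \<Longrightarrow> (\<rho> has_derivative (\<lambda>v. n3 (C x) \<bullet> v)) (at (C x))"
    and on_boundary: "x \<in> E \<Longrightarrow> \<rho> (C x) = 0"
    and N_eq: "x \<in> E \<Longrightarrow> N x = {v. n1 (fst x) \<bullet> fst v = 0 \<and> n2 (snd x) \<bullet> snd v = 0}"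
    and transversal: "x \<in> E \<Longrightarrow> n1 (fst x) \<bullet> (snd x - fst x) \<noteq> 0" "x \<in> E \<Longrightarrow> n1 (fst x) \<bullet> (C x - fst x) \<noteq> 0"
      "x \<in> E \<Longrightarrow> n2 (snd x) \<bullet> (fst x - snd x) \<noteq> 0" "x \<in> E \<Longrightarrow> n2 (snd x) \<bullet> (C x - snd x) \<noteq> 0"
      "x \<in> E \<Longrightarrow> n3 (C x) \<bullet> (fst x - C x) \<noteq> 0" "x \<in> E \<Longrightarrow> n3 (C x) \<bullet> (snd x - C x) \<noteq> 0"
    and reflection:
      "x \<in> E \<Longrightarrow> 2 *\<^sub>R M1 (fst x) = (1 / (n1 (fst x) \<bullet> (snd x - fst x))) *\<^sub>R (snd x - fst x) +
        (1 / (n1 (fst x) \<bullet> (C x - fst x))) *\<^sub>R (C x - fst x)"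
      "x \<in> E \<Longrightarrow> 2 *\<^sub>R M2 (snd x) = (1 / (n2 (snd x) \<bullet> (fst x - snd x))) *\<^sub>R (fst x - snd x) +
        (1 / (n2 (snd x) \<bullet> (C x - snd x))) *\<^sub>R (C x - snd x)"
      "x \<in> E \<Longrightarrow> 2 *\<^sub>R M3 (C x) = (1 / (n3 (C x) \<bullet> (fst x - C x))) *\<^sub>R (fst x - C x) +
        (1 / (n3 (C x) \<bullet> (snd x - C x))) *\<^sub>R (snd x - C x)"
    and nondegenerate: "x \<in> E \<Longrightarrow> a *\<^sub>R (snd x - fst x) + b *\<^sub>R (C x - fst x) = 0 \<Longrightarrow> a = 0 \<and> b = 0"
begin

abbreviation DC :: "'v \<times> 'v \<Rightarrow> 'v \<times> 'v \<Rightarrow> 'v" where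
  "DC x \<equiv> frechet_derivative C (at x)"

definition hAB :: "'v \<times> 'v \<Rightarrow> real" where "hAB x = n1 (fst x) \<bullet> (snd x - fst x)"
definition hAC :: "'v \<times> 'v \<Rightarrow> real" where "hAC x = n1 (fst x) \<bullet> (C x - fst x)"
definition hBA :: "'v \<times> 'v \<Rightarrow> real" where "hBA x = n2 (snd x) \<bullet> (fst x - snd x)"
definition hBC :: "'v \<times> 'v \<Rightarrow> real" where "hBC x = n2 (snd x) \<bullet> (C x - snd x)"
definition hCA :: "'v \<times> 'v \<Rightarrow> real" where "hCA x = n3 (C x) \<bullet> (fst x - C x)"
definition hCB :: "'v \<times> 'v \<Rightarrow> real" where "hCB x = n3 (C x) \<bullet> (snd x - C x)"

lemmas h_defs = hAB_def hAC_def hBA_def hBC_def hCA_def hCB_def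

definition hAB' :: "'v \<times> 'v \<Rightarrow> 'v \<times> 'v \<Rightarrow> real" where
  "hAB' x v = frechet_derivative n1 (at (fst x)) (fst v) \<bullet> (snd x - fst x) + n1 (fst x) \<bullet> (snd v - fst v)"
definition hAC' :: "'v \<times> 'v \<Rightarrow> 'v \<times> 'v \<Rightarrow> real" where
  "hAC' x v = frechet_derivative n1 (at (fst x)) (fst v) \<bullet> (C x - fst x) + n1 (fst x) \<bullet> (DC x v - fst v)"
definition hBA' :: "'v \<times> 'v \<Rightarrow> 'v \<times> 'v \<Rightarrow> real" where
  "hBA' x v = frechet_derivative n2 (at (snd x)) (snd v) \<bullet> (fst x - snd x) + n2 (snd x) \<bullet> (fst v - snd v)"
definition hBC' :: "'v \<times> 'v \<Rightarrow> 'v \<times> 'v \<Rightarrow> real" where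
  "hBC' x v = frechet_derivative n2 (at (snd x)) (snd v) \<bullet> (C x - snd x) + n2 (snd x) \<bullet> (DC x v - snd v)"
definition hCA' :: "'v \<times> 'v \<Rightarrow> 'v \<times> 'v \<Rightarrow> real" where
  "hCA' x v = frechet_derivative n3 (at (C x)) (DC x v) \<bullet> (fst x - C x) + n3 (C x) \<bullet> (fst v - DC x v)"
definition hCB' :: "'v \<times> 'v \<Rightarrow> 'v \<times> 'v \<Rightarrow> real" where
  "hCB' x v = frechet_derivative n3 (at (C x)) (DC x v) \<bullet> (snd x - C x) + n3 (C x) \<bullet> (snd v - DC x v)"

lemmas h'_defs = hAB'_def hAC'_def hBA'_def hBC'_def hCA'_def hCB'_def

text \<open>By the reflection law the sides at A, scaled to value 1 on \<open>n1\<close>, are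
  \<open>M1 + tA / 2\<close> and \<open>M1 - tA / 2\<close>; hence \<open>tA\<close> directs the
  tangent line of the first boundary inside the orbit plane. All three vectors follow the cyclic
  order ABC, so that \<open>DC_fixed_A\<close> and \<open>DC_fixed_B\<close> carry the same
  sign.\<close>

definition tA :: "'v \<times> 'v \<Rightarrow> 'v" where "tA x = (1 / hAB x) *\<^sub>R (snd x - fst x) - (1 / hAC x) *\<^sub>R (C x - fst x)"
definition tB :: "'v \<times> 'v \<Rightarrow> 'v" where "tB x = (1 / hBC x) *\<^sub>R (C x - snd x) - (1 / hBA x) *\<^sub>R (fst x - snd x)"
definition tC :: "'v \<times> 'v \<Rightarrow> 'v" where "tC x = (1 / hCA x) *\<^sub>R (fst x - C x) - (1 / hCB x) *\<^sub>R (snd x - C x)"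

text \<open>\<open>- c1\<close> and \<open>- c2\<close> are the velocities of C, measured in
  \<open>tC\<close>, when A moves with velocity \<open>tA\<close> and when B moves with velocity
  \<open>tB\<close>; they are the factors of \<open>variation_fixed_vertex\<close>.\<close>

definition c1 :: "'v \<times> 'v \<Rightarrow> real" where "c1 x = (hBC x)\<^sup>2 * hCA x / ((hBA x)\<^sup>2 * hAC x)"
definition c2 :: "'v \<times> 'v \<Rightarrow> real" where "c2 x = (hAC x)\<^sup>2 * hCB x / ((hAB x)\<^sup>2 * hBC x)"

lemma h_nonzero: "x \<in> E \<Longrightarrow> hAB x \<noteq> 0" "x \<in> E \<Longrightarrow> hAC x \<noteq> 0" "x \<in> E \<Longrightarrow> hBA x \<noteq> 0"
    "x \<in> E \<Longrightarrow> hBC x \<noteq> 0" "x \<in> E \<Longrightarrow> hCA x \<noteq> 0" "x \<in> E \<Longrightarrow> hCB x \<noteq> 0"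
  unfolding h_defs using transversal by blast+

lemma C_der: "x \<in> W \<Longrightarrow> (C has_derivative DC x) (at x)"
  using ck_on_2D(1)[OF C2] .

lemma linear_DC: "x \<in> W \<Longrightarrow> linear (DC x)"
  using C_der by (simp add: has_derivative_def bounded_linear.linear)

lemma fst_snd_der: "(fst has_derivative fst) (at x)" "(snd has_derivative snd) (at x)"
  by (auto intro!: derivative_eq_intros)

lemma h_der:
  assumes "x \<in> W"
  shows "(hAB has_derivative hAB' x) (at x)" "(hAC has_derivative hAC' x) (at x)"
    "(hBA has_derivative hBA' x) (at x)" "(hBC has_derivative hBC' x) (at x)"
    "(hCA has_derivative hCA' x) (at x)" "(hCB has_derivative hCB' x) (at x)"
  unfolding h_defs[abs_def] h'_defs[abs_def]
  by (rule has_derivative_covector n_diff assms fst_snd_der C_der)+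

lemma n_tangent: "x \<in> E \<Longrightarrow> n1 (fst x) \<bullet> tA x = 0" "x \<in> E \<Longrightarrow> n2 (snd x) \<bullet> tB x = 0"
    "x \<in> E \<Longrightarrow> n3 (C x) \<bullet> tC x = 0"
  using h_nonzero[of x]
  unfolding tA_def tB_def tC_def inner_diff_right[of _ "_ *\<^sub>R _" "_ *\<^sub>R _"] inner_scaleR_right h_defs[symmetric]
  by simp_all

lemma tangent_in_N: "x \<in> E \<Longrightarrow> (a *\<^sub>R tA x, b *\<^sub>R tB x) \<in> N x"
  by (simp add: N_eq n_tangent)

lemma C_tangent:
  assumes x: "x \<in> flat N E" and v: "v \<in> N x"
  shows "n3 (C x) \<bullet> DC x v = 0"
proof -
  have "x \<in> W"
    using x flat_subset E_W by blast
  then have "((\<lambda>x. \<rho> (C x)) has_derivative (\<lambda>v. n3 (C x) \<bullet> DC x v)) (at x)"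
    using has_derivative_compose[OF C_der gradient] by blast
  from flatD[OF x this has_derivative_const[of 0] on_boundary v] show ?thesis
    by simp
qed

lemma DC_fixed_A:
  assumes x: "x \<in> flat N E"
  shows "DC x (0, k *\<^sub>R tB x) = - (k * c2 x) *\<^sub>R tC x"
proof -
  have E: "x \<in> E" and W: "x \<in> W"
    using x flat_subset E_W by blast+
  have v: "(0, k *\<^sub>R tB x) \<in> N x"
    using tangent_in_N[OF E, of 0 k] by simp
  note var = frame_variation[where P = fst and Q = snd and R = C, OF x v n_diff(1)[OF W] M_diff(1)[OF W]
      fst_snd_der C_der[OF W] transversal(1,2)[OF E] reflection(1) fst_conv, unfolded fst_conv snd_conv]
  have k: "k *\<^sub>R tB x = k *\<^sub>R ((1 / hBC x) *\<^sub>R (C x - snd x) - (1 / hBA x) *\<^sub>R (fst x - snd x))"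
    by (simp add: tB_def)
  show ?thesis
    unfolding c2_def tC_def
    by (rule variation_fixed_vertex[where P = "fst x" and Q = "snd x", OF hAB_def hAC_def hBA_def hBC_def hCA_def hCB_def
          h_nonzero[OF E] var[folded h_defs] k C_tangent[OF x v]])
qed

lemma DC_fixed_B:
  assumes x: "x \<in> flat N E"
  shows "DC x (k *\<^sub>R tA x, 0) = - (k * c1 x) *\<^sub>R tC x"
proof -
  have E: "x \<in> E" and W: "x \<in> W"
    using x flat_subset E_W by blast+
  have v: "(k *\<^sub>R tA x, 0) \<in> N x"
    using tangent_in_N[OF E, of k 0] by simp
  note var = frame_variation[where P = snd and Q = fst and R = C, OF x v n_diff(2)[OF W] M_diff(2)[OF W]
      fst_snd_der(2,1) C_der[OF W] transversal(3,4)[OF E] reflection(2) snd_conv, unfolded fst_conv snd_conv]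
  have k: "k *\<^sub>R tA x = (- k) *\<^sub>R ((1 / hAC x) *\<^sub>R (C x - fst x) - (1 / hAB x) *\<^sub>R (snd x - fst x))"
    by (simp add: tA_def algebra_simps)
  have "DC x (k *\<^sub>R tA x, 0) = - (- k * c1 x) *\<^sub>R ((1 / hCB x) *\<^sub>R (snd x - C x) - (1 / hCA x) *\<^sub>R (fst x - C x))"
    unfolding c1_def
    by (rule variation_fixed_vertex[where P = "snd x" and Q = "fst x", OF hBA_def hBC_def hAB_def hAC_def hCB_def hCA_def
          h_nonzero(3,4,1,2,6,5)[OF E] var[folded h_defs] k C_tangent[OF x v]])
  then show ?thesis
    by (simp add: tC_def algebra_simps)
qed

lemma in_plane:
  "tA x = (1 / hAB x) *\<^sub>R (snd x - fst x) + (- 1 / hAC x) *\<^sub>R (C x - fst x)"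
  "tB x = (1 / hBA x - 1 / hBC x) *\<^sub>R (snd x - fst x) + (1 / hBC x) *\<^sub>R (C x - fst x)"
  "tC x = (- 1 / hCB x) *\<^sub>R (snd x - fst x) + (1 / hCB x - 1 / hCA x) *\<^sub>R (C x - fst x)"
  by (simp_all add: tA_def tB_def tC_def algebra_simps)

lemma tB_nonzero: "x \<in> E \<Longrightarrow> tB x \<noteq> 0"
  using nondegenerate[of x] h_nonzero(4)[of x] unfolding in_plane by fastforce

lemma tC_nonzero: "x \<in> E \<Longrightarrow> tC x \<noteq> 0"
  using nondegenerate[of x] h_nonzero(6)[of x] unfolding in_plane by fastforce

text \<open>The laws at A and B determine how C moves; combining both deformations so that C rests
  brings in the law at C, and the transferred speeds must agree. The tangent at A divides the line
  BC in the ratio \<open>hAB / hAC\<close>, so this is Menelaus' condition for the three tangents.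
  As the framing lines meet the sides in the harmonic conjugate points, it is also Ceva's condition
  for the framing lines.\<close>

lemma menelaus:
  assumes x: "x \<in> flat N E"
  shows "hAB x * hBC x * hCA x = hAC x * hCB x * hBA x"
proof -
  have E: "x \<in> E" and W: "x \<in> W"
    using x flat_subset E_W by blast+
  \<comment> \<open>The velocities of A and B are weighted by \<open>c2\<close> and
    \<open>- c1\<close> so that their effects on C cancel.\<close>
  let ?v = "(c2 x *\<^sub>R tA x, (- c1 x) *\<^sub>R tB x)"
  have v: "?v \<in> N x"
    by (rule tangent_in_N[OF E])
  have "DC x ?v = DC x (c2 x *\<^sub>R tA x, 0) + DC x (0, (- c1 x) *\<^sub>R tB x)"
    using linear_add[OF linear_DC[OF W], of "(c2 x *\<^sub>R tA x, 0)" "(0, (- c1 x) *\<^sub>R tB x)"] by simp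
  also have "\<dots> = 0"
    unfolding DC_fixed_A[OF x] DC_fixed_B[OF x] by (simp add: algebra_simps)
  finally have DCv: "DC x ?v = 0" .
  note var = frame_variation[where P = C and Q = fst and R = snd, OF x v n_diff(3)[OF W] M_diff(3)[OF W]
      C_der[OF W] fst_snd_der transversal(5,6)[OF E] reflection(3) DCv, unfolded fst_conv snd_conv]
  have k: "c2 x *\<^sub>R tA x = c2 x *\<^sub>R ((1 / hAB x) *\<^sub>R (snd x - fst x) - (1 / hAC x) *\<^sub>R (C x - fst x))"
    by (simp add: tA_def)
  have nB: "n2 (snd x) \<bullet> ((- c1 x) *\<^sub>R tB x) = 0"
    using v N_eq[OF E] by simp
  have "(- c1 x) *\<^sub>R tB x = - (c2 x * ((hCB x)\<^sup>2 * hBA x / ((hCA x)\<^sup>2 * hAB x))) *\<^sub>R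
      ((1 / hBC x) *\<^sub>R (C x - snd x) - (1 / hBA x) *\<^sub>R (fst x - snd x))"
    by (rule variation_fixed_vertex[where P = "C x" and Q = "fst x" and R = "snd x",
          OF hCA_def hCB_def hAC_def hAB_def hBC_def hBA_def h_nonzero(5,6,2,1,4,3)[OF E] var[folded h_defs] k nB])
  then have "c1 x *\<^sub>R tB x = (c2 x * ((hCB x)\<^sup>2 * hBA x / ((hCA x)\<^sup>2 * hAB x))) *\<^sub>R tB x"
    by (simp add: tB_def[symmetric])
  then have "c1 x = c2 x * ((hCB x)\<^sup>2 * hBA x / ((hCA x)\<^sup>2 * hAB x))"
    using tB_nonzero[OF E] by simp
  then show ?thesis
    using menelaus_cubes[OF h_nonzero(1,2,4,3,5,6)[OF E]] unfolding c1_def c2_def by blast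
qed

end

section \<open>Second order: derivatives of Ceva's condition, commutator, curvatures\<close>

context orbit_family
begin

definition tA' :: "'v \<times> 'v \<Rightarrow> 'v \<times> 'v \<Rightarrow> 'v" where
  "tA' x v = (1 / hAB x) *\<^sub>R (snd v - fst v) - (hAB' x v / (hAB x)\<^sup>2) *\<^sub>R (snd x - fst x) -
    ((1 / hAC x) *\<^sub>R (DC x v - fst v) - (hAC' x v / (hAC x)\<^sup>2) *\<^sub>R (C x - fst x))"
definition tB' :: "'v \<times> 'v \<Rightarrow> 'v \<times> 'v \<Rightarrow> 'v" where
  "tB' x v = (1 / hBC x) *\<^sub>R (DC x v - snd v) - (hBC' x v / (hBC x)\<^sup>2) *\<^sub>R (C x - snd x) -
    ((1 / hBA x) *\<^sub>R (fst v - snd v) - (hBA' x v / (hBA x)\<^sup>2) *\<^sub>R (fst x - snd x))"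
definition tC' :: "'v \<times> 'v \<Rightarrow> 'v \<times> 'v \<Rightarrow> 'v" where
  "tC' x v = (1 / hCA x) *\<^sub>R (fst v - DC x v) - (hCA' x v / (hCA x)\<^sup>2) *\<^sub>R (fst x - C x) -
    ((1 / hCB x) *\<^sub>R (snd v - DC x v) - (hCB' x v / (hCB x)\<^sup>2) *\<^sub>R (snd x - C x))"

lemma t_der:
  assumes "x \<in> E"
  shows "(tA has_derivative tA' x) (at x)" "(tB has_derivative tB' x) (at x)" "(tC has_derivative tC' x) (at x)"
  unfolding tA_def[abs_def] tB_def[abs_def] tC_def[abs_def] tA'_def[abs_def] tB'_def[abs_def] tC'_def[abs_def]
  using subsetD[OF E_W assms]
  by (intro has_derivative_diff has_derivative_scaled_edge h_der fst_snd_der C_der h_nonzero assms; assumption)+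

definition c1' :: "'v \<times> 'v \<Rightarrow> 'v \<times> 'v \<Rightarrow> real" where
  "c1' x v = c1 x * ((hBC' x v / hBC x + hBC' x v / hBC x + hCA' x v / hCA x) -
    (hBA' x v / hBA x + hBA' x v / hBA x + hAC' x v / hAC x))"
definition c2' :: "'v \<times> 'v \<Rightarrow> 'v \<times> 'v \<Rightarrow> real" where
  "c2' x v = c2 x * ((hAC' x v / hAC x + hAC' x v / hAC x + hCB' x v / hCB x) -
    (hAB' x v / hAB x + hAB' x v / hAB x + hBC' x v / hBC x))"

lemma c_der:
  assumes "x \<in> E"
  shows "(c1 has_derivative c1' x) (at x)" "(c2 has_derivative c2' x) (at x)"
  unfolding c1'_def[abs_def] c2'_def[abs_def] c1_def[abs_def] c2_def[abs_def]
  by (rule has_derivative_quotient h_der[OF subsetD[OF E_W assms]] h_nonzero[OF assms])+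

lemma inner_edges:
  "n1 (fst x) \<bullet> (snd x - fst x) = hAB x" "n1 (fst x) \<bullet> (C x - fst x) = hAC x"
  "n2 (snd x) \<bullet> (snd x - fst x) = - hBA x" "n2 (snd x) \<bullet> (C x - fst x) = hBC x - hBA x"
  "n3 (C x) \<bullet> (snd x - fst x) = hCB x - hCA x" "n3 (C x) \<bullet> (C x - fst x) = - hCA x"
  by (simp_all add: h_defs inner_diff_right)

lemma inner_tangents:
  assumes "x \<in> E"
  shows "n1 (fst x) \<bullet> tB x = (hAC x - hAB x) / hBC x + hAB x / hBA x"
    "n1 (fst x) \<bullet> tC x = - hAC x / hCA x - (hAB x - hAC x) / hCB x"
    "n2 (snd x) \<bullet> tA x = - hBA x / hAB x - (hBC x - hBA x) / hAC x"
    "n2 (snd x) \<bullet> tC x = - (hBC x - hBA x) / hCA x + hBC x / hCB x"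
    "n3 (C x) \<bullet> tA x = (hCB x - hCA x) / hAB x + hCA x / hAC x"
    "n3 (C x) \<bullet> tB x = - hCB x / hBC x + (hCB x - hCA x) / hBA x"
  unfolding in_plane inner_add_right inner_scaleR_right inner_edges
  using h_nonzero[OF assms] by (simp_all add: field_simps)

lemma flat_E: "x \<in> flat N E \<Longrightarrow> x \<in> E"
  using flat_subset by blast

lemma flat_W: "x \<in> flat N E \<Longrightarrow> x \<in> W"
  using flat_E E_W by blast

lemma linear_Dn:
  assumes "x \<in> W"
  shows "linear (frechet_derivative n1 (at (fst x)))" "linear (frechet_derivative n2 (at (snd x)))"
    "linear (frechet_derivative n3 (at (C x)))"
  using n_diff[OF assms] by (auto intro: linear_frechet_derivative)

lemma DC_X: "x \<in> flat N E \<Longrightarrow> DC x (0, tB x) = - c2 x *\<^sub>R tC x"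
  using DC_fixed_A[of x 1] by simp

text \<open>A is at rest, and tangency kills \<open>n2\<close> on \<open>tB\<close> and
  \<open>n3\<close> on \<open>tC\<close>. What survives are values of the normals on tangent vectors
  at other vertices, computed in \<open>inner_tangents\<close>, and derivatives of \<open>n2\<close>
  and \<open>n3\<close>, which carry the curvatures.\<close>

lemma variation_X:
  assumes x: "x \<in> flat N E"
  shows "hAB' x (0, tB x) = n1 (fst x) \<bullet> tB x" "hAC' x (0, tB x) = - c2 x * (n1 (fst x) \<bullet> tC x)"
      "hBC' x (0, tB x) = frechet_derivative n2 (at (snd x)) (tB x) \<bullet> (C x - snd x) - c2 x * (n2 (snd x) \<bullet> tC x)"
      "hBA' x (0, tB x) = frechet_derivative n2 (at (snd x)) (tB x) \<bullet> (fst x - snd x)"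
      "hCA' x (0, tB x) = - c2 x * (frechet_derivative n3 (at (C x)) (tC x) \<bullet> (fst x - C x))"
      "hCB' x (0, tB x) = - c2 x * (frechet_derivative n3 (at (C x)) (tC x) \<bullet> (snd x - C x)) + n3 (C x) \<bullet> tB x"
  unfolding h'_defs
  by (simp_all add: DC_X[OF x] linear_0[OF linear_Dn(1)] linear_scale[OF linear_Dn(3)] linear_neg[OF linear_Dn(3)] flat_W[OF x]
      n_tangent[OF flat_E[OF x]] inner_diff_right[of _ "- _"] inner_diff_right[of _ _ "tB x"] inner_diff_right[of _ "tB x"]
      inner_diff_right[of _ "_ *\<^sub>R _"] inner_add_right[of _ "tB x"])

lemma DC_Y: "x \<in> flat N E \<Longrightarrow> DC x (tA x, 0) = - c1 x *\<^sub>R tC x"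
  using DC_fixed_B[of x 1] by simp

lemma variation_Y:
  assumes x: "x \<in> flat N E"
  shows "hAB' x (tA x, 0) = frechet_derivative n1 (at (fst x)) (tA x) \<bullet> (snd x - fst x)"
      "hAC' x (tA x, 0) = frechet_derivative n1 (at (fst x)) (tA x) \<bullet> (C x - fst x) - c1 x * (n1 (fst x) \<bullet> tC x)"
      "hBC' x (tA x, 0) = - c1 x * (n2 (snd x) \<bullet> tC x)"
      "hBA' x (tA x, 0) = n2 (snd x) \<bullet> tA x"
      "hCA' x (tA x, 0) = - c1 x * (frechet_derivative n3 (at (C x)) (tC x) \<bullet> (fst x - C x)) + n3 (C x) \<bullet> tA x"
      "hCB' x (tA x, 0) = - c1 x * (frechet_derivative n3 (at (C x)) (tC x) \<bullet> (snd x - C x))"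
  unfolding h'_defs
  by (simp_all add: DC_Y[OF x] linear_0[OF linear_Dn(2)] linear_scale[OF linear_Dn(3)] linear_neg[OF linear_Dn(3)] flat_W[OF x]
      n_tangent[OF flat_E[OF x]] inner_diff_right[of _ "- _"] inner_diff_right[of _ _ "tA x"] inner_diff_right[of _ "tA x"]
      inner_diff_right[of _ "_ *\<^sub>R _"] inner_add_right[of _ "tA x"])

text \<open>Ceva's condition is available at flat points of \<open>E\<close>, so it is
  differentiated at flat points of \<open>flat N E\<close>. Division by the common value of its two
  sides leaves logarithmic derivatives.\<close>

lemma menelaus_variation:
  assumes x: "x \<in> flat N (flat N E)" and v: "v \<in> N x"
  shows "hAB' x v / hAB x + hBC' x v / hBC x + hCA' x v / hCA x = hAC' x v / hAC x + hCB' x v / hCB x + hBA' x v / hBA x"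
proof -
  have E1: "x \<in> flat N E"
    using x flat_subset by blast
  then have E: "x \<in> E" and W: "x \<in> W"
    using flat_subset E_W by blast+
  note h = h_der[OF W] and nz = h_nonzero[OF E]
  note 1 = has_derivative_mult3[OF h(1,4,5) nz(1,4,5)] and 2 = has_derivative_mult3[OF h(2,6,3) nz(2,6,3)]
  show ?thesis
    using flatD[OF x 1 2 menelaus v] nz unfolding menelaus[OF E1] by simp
qed

text \<open>The formula for \<open>DC x (tA x, 0)\<close> is differentiated along
  \<open>(0, tB x)\<close> and the one for \<open>DC x (0, tB x)\<close> along
  \<open>(tA x, 0)\<close>. By symmetry the second derivatives of \<open>C\<close> cancel in the
  difference, so only first-order data remain.\<close>

lemma commutator:
  assumes x: "x \<in> flat N (flat N E)"
  shows "DC x (tA' x (0, tB x), 0) - DC x (0, tB' x (tA x, 0)) =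
    (c2' x (tA x, 0) - c1' x (0, tB x)) *\<^sub>R tC x - (c1 x *\<^sub>R tC' x (0, tB x) - c2 x *\<^sub>R tC' x (tA x, 0))"
proof -
  have E1: "x \<in> flat N E"
    using x flat_subset by blast
  then have E: "x \<in> E" and W: "x \<in> W"
    using flat_subset E_W by blast+
  let ?D2 = "\<lambda>u v. frechet_derivative (\<lambda>y. DC y u) (at x) v"
  have X: "(0, tB x) \<in> N x" and Y: "(tA x, 0) \<in> N x"
    using tangent_in_N[OF E, of 0 1] tangent_in_N[OF E, of 1 0] by simp_all
  have fY: "((\<lambda>y. DC y (tA y, 0)) has_derivative (\<lambda>v. ?D2 (tA x, 0) v + DC x (tA' x v, 0))) (at x)"
    by (rule frechet_derivative_field[OF C2 open_W W, where V = "\<lambda>y. (tA y, 0)"])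
      (intro has_derivative_Pair t_der[OF E] has_derivative_const)
  have fX: "((\<lambda>y. DC y (0, tB y)) has_derivative (\<lambda>v. ?D2 (0, tB x) v + DC x (0, tB' x v))) (at x)"
    by (rule frechet_derivative_field[OF C2 open_W W, where V = "\<lambda>y. (0, tB y)"])
      (intro has_derivative_Pair t_der[OF E] has_derivative_const)
  have g: "((\<lambda>y. (- c y) *\<^sub>R tC y) has_derivative (\<lambda>v. (- c x) *\<^sub>R tC' x v + (- c' v) *\<^sub>R tC x)) (at x)"
    if "(c has_derivative c') (at x)" for c c'
    by (rule has_derivative_scaleR[OF has_derivative_minus[OF that] t_der(3)[OF E]])
  have 1: "?D2 (tA x, 0) (0, tB x) + DC x (tA' x (0, tB x), 0) = (- c1 x) *\<^sub>R tC' x (0, tB x) + (- c1' x (0, tB x)) *\<^sub>R tC x"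
    by (rule flatD[OF x fY g[OF c_der(1)[OF E]] DC_Y X])
  have 2: "?D2 (0, tB x) (tA x, 0) + DC x (0, tB' x (tA x, 0)) = (- c2 x) *\<^sub>R tC' x (tA x, 0) + (- c2' x (tA x, 0)) *\<^sub>R tC x"
    by (rule flatD[OF x fX g[OF c_der(2)[OF E]] DC_X Y])
  have 3: "?D2 (tA x, 0) (0, tB x) = ?D2 (0, tB x) (tA x, 0)"
    by (rule symmetric_second_derivative[OF open_W W C2])
  have "a - b = (q' - p') *\<^sub>R t - (P - Q)"
    if "d + a = P' + (- p') *\<^sub>R t" "d + b = Q' + (- q') *\<^sub>R t" "P' = - P" "Q' = - Q" for a b d P Q P' Q' t :: 'v and p' q'
  proof -
    have "a - b = (d + a) - (d + b)"
      by simp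
    then show ?thesis
      unfolding that by (simp add: algebra_simps)
  qed
  from this[OF 1 2[folded 3] scaleR_minus_left scaleR_minus_left] show ?thesis .
qed

text \<open>Up to sign and scale, the second fundamental form of the boundary on its tangent
  direction inside the orbit plane, when \<open>n1\<close> is the gradient of a defining function;
  likewise \<open>kB\<close> and \<open>kC\<close>.\<close>

definition kA :: "'v \<times> 'v \<Rightarrow> real" where "kA x = frechet_derivative n1 (at (fst x)) (tA x) \<bullet> tA x"
definition kB :: "'v \<times> 'v \<Rightarrow> real" where "kB x = frechet_derivative n2 (at (snd x)) (tB x) \<bullet> tB x"
definition kC :: "'v \<times> 'v \<Rightarrow> real" where "kC x = frechet_derivative n3 (at (C x)) (tC x) \<bullet> tC x"

text \<open>Every term of \<open>commutator\<close> is a multiple of \<open>tC x\<close>, which is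
  non-zero, so the vector identity is one scalar equation. It is the third equation for
  \<open>curvature_relations\<close>, besides the two derivatives of Ceva's condition.\<close>

lemma curvature_zero:
  assumes x: "x \<in> flat N (flat N E)"
  shows "kA x = 0" "kB x = 0" "kC x = 0"
proof -
  have E1: "x \<in> flat N E"
    using x flat_subset by blast
  then have E: "x \<in> E" and W: "x \<in> W"
    using flat_subset E_W by blast+
  let ?X = "(0, tB x)" and ?Y = "(tA x, 0)"
  have X: "?X \<in> N x" and Y: "?Y \<in> N x"
    using tangent_in_N[OF E, of 0 1] tangent_in_N[OF E, of 1 0] by simp_all
  note nz = h_nonzero(1,2,4,3,5,6)[OF E] and vX = variation_X[OF E1] DC_X[OF E1] and vY = variation_Y[OF E1] DC_Y[OF E1]
    and dots = inner_tangents[OF E]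
  define e1 e2 where "e1 = snd x - fst x" and "e2 = C x - fst x"
  have e: "snd x - fst x = e1" "C x - fst x = e2" "fst x - snd x = - e1" "C x - snd x = e2 - e1"
      "fst x - C x = - e2" "snd x - C x = e1 - e2"
    by (simp_all add: e1_def e2_def)
  note tv = tangent_variations[OF nz menelaus[OF E1] c1_def c2_def tA_def[of x, unfolded e] tB_def[of x, unfolded e] tC_def[of x, unfolded e]]
  have A: "tA' x ?X = - (2 * hAC x / (hAB x * hBC x)) *\<^sub>R tA x"
    unfolding tv(1)[symmetric] tA'_def vX dots fst_conv snd_conv e by simp
  have B: "tB' x ?Y = (2 * hBC x / (hAC x * hBA x)) *\<^sub>R tB x"
    unfolding tv(2)[symmetric] tB'_def vY dots fst_conv snd_conv e by simp
  have C: "c1 x *\<^sub>R tC' x ?X - c2 x *\<^sub>R tC' x ?Y = (2 * hBC x / (hAC x * hBA x) * c2 x) *\<^sub>R tC x"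
  proof -
    have "c1 x *\<^sub>R tC' x ?X - c2 x *\<^sub>R tC' x ?Y =
      (1 / hCA x) *\<^sub>R (- c2 x *\<^sub>R tA x) - (- c2 x * (n3 (C x) \<bullet> tA x) / (hCA x)\<^sup>2) *\<^sub>R (- e2) -
      ((1 / hCB x) *\<^sub>R (c1 x *\<^sub>R tB x) - (c1 x * (n3 (C x) \<bullet> tB x) / (hCB x)\<^sup>2) *\<^sub>R (e1 - e2))"
      unfolding tC'_def vX vY fst_conv snd_conv e by (simp add: algebra_simps add_divide_distrib diff_divide_distrib)
    then show ?thesis
      unfolding tv(3)[symmetric] dots by simp
  qed
  have "DC x (tA' x ?X, 0) = (2 * hAC x / (hAB x * hBC x) * c1 x) *\<^sub>R tC x"
    unfolding A DC_fixed_B[OF E1] by simp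
  moreover have "DC x (0, tB' x ?Y) = - (2 * hBC x / (hAC x * hBA x) * c2 x) *\<^sub>R tC x"
    unfolding B DC_fixed_A[OF E1] by simp
  \<comment> \<open>Ceva's condition in another guise: both terms on the left of
    \<open>commutator\<close> contribute the same amount \<open>K\<close>.\<close>
  moreover have "2 * hAC x / (hAB x * hBC x) * c1 x = 2 * hBC x / (hAC x * hBA x) * c2 x"
    using menelaus[OF E1] nz unfolding c1_def c2_def by (simp add: field_simps power2_eq_square)
  moreover define K where "K = 2 * hBC x / (hAC x * hBA x) * c2 x"
  ultimately have "K *\<^sub>R tC x + K *\<^sub>R tC x = (c2' x ?Y - c1' x ?X) *\<^sub>R tC x - K *\<^sub>R tC x"
    using commutator[OF x] unfolding C by simp
  then have "(K + K + K + c1' x ?X - c2' x ?Y) *\<^sub>R tC x = 0"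
    unfolding scaleR_left_distrib scaleR_left_diff_distrib by (simp add: algebra_simps)
  \<comment> \<open>Two copies of \<open>K\<close> come from the left side of
    \<open>commutator\<close> and one from \<open>C\<close>; with the 2 inside \<open>K\<close> this
    gives the coefficient 6.\<close>
  then have "6 * hBC x / (hAC x * hBA x) * c2 x + c1' x ?X - c2' x ?Y = 0"
    using tC_nonzero[OF E] by (simp add: K_def mult.assoc mult.commute[of "hBA x" "hAC x"])
  note int = this
  have int': "6 * hBC x / (hAC x * hBA x) * c2 x +
      c1 x * (2 * hBC' x ?X / hBC x + hCA' x ?X / hCA x - 2 * hBA' x ?X / hBA x - hAC' x ?X / hAC x) -
      c2 x * (2 * hAC' x ?Y / hAC x + hCB' x ?Y / hCB x - 2 * hAB' x ?Y / hAB x - hBC' x ?Y / hBC x) = 0"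
    using int unfolding c1'_def c2'_def by (simp add: algebra_simps)
  note cr = curvature_relations[OF nz menelaus[OF E1] c1_def c2_def vX(1-6)[unfolded dots]
      vY(1-6)[unfolded dots] menelaus_variation[OF x X] menelaus_variation[OF x Y] int']
  show "kA x = 0"
    using cr(1) unfolding kA_def tA_def[of x] inner_diff_right[of _ "_ *\<^sub>R _" "_ *\<^sub>R _"] inner_scaleR_right by simp
  show "kB x = 0"
    using cr(2) unfolding kB_def tB_def[of x] inner_diff_right[of _ "_ *\<^sub>R _" "_ *\<^sub>R _"] inner_scaleR_right by simp
  show "kC x = 0"
    using cr(3) unfolding kC_def tC_def[of x] inner_diff_right[of _ "_ *\<^sub>R _" "_ *\<^sub>R _"] inner_scaleR_right by simp
qed

end

section \<open>Excluding dimensions above two\<close>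

lemma det3_eq_0:
  fixes w e1 e2 z g1 g2 :: "'a::real_inner"
  assumes "w = a *\<^sub>R e1 + b *\<^sub>R e2"
  shows "(w \<bullet> z) * ((e1 \<bullet> g1) * (e2 \<bullet> g2) - (e1 \<bullet> g2) * (e2 \<bullet> g1)) +
    ((e1 \<bullet> z) * ((e2 \<bullet> g1) * (w \<bullet> g2) - (w \<bullet> g1) * (e2 \<bullet> g2)) +
     (e2 \<bullet> z) * ((w \<bullet> g1) * (e1 \<bullet> g2) - (w \<bullet> g2) * (e1 \<bullet> g1))) = 0"
  unfolding assms by (simp add: inner_add_left algebra_simps)

lemma gram_pos:
  fixes x y :: "'a::real_inner"
  assumes "\<And>a b. a *\<^sub>R x + b *\<^sub>R y = 0 \<Longrightarrow> a = 0 \<and> b = 0"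
  shows "(x \<bullet> x) * (y \<bullet> y) - (x \<bullet> y) * (y \<bullet> x) > 0"
proof -
  have "y \<noteq> 0"
    using assms[of 0 1] by auto
  define a where "a = (x \<bullet> y) / (y \<bullet> y)"
  have "x - a *\<^sub>R y \<noteq> 0"
    using assms[of 1 "- a"] by auto
  then have "0 < (x - a *\<^sub>R y) \<bullet> (x - a *\<^sub>R y)"
    by simp
  also have "\<dots> = x \<bullet> x - (x \<bullet> y) * (x \<bullet> y) / (y \<bullet> y)"
    using \<open>y \<noteq> 0\<close> by (simp add: a_def inner_diff_left inner_diff_right inner_commute[of y x] field_simps)
  finally show ?thesis
    using \<open>y \<noteq> 0\<close> by (simp add: field_simps inner_commute[of y x])
qed

lemma has_derivative_mult_zero:
  fixes f g :: "'a::real_normed_vector \<Rightarrow> real"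
  assumes "(f has_derivative f') (at x)" "g differentiable (at x)" "f x = 0"
  shows "((\<lambda>x. f x * g x) has_derivative (\<lambda>v. f' v * g x)) (at x)"
proof -
  obtain g' where "(g has_derivative g') (at x)"
    using assms(2) by (auto simp: differentiable_def)
  from has_derivative_mult[OF assms(1) this] show ?thesis
    by (simp add: assms(3))
qed

lemma has_derivative_recip:
  fixes h :: "'a::real_normed_vector \<Rightarrow> real"
  assumes "(h has_derivative h') (at x)" "h x \<noteq> 0"
  shows "((\<lambda>x. 1 / h x) has_derivative (\<lambda>v. - (h' v / (h x)\<^sup>2))) (at x)"
  using Deriv.has_derivative_inverse[OF assms(2,1)] by (simp add: inverse_eq_divide power2_eq_square)

text \<open>The left-hand side is twice the derivative of \<mu> along \<open>(tA, 0)\<close>.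
  Vanishing curvature at A removes \<open>a1\<close> and \<open>a2\<close>, and Ceva's condition
  collapses the rest to an expression that is visibly non-zero.\<close>

lemma cevian_speed:
  fixes p q r s t u c1 :: real
  assumes nz: "p \<noteq> 0" "q \<noteq> 0" "r \<noteq> 0" "s \<noteq> 0" "t \<noteq> 0" "u \<noteq> 0"
    and men: "p * r * t = q * u * s" and c1: "c1 = r\<^sup>2 * t / (s\<^sup>2 * q)" and k: "a1 / p - a2 / q = 0"
  shows "- ((- s / p - (r - s) / q) / s\<^sup>2) + - (- c1 * (- (r - s) / t + r / u) / r\<^sup>2) +
    q / (p * r) * ((a2 - c1 * (- q / t - (p - q) / u)) / q - (a1 / p + - c1 * (- (r - s) / t + r / u) / r)) = 4 / (p * s)"
proof -
  have u: "u = p * r * t / (q * s)"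
    using men nz by (simp add: field_simps)
  have "q / (p * r) * ((a2 - c1 * (- q / t - (p - q) / u)) / q - (a1 / p + - c1 * (- (r - s) / t + r / u) / r)) =
    q / (p * r) * ((- c1 * (- q / t - (p - q) / u)) / q - (- c1 * (- (r - s) / t + r / u) / r))"
    using k by (simp add: diff_divide_distrib)
  also have "- ((- s / p - (r - s) / q) / s\<^sup>2) + - (- c1 * (- (r - s) / t + r / u) / r\<^sup>2) + \<dots> = 4 / (p * s)"
    using nz unfolding c1 u by (simp add: field_simps power2_eq_square)
  finally show ?thesis .
qed

context orbit_family
begin

text \<open>The framing lines at \<open>A\<close> and \<open>B\<close> meet at the point \<open>B + M\<^sub>B / \<mu>\<close> (at infinity if \<open>\<mu> = 0\<close>).\<close>

definition \<mu> :: "'v \<times> 'v \<Rightarrow> real" where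
  "\<mu> x = (1 / hBA x + 1 / hBC x + hAC x / (hAB x * hBC x)) / 2"
definition \<mu>' :: "'v \<times> 'v \<Rightarrow> 'v \<times> 'v \<Rightarrow> real" where
  "\<mu>' x v = (- (hBA' x v / (hBA x)\<^sup>2) + - (hBC' x v / (hBC x)\<^sup>2) +
    hAC x / (hAB x * hBC x) * (hAC' x v / hAC x - (hAB' x v / hAB x + hBC' x v / hBC x))) / 2"

lemma \<mu>_der:
  assumes "x \<in> E"
  shows "(\<mu> has_derivative \<mu>' x) (at x)"
proof -
  have W: "x \<in> W"
    using assms E_W by blast
  note nz = h_nonzero[OF assms] and h = h_der[OF W]
  have "((\<lambda>x. hAC x / (hAB x * hBC x)) has_derivative (\<lambda>v. hAC x / (hAB x * hBC x) *
      (hAC' x v / hAC x - (hAB' x v / hAB x + hBC' x v / hBC x)))) (at x)"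
    using nz by (intro has_log_derivative_divide has_log_derivative_mult has_log_derivative h) auto
  then show ?thesis
    unfolding \<mu>_def[abs_def] \<mu>'_def[abs_def]
    by (intro bounded_linear.has_derivative[OF bounded_linear_divide] has_derivative_add has_derivative_recip h nz)
qed

text \<open>\<open>hAC x / hBC x\<close> is the factor that equates the components along
  \<open>C x - fst x\<close>; the difference is then a multiple of \<open>snd x - fst x\<close>, and
  \<mu> is its coefficient. Division by \<mu>, where it is non-zero, exhibits the common point of
  the two framing lines.\<close>

lemma cevians_meet:
  assumes "x \<in> E"
  shows "(hAC x / hBC x) *\<^sub>R M1 (fst x) = M2 (snd x) + \<mu> x *\<^sub>R (snd x - fst x)"
proof -
  note nz = h_nonzero[OF assms]
  define e1 e2 where "e1 = snd x - fst x" and "e2 = C x - fst x"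
  have e: "snd x - fst x = e1" "C x - fst x = e2" "fst x - snd x = - e1" "C x - snd x = e2 - e1"
    by (simp_all add: e1_def e2_def)
  have M: "M1 (fst x) = (1 / 2) *\<^sub>R ((1 / hAB x) *\<^sub>R (snd x - fst x) + (1 / hAC x) *\<^sub>R (C x - fst x))"
    "M2 (snd x) = (1 / 2) *\<^sub>R ((1 / hBA x) *\<^sub>R (fst x - snd x) + (1 / hBC x) *\<^sub>R (C x - snd x))"
    unfolding h_defs reflection(1,2)[OF assms, symmetric] by simp_all
  have "(hAC x / hBC x) *\<^sub>R M1 (fst x) = (hAC x / (hAB x * hBC x) / 2) *\<^sub>R e1 + (1 / hBC x / 2) *\<^sub>R e2"
    unfolding M e using nz by (simp add: algebra_simps)
  also have "\<dots> = M2 (snd x) + \<mu> x *\<^sub>R (snd x - fst x)"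
    unfolding M e \<mu>_def
    by (simp add: algebra_simps add_divide_distrib)
  finally show ?thesis .
qed

lemma M1_in_plane:
  assumes "x \<in> E"
  shows "M1 (fst x) = (1 / hAB x / 2) *\<^sub>R (snd x - fst x) + (1 / hAC x / 2) *\<^sub>R (C x - fst x)"
proof -
  have "M1 (fst x) = (1 / 2) *\<^sub>R ((1 / hAB x) *\<^sub>R (snd x - fst x) + (1 / hAC x) *\<^sub>R (C x - fst x))"
    unfolding h_defs reflection(1)[OF assms, symmetric] by simp
  then show ?thesis
    by (simp add: scaleR_add_right mult.commute)
qed

text \<open>With A at rest, all terms in the derivative of \<open>cevians_meet\<close> other than
  the two named here are multiples of \<open>M1\<close> or of \<open>snd x - fst x\<close>, hence
  lie in the plane. This holds for every tangent \<open>v\<close> at B, also for those that leave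
  the plane.\<close>

lemma frame_turns_in_plane:
  assumes x: "x \<in> flat N E" and v: "n2 (snd x) \<bullet> v = 0"
  obtains a b where "frechet_derivative M2 (at (snd x)) v + \<mu> x *\<^sub>R v = a *\<^sub>R (snd x - fst x) + b *\<^sub>R (C x - fst x)"
proof -
  have E: "x \<in> E" and W: "x \<in> W"
    using x flat_subset E_W by blast+
  have vN: "(0, v) \<in> N x"
    using v by (simp add: N_eq[OF E])
  have M: "((\<lambda>y. M1 (fst y)) has_derivative (\<lambda>v. frechet_derivative M1 (at (fst x)) (fst v))) (at x)"
    "((\<lambda>y. M2 (snd y)) has_derivative (\<lambda>v. frechet_derivative M2 (at (snd x)) (snd v))) (at x)"
    using has_derivative_compose[OF fst_snd_der(1)] has_derivative_compose[OF fst_snd_der(2)] M_diff[OF W]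
      frechet_derivative_works by blast+
  have "(\<lambda>y. hAC y / hBC y) differentiable (at x)"
    using h_der[OF W] h_nonzero[OF E] by (intro differentiable_divide) (auto simp: differentiable_def)
  then obtain \<kappa>' where \<kappa>: "((\<lambda>y. hAC y / hBC y) has_derivative \<kappa>') (at x)"
    by (auto simp: differentiable_def)
  note 1 = has_derivative_scaleR[OF \<kappa> M(1)]
    and 2 = has_derivative_add[OF M(2) has_derivative_scaleR[OF \<mu>_der[OF E] has_derivative_diff[OF fst_snd_der(2,1)]]]
  have "linear (frechet_derivative M1 (at (fst x)))"
    using M_diff[OF W] by (auto intro: linear_frechet_derivative)
  then have "frechet_derivative M2 (at (snd x)) v + \<mu> x *\<^sub>R v = \<kappa>' (0, v) *\<^sub>R M1 (fst x) - \<mu>' x (0, v) *\<^sub>R (snd x - fst x)"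
    using flatD[OF x 1 2 cevians_meet vN] by (simp add: linear_0 algebra_simps)
  also have "\<dots> = (\<kappa>' (0, v) * (1 / hAB x / 2) - \<mu>' x (0, v)) *\<^sub>R (snd x - fst x) + (\<kappa>' (0, v) * (1 / hAC x / 2)) *\<^sub>R (C x - fst x)"
    unfolding M1_in_plane[OF E] by (simp add: scaleR_add_right scaleR_left_diff_distrib)
  finally show ?thesis
    using that by blast
qed

lemma \<mu>_variation:
  assumes x: "x \<in> flat N (flat N E)"
  shows "\<mu>' x (tA x, 0) = 2 / (hAB x * hBA x)"
proof -
  have E1: "x \<in> flat N E"
    using x flat_subset by blast
  then have E: "x \<in> E"
    using flat_subset by blast
  have k: "frechet_derivative n1 (at (fst x)) (tA x) \<bullet> (snd x - fst x) / hAB x - frechet_derivative n1 (at (fst x)) (tA x) \<bullet> (C x - fst x) / hAC x = 0"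
    using curvature_zero(1)[OF x]
    unfolding kA_def tA_def[of x] inner_diff_right[of _ "_ *\<^sub>R _" "_ *\<^sub>R _"] inner_scaleR_right by simp
  show ?thesis
    unfolding \<mu>'_def variation_Y[OF E1] inner_tangents[OF E]
      cevian_speed[OF h_nonzero(1,2,4,3,5,6)[OF E] menelaus[OF E1] c1_def k] by simp
qed

text \<open>Fix \<open>B\<close> and let \<open>A\<close> move inside the plane of the orbit. The plane is constant to first order while the
  point where the framing lines meet moves along the line at \<open>B\<close>, so all tangent directions at \<open>B\<close>
  would have to lie in the plane.\<close>

theorem dim_le_2:
  assumes x: "x \<in> flat N (flat N E)" and M2: "open U" "ck_on 2 M2 U" "snd x \<in> U"
  shows "DIM('v) \<le> 2"
proof (rule ccontr)
  assume dim: "\<not> DIM('v) \<le> 2"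
  have E1: "x \<in> flat N E"
    using x flat_subset by blast
  then have E: "x \<in> E" and W: "x \<in> W"
    using flat_subset E_W by blast+
  define g1 g2 where "g1 = snd x - fst x" and "g2 = C x - fst x"
  have "dim {g1, g2} \<le> 2"
    using dim_le_card'[of "{g1, g2}"] card_insert_le_m1[of 2 "{g2}" g1] by (simp add: card_insert_if split: if_splits)
  then have "dim {g1, g2} < DIM('v)"
    using dim by simp
  then have "span {g1, g2} \<noteq> UNIV"
    by (metis dim_UNIV dim_span less_irrefl)
  then obtain z where z: "z \<noteq> 0" "\<And>y. y \<in> span {g1, g2} \<Longrightarrow> z \<bullet> y = 0"
    using span_not_univ_subset_hyperplane[of "{g1, g2}"] by blast
  have zg: "g1 \<bullet> z = 0" "g2 \<bullet> z = 0"
    using z(2)[of g1] z(2)[of g2] span_base[of _ "{g1, g2}"] by (auto simp: inner_commute)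
  have plane: "t \<bullet> z = 0" if "t = a *\<^sub>R g1 + b *\<^sub>R g2" for t a b
    unfolding that by (simp add: inner_add_left zg)
  have tz: "tA x \<bullet> z = 0" "tC x \<bullet> z = 0"
    using plane in_plane(1,3)[of x] unfolding g1_def g2_def by blast+
  \<comment> \<open>The tangential part of \<open>z\<close>, extended to a field that depends on B
    alone. It is tangent to the second boundary, and at \<open>x\<close> it has a non-zero component
    out of the plane.\<close>
  define \<eta> where "\<eta> b = z - ((n2 b \<bullet> z) / (n2 b \<bullet> n2 b)) *\<^sub>R n2 b" for b
  have n2_nz: "n2 (snd y) \<noteq> 0" if "y \<in> E" for y
    using transversal(3)[OF that] by auto
  have \<eta>_tangent: "n2 (snd y) \<bullet> \<eta> (snd y) = 0" if "y \<in> E" for y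
    using n2_nz[OF that] by (simp add: \<eta>_def inner_diff_right)
  have \<eta>z: "\<eta> (snd x) \<bullet> z \<noteq> 0"
  proof -
    let ?n = "n2 (snd x)"
    have "a = 0 \<and> b = 0" if ab: "a *\<^sub>R ?n + b *\<^sub>R z = 0" for a b
    proof -
      have "(a *\<^sub>R ?n + b *\<^sub>R z) \<bullet> g1 = 0"
        using ab by simp
      then have "a * (?n \<bullet> g1) = 0"
        by (simp add: inner_add_left inner_commute[of z] zg)
      moreover have "?n \<bullet> g1 \<noteq> 0"
        using inner_edges(3)[of x] h_nonzero(3)[OF E] by (simp add: g1_def)
      ultimately show ?thesis
        using ab z(1) by simp
    qed
    from gram_pos[of ?n z, OF this] show ?thesis
      using n2_nz[OF E] by (simp add: \<eta>_def inner_diff_left inner_commute[of z ?n] field_simps)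
  qed
  have "\<eta> differentiable (at (snd x))"
    unfolding \<eta>_def using n_diff(2)[OF W] n2_nz[OF E]
    by (intro differentiable_diff differentiable_scaleR differentiable_divide differentiable_inner differentiable_const) auto
  then obtain \<eta>' where \<eta>': "(\<eta> has_derivative \<eta>') (at (snd x))"
    by (auto simp: differentiable_def)
  obtain m' where m: "((\<lambda>b. frechet_derivative M2 (at b) (\<eta> b)) has_derivative m') (at (snd x))"
    using frechet_derivative_field[OF M2(2,1,3) \<eta>'] by blast
  \<comment> \<open>By \<open>frame_turns_in_plane\<close> this vector lies in the orbit plane at
    every flat point. While B rests, it varies only through \<mu>.\<close>
  define w where "w y = frechet_derivative M2 (at (snd y)) (\<eta> (snd y)) + \<mu> y *\<^sub>R \<eta> (snd y)" for y
  have wd: "(w has_derivative (\<lambda>v. m' (snd v) + (\<mu> x *\<^sub>R \<eta>' (snd v) + \<mu>' x v *\<^sub>R \<eta> (snd x)))) (at x)"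
    unfolding w_def
    by (intro has_derivative_add has_derivative_scaleR \<mu>_der[OF E] has_derivative_compose[OF fst_snd_der(2) m]
        has_derivative_compose[OF fst_snd_der(2) \<eta>'])
  have w_plane: "\<exists>a b. w y = a *\<^sub>R (snd y - fst y) + b *\<^sub>R (C y - fst y)" if "y \<in> flat N E" for y
  proof -
    have "y \<in> E"
      using that flat_subset by blast
    from frame_turns_in_plane[OF that \<eta>_tangent[OF this]] show ?thesis
      unfolding w_def by metis
  qed
  have e1d: "((\<lambda>y. snd y - fst y) has_derivative (\<lambda>v. snd v - fst v)) (at x)"
    and e2d: "((\<lambda>y. C y - fst y) has_derivative (\<lambda>v. DC x v - fst v)) (at x)"
    by (intro has_derivative_diff fst_snd_der C_der[OF W])+
  have diff: "w differentiable (at x)" "(\<lambda>y. snd y - fst y) differentiable (at x)" "(\<lambda>y. C y - fst y) differentiable (at x)"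
    using wd e1d e2d by (auto simp: differentiable_def)
  define G where "G = (g1 \<bullet> g1) * (g2 \<bullet> g2) - (g1 \<bullet> g2) * (g2 \<bullet> g1)"
  have "G > 0"
    unfolding G_def g1_def g2_def by (rule gram_pos[OF nondegenerate[OF E]])
  \<comment> \<open>The determinant of \<open>w y\<close> and the two sides at A, tested against
    \<open>z\<close>, \<open>g1\<close>, \<open>g2\<close> and expanded along the pairings with
    \<open>z\<close>. These pairings vanish at \<open>x\<close>, so only their derivatives enter the
    derivative of the determinant.\<close>
  let ?\<Delta> = "\<lambda>y. (w y \<bullet> z) * (((snd y - fst y) \<bullet> g1) * ((C y - fst y) \<bullet> g2) - ((snd y - fst y) \<bullet> g2) * ((C y - fst y) \<bullet> g1)) +
    (((snd y - fst y) \<bullet> z) * (((C y - fst y) \<bullet> g1) * (w y \<bullet> g2) - (w y \<bullet> g1) * ((C y - fst y) \<bullet> g2)) +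
     ((C y - fst y) \<bullet> z) * ((w y \<bullet> g1) * ((snd y - fst y) \<bullet> g2) - (w y \<bullet> g2) * ((snd y - fst y) \<bullet> g1)))"
  have \<Delta>0: "?\<Delta> y = 0" if "y \<in> flat N E" for y
    using w_plane[OF that] det3_eq_0 by blast
  have wz: "w x \<bullet> z = 0"
    using w_plane[OF E1] plane unfolding g1_def g2_def by blast
  let ?P = "((C x - fst x) \<bullet> g1) * (w x \<bullet> g2) - (w x \<bullet> g1) * ((C x - fst x) \<bullet> g2)"
  let ?Q = "(w x \<bullet> g1) * ((snd x - fst x) \<bullet> g2) - (w x \<bullet> g2) * ((snd x - fst x) \<bullet> g1)"
  have inner_d: "((\<lambda>y. f y \<bullet> z) has_derivative (\<lambda>v. f' v \<bullet> z)) (at x)" if "(f has_derivative f') (at x)" for f f'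
    by (rule bounded_linear.has_derivative[OF bounded_linear_inner_left that])
  have \<Delta>d: "(?\<Delta> has_derivative (\<lambda>v. ((m' (snd v) + (\<mu> x *\<^sub>R \<eta>' (snd v) + \<mu>' x v *\<^sub>R \<eta> (snd x))) \<bullet> z) *
        (((snd x - fst x) \<bullet> g1) * ((C x - fst x) \<bullet> g2) - ((snd x - fst x) \<bullet> g2) * ((C x - fst x) \<bullet> g1)) +
      (((snd v - fst v) \<bullet> z) * ?P + ((DC x v - fst v) \<bullet> z) * ?Q))) (at x)"
    using zg wz
    by (intro has_derivative_add has_derivative_mult_zero inner_d wd e1d e2d differentiable_diff differentiable_mult
        differentiable_inner diff differentiable_const) (auto simp: g1_def g2_def)
  have Y: "(tA x, 0) \<in> N x"
    using tangent_in_N[OF E, of 1 0] by simp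
  have lin: "linear m'" "linear \<eta>'"
    using m \<eta>' by (auto simp: has_derivative_def bounded_linear.linear)
  \<comment> \<open>Along \<open>(tA x, 0)\<close> the sides move by combinations of
    \<open>tA x\<close> and \<open>tC x\<close>, which are orthogonal to \<open>z\<close>; only the
    change of \<mu> contributes.\<close>
  have "(\<mu>' x (tA x, 0) * (\<eta> (snd x) \<bullet> z)) * G = 0"
    using flatD[OF x \<Delta>d has_derivative_const \<Delta>0 Y]
    by (simp add: lin linear_0 DC_Y[OF E1] inner_diff_left tz G_def g1_def g2_def)
  then show False
    using \<open>G > 0\<close> \<eta>z h_nonzero[OF E] unfolding \<mu>_variation[OF x] by simp
qed

end

section \<open>Local description of line-framed hypersurfaces\<close>

lemma ck_on_sum:
  assumes "open S" "finite I" "\<And>i. i \<in> I \<Longrightarrow> ck_on k (f i) S"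
  shows "ck_on k (\<lambda>x. \<Sum>i\<in>I. f i x) S"
  using assms(2,3)
proof (induction I rule: finite_induct)
  case empty
  then show ?case
    by (simp add: ck_on_const assms(1))
next
  case (insert i I)
  then show ?case
    by (simp add: ck_on_add assms(1))
qed

lemma smooth_on_differentiable:
  assumes "smooth_on f S" "x \<in> S"
  shows "f differentiable (at x)"
  using assms ck_on.simps(2)[of 0 f S] unfolding smooth_on_def by blast

section \<open>Tangent spaces read off in slice charts\<close>

lemma slice_chart_derivative:
  assumes "slice_chart S k U \<phi> T" "x \<in> U"
  obtains \<phi>' \<psi>' where "(\<phi> has_derivative \<phi>') (at x)" "(inv_into U \<phi> has_derivative \<psi>') (at (\<phi> x))"
    "\<forall>v. \<psi>' (\<phi>' v) = v" "\<forall>w. \<phi>' (\<psi>' w) = w"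
proof -
  let ?\<psi> = "inv_into U \<phi>"
  have c: "open U" "open (\<phi> ` U)" "inj_on \<phi> U" "smooth_on \<phi> U" "smooth_on ?\<psi> (\<phi> ` U)"
    using assms(1) by (auto simp: slice_chart_def)
  obtain \<phi>' where \<phi>': "(\<phi> has_derivative \<phi>') (at x)"
    using smooth_on_differentiable[OF c(4) assms(2)] by (auto simp: differentiable_def)
  obtain \<psi>' where \<psi>': "(?\<psi> has_derivative \<psi>') (at (\<phi> x))"
    using smooth_on_differentiable[OF c(5)] assms(2) by (auto simp: differentiable_def)
  have "((\<lambda>y. ?\<psi> (\<phi> y)) has_derivative (\<lambda>v. \<psi>' (\<phi>' v))) (at x)"
    by (rule has_derivative_compose[OF \<phi>' \<psi>'])
  moreover have "((\<lambda>y. ?\<psi> (\<phi> y)) has_derivative (\<lambda>v. v)) (at x)"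
    by (rule has_derivative_transform_within_open[OF has_derivative_ident c(1) assms(2)])
      (simp add: inv_into_f_f[OF c(3)])
  ultimately have 1: "(\<lambda>v. \<psi>' (\<phi>' v)) = (\<lambda>v. v)"
    by (rule has_derivative_unique)
  have "?\<psi> (\<phi> x) = x"
    by (rule inv_into_f_f[OF c(3) assms(2)])
  then have "((\<lambda>y. \<phi> (?\<psi> y)) has_derivative (\<lambda>v. \<phi>' (\<psi>' v))) (at (\<phi> x))"
    using has_derivative_compose[OF \<psi>'] \<phi>' by simp
  moreover have "((\<lambda>y. \<phi> (?\<psi> y)) has_derivative (\<lambda>v. v)) (at (\<phi> x))"
    by (rule has_derivative_transform_within_open[OF has_derivative_ident c(2)])
      (use assms(2) in \<open>simp_all add: f_inv_into_f\<close>)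
  ultimately have 2: "(\<lambda>v. \<phi>' (\<psi>' v)) = (\<lambda>v. v)"
    by (rule has_derivative_unique)
  show ?thesis
    using that \<phi>' \<psi>' fun_cong[OF 1] fun_cong[OF 2] by blast
qed

text \<open>Membership in \<open>T\<close> is tested on the orthogonal complement, where the image
  curve has coordinate 0. The curve is only assumed differentiable at 0, as are the curves in
  \<open>flat_nonempty\<close>.\<close>

lemma slice_chart_velocity:
  fixes \<gamma> :: "real \<Rightarrow> 'a::euclidean_space"
  assumes chart: "slice_chart S k U \<phi> T" and x: "x \<in> U" and \<phi>': "(\<phi> has_derivative \<phi>') (at x)"
    and \<gamma>: "e > 0" "\<And>t. t \<in> {-e<..<e} \<Longrightarrow> \<gamma> t \<in> S" "\<gamma> 0 = x" "(\<gamma> has_vector_derivative v) (at 0)"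
  shows "\<phi>' v \<in> T"
proof -
  have c: "open U" "subspace T" "\<phi> ` (S \<inter> U) = \<phi> ` U \<inter> T"
    using chart by (auto simp: slice_chart_def)
  have "isCont \<gamma> 0"
    using \<gamma>(4) has_vector_derivative_continuous by blast
  then have "\<forall>\<^sub>F t in at 0. \<gamma> t \<in> U"
    using c(1) x \<gamma>(3) unfolding continuous_at by (simp add: topological_tendstoD)
  then obtain d where d: "d > 0" "\<And>t. t \<noteq> 0 \<Longrightarrow> dist t 0 < d \<Longrightarrow> \<gamma> t \<in> U"
    by (auto simp: eventually_at)
  define r where "r = min d e"
  have r: "r > 0" "\<And>t. t \<in> ball 0 r \<Longrightarrow> \<gamma> t \<in> S \<inter> U"
  proof -
    show "r > 0"
      using d \<gamma> by (simp add: r_def)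
    fix t :: real assume "t \<in> ball 0 r"
    then show "\<gamma> t \<in> S \<inter> U"
      using d(2)[of t] \<gamma>(2)[of t] \<gamma>(3) x by (cases "t = 0") (auto simp: r_def dist_real_def abs_less_iff)
  qed
  have der: "((\<lambda>t. \<phi> (\<gamma> t)) has_derivative (\<lambda>t. \<phi>' (t *\<^sub>R v))) (at 0)"
    using has_derivative_compose[where f = \<gamma> and g = \<phi> and x = 0] \<gamma>(3,4) \<phi>' by (simp add: has_vector_derivative_def)
  have "u \<bullet> \<phi>' v = 0" if "u \<in> T\<^sup>\<bottom>" for u
  proof -
    have "((\<lambda>t. u \<bullet> \<phi> (\<gamma> t)) has_derivative (\<lambda>t. u \<bullet> \<phi>' (t *\<^sub>R v))) (at 0)"
      by (rule bounded_linear.has_derivative[OF bounded_linear_inner_right der])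
    moreover have "((\<lambda>t. u \<bullet> \<phi> (\<gamma> t)) has_derivative (\<lambda>t. 0)) (at 0)"
    proof (rule has_derivative_transform_within_open[OF has_derivative_const[where c = 0] open_ball[of 0 r]])
      show "0 = u \<bullet> \<phi> (\<gamma> t)" if "t \<in> ball 0 r" for t
      proof -
        have "\<phi> (\<gamma> t) \<in> T"
          using r(2)[OF that] c(3) by blast
        then show ?thesis
          using \<open>u \<in> T\<^sup>\<bottom>\<close> by (simp add: orthogonal_comp_def orthogonal_def inner_commute[of u])
      qed
    qed (use r in simp)
    ultimately have "(\<lambda>t. u \<bullet> \<phi>' (t *\<^sub>R v)) = (\<lambda>t. 0)"
      by (rule has_derivative_unique)
    then show ?thesis
      by (metis scaleR_one)
  qed
  then have "\<phi>' v \<in> T\<^sup>\<bottom>\<^sup>\<bottom>"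
    by (simp add: orthogonal_comp_def orthogonal_def)
  then show ?thesis
    using orthogonal_comp_self[OF c(2)] by simp
qed

lemma tangent_space_chart:
  assumes chart: "slice_chart S k U \<phi> T" and x: "x \<in> S \<inter> U" and \<phi>': "(\<phi> has_derivative \<phi>') (at x)"
  shows "tangent_space S x = {v. \<phi>' v \<in> T}"
proof (intro equalityI subsetI)
  fix v assume "v \<in> tangent_space S x"
  then show "v \<in> {v. \<phi>' v \<in> T}"
    using slice_chart_velocity[OF chart _ \<phi>'] x unfolding tangent_space_def by blast
next
  fix v assume v: "v \<in> {v. \<phi>' v \<in> T}"
  let ?\<psi> = "inv_into U \<phi>"
  have c: "open (\<phi> ` U)" "inj_on \<phi> U" "smooth_on ?\<psi> (\<phi> ` U)" "subspace T" "\<phi> ` (S \<inter> U) = \<phi> ` U \<inter> T"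
    using chart by (auto simp: slice_chart_def)
  have "x \<in> U"
    using x by simp
  obtain \<phi>'' \<psi>' where d: "(\<phi> has_derivative \<phi>'') (at x)" "(?\<psi> has_derivative \<psi>') (at (\<phi> x))"
    "\<forall>v. \<psi>' (\<phi>'' v) = v" "\<forall>w. \<phi>'' (\<psi>' w) = w"
    using slice_chart_derivative[OF chart \<open>x \<in> U\<close>] .
  have [simp]: "\<phi>'' = \<phi>'"
    using has_derivative_unique[OF d(1) \<phi>'] .
  \<comment> \<open>A vector mapped into \<open>T\<close> is realised by a straight segment in the
    chart, pulled back to the submanifold.\<close>
  define \<gamma> where "\<gamma> t = ?\<psi> (\<phi> x + t *\<^sub>R \<phi>' v)" for t :: real
  have "\<phi> x \<in> \<phi> ` U"
    using x by blast
  moreover have "isCont (\<lambda>t::real. \<phi> x + t *\<^sub>R \<phi>' v) 0"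
    by (intro continuous_intros)
  ultimately have "\<forall>\<^sub>F t::real in at 0. \<phi> x + t *\<^sub>R \<phi>' v \<in> \<phi> ` U"
    using c(1) unfolding continuous_at by (simp add: topological_tendstoD)
  then obtain e where e: "e > 0" "\<And>t::real. t \<noteq> 0 \<Longrightarrow> dist t 0 < e \<Longrightarrow> \<phi> x + t *\<^sub>R \<phi>' v \<in> \<phi> ` U"
    by (auto simp: eventually_at)
  have in_U: "\<phi> x + t *\<^sub>R \<phi>' v \<in> \<phi> ` U" if "t \<in> {-e<..<e}" for t
    using e(2)[of t] that \<open>\<phi> x \<in> \<phi> ` U\<close> by (cases "t = 0") (auto simp: dist_real_def abs_less_iff)
  have "\<phi> x \<in> T"
    using x c(5) by blast
  have "smooth_on \<gamma> {-e<..<e}"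
    unfolding smooth_on_def
  proof
    fix j
    have "ck_on j \<gamma> {t. \<phi> x + t *\<^sub>R \<phi>' v \<in> \<phi> ` U}"
      unfolding \<gamma>_def using ck_on_comp_affine[OF bounded_linear_scaleR_left c(1)] c(3) unfolding smooth_on_def by blast
    then show "ck_on j \<gamma> {-e<..<e}"
      by (rule ck_on_subset) (use in_U in auto)
  qed
  moreover have "\<gamma> t \<in> S" if "t \<in> {-e<..<e}" for t
  proof -
    have "\<phi> x + t *\<^sub>R \<phi>' v \<in> T"
      using v \<open>\<phi> x \<in> T\<close> c(4) by (simp add: subspace_add subspace_scale)
    then obtain y where "y \<in> S \<inter> U" "\<phi> x + t *\<^sub>R \<phi>' v = \<phi> y"
      using in_U[OF \<open>t \<in> {-e<..<e}\<close>] c(5) by blast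
    then show ?thesis
      unfolding \<gamma>_def using inv_into_f_f[OF c(2)] by auto
  qed
  moreover have "\<gamma> 0 = x"
    using x by (simp add: \<gamma>_def inv_into_f_f[OF c(2)])
  moreover have "(\<gamma> has_vector_derivative v) (at 0)"
  proof -
    have 1: "((\<lambda>t. \<phi> x + t *\<^sub>R \<phi>' v) has_derivative (\<lambda>t. t *\<^sub>R \<phi>' v)) (at 0)"
      by (auto intro!: derivative_eq_intros)
    have "(\<gamma> has_derivative (\<lambda>t. \<psi>' (t *\<^sub>R \<phi>' v))) (at 0)"
      unfolding \<gamma>_def using has_derivative_compose[OF 1, of ?\<psi> \<psi>'] d(2) by simp
    moreover have "\<psi>' (t *\<^sub>R \<phi>' v) = t *\<^sub>R v" for t
    proof -
      have "linear \<psi>'"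
        using d(2) by (simp add: has_derivative_def bounded_linear.linear)
      then show ?thesis
        using d(3) by (simp add: linear_scale)
    qed
    ultimately show ?thesis
      by (simp add: has_vector_derivative_def)
  qed
  ultimately show "v \<in> tangent_space S x"
    unfolding tangent_space_def using e(1) by blast
qed

lemma is_line_direction:
  fixes L :: "'a::euclidean_space set"
  assumes "is_line L" "q \<in> L"
  obtains d where "d \<noteq> 0" "direction q L = span {d}"
proof -
  have dir: "direction q L = (\<lambda>x. - q + x) ` L"
    by (force simp: direction_def image_def)
  have sub: "subspace (direction q L)"
    unfolding dir using affine_diffs_subspace[of L q] assms by (simp add: is_line_def)
  have "int (dim (direction q L)) = 1"
    using aff_dim_subspace[OF sub] aff_dim_translation_eq[of "- q" L] assms(1) unfolding dir by (simp add: is_line_def)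
  then have dim: "dim (direction q L) = 1"
    by simp
  obtain B where B: "B \<subseteq> direction q L" "independent B" "direction q L \<subseteq> span B" "card B = 1"
    using basis_exists[of "direction q L"] dim by metis
  then obtain d where d: "B = {d}"
    by (auto simp: card_1_singleton_iff)
  then have "d \<noteq> 0" "direction q L = span {d}"
    using B span_minimal[OF B(1) sub] dependent_zero by auto
  then show ?thesis
    using that by blast
qed

lemma PT_chart_direction:
  fixes L :: "'a::euclidean_space set"
  assumes "(q, L) \<in> PT_dom u"
  shows "direction q L = span {snd (PT_chart u (q, L))}"
proof -
  have L: "is_line L" "q \<in> L" and ex: "\<exists>v\<in>direction q L. v \<bullet> u \<noteq> 0"
    using assms by (auto simp: PT_dom_def PT_def)
  obtain d where d: "d \<noteq> 0" "direction q L = span {d}"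
    using is_line_direction[OF L] .
  then have du: "d \<bullet> u \<noteq> 0"
    using ex by (auto simp: span_singleton)
  let ?v = "(1 / (d \<bullet> u)) *\<^sub>R d"
  have "(THE v. v \<in> direction q L \<and> v \<bullet> u = 1) = ?v"
  proof (rule the_equality)
    show "?v \<in> direction q L \<and> ?v \<bullet> u = 1"
      using du d by (simp add: span_base span_scale)
    show "v = ?v" if "v \<in> direction q L \<and> v \<bullet> u = 1" for v
    proof -
      obtain c where "v = c *\<^sub>R d"
        using \<open>v \<in> direction q L \<and> v \<bullet> u = 1\<close> unfolding d(2) span_singleton by blast
      moreover have "c * (d \<bullet> u) = 1"
        using that calculation by simp
      ultimately show ?thesis
        using du by (simp add: field_simps)
    qed
  qed
  then have "snd (PT_chart u (q, L)) = ?v"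
    by (simp add: PT_chart_def)
  moreover have "span {?v} = span {d}"
    using du span_image_scale[of "{d}" "\<lambda>_. 1 / (d \<bullet> u)"] by simp
  ultimately show ?thesis
    using d by simp
qed

text \<open>The normal and the framing are extended to an ambient neighbourhood \<open>U\<close>, since the orbit
  conditions will only be differentiated in the ambient space.\<close>

definition adapted ::
  "('a::euclidean_space \<times> 'a set) set \<Rightarrow> 'a set \<Rightarrow> ('a \<Rightarrow> real) \<Rightarrow> ('a \<Rightarrow> 'a) \<Rightarrow> ('a \<Rightarrow> 'a) \<Rightarrow> bool" where
  "adapted \<alpha> U \<rho> n M \<longleftrightarrow> open U \<and> (\<forall>q\<in>U. (\<rho> has_derivative (\<lambda>v. n q \<bullet> v)) (at q)) \<and>
     (\<forall>q\<in>fst ` \<alpha> \<inter> U. \<rho> q = 0) \<and> ck_on 2 n U \<and> ck_on 2 M U \<and>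
     (\<forall>q\<in>fst ` \<alpha> \<inter> U. tangent_space (fst ` \<alpha>) q = {v. n q \<bullet> v = 0}) \<and> (\<forall>q\<in>U. n q \<noteq> 0) \<and>
     (\<forall>q L. (q, L) \<in> \<alpha> \<and> q \<in> U \<longrightarrow> direction q L = span {M q} \<and> n q \<bullet> M q = 1)"

lemma adapted_exists:
  fixes \<alpha> :: "('a::euclidean_space \<times> 'a set) set"
  assumes \<alpha>: "line_framed_hypersurface \<alpha>" and p: "p \<in> fst ` \<alpha>"
  obtains U \<rho> n M where "p \<in> U" "adapted \<alpha> U \<rho> n M"
proof -
  let ?a = "fst ` \<alpha>" and ?s = "inv_into \<alpha> fst"
  have sub: "submanifold (DIM('a) - 1) ?a" and inj: "inj_on fst \<alpha>" and sm: "smooth_into_PT ?s ?a"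
    and tr: "\<And>q L. (q, L) \<in> \<alpha> \<Longrightarrow> transverse (direction q L) (tangent_space ?a q)"
    using \<alpha> by (auto simp: line_framed_hypersurface_def)
  obtain U \<phi> T where U: "p \<in> U" and chart: "slice_chart ?a (DIM('a) - 1) U \<phi> T"
    using sub p unfolding submanifold_def by blast
  have c: "open U" "smooth_on \<phi> U" "subspace T" "dim T = DIM('a) - 1" "\<phi> ` (?a \<inter> U) = \<phi> ` U \<inter> T"
    using chart by (auto simp: slice_chart_def)
  \<comment> \<open>The chart flattens the hypersurface into the hyperplane orthogonal to
    \<open>w\<close>. The product of \<open>w\<close> with the chart is thus a defining function,
    and its gradient is a normal field on a full neighbourhood.\<close>
  obtain w where w: "w \<noteq> 0" "T = {x. w \<bullet> x = 0}"
    using lowdim_eq_hyperplane[OF c(4)] c(3) by (metis span_eq_iff)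
  define \<rho> where "\<rho> q = w \<bullet> \<phi> q" for q
  have \<rho>_smooth: "ck_on k \<rho> U" for k
    unfolding \<rho>_def using c(2) unfolding smooth_on_def
    by (intro ck_on_bounded_linear_comp[OF bounded_linear_inner_right c(1)]) auto
  define n where "n q = (\<Sum>b\<in>Basis. frechet_derivative \<rho> (at q) b *\<^sub>R b)" for q
  have \<rho>_der: "(\<rho> has_derivative frechet_derivative \<rho> (at q)) (at q)" if "q \<in> U" for q
    by (rule ck_on_SucD[OF \<rho>_smooth that])
  have n: "frechet_derivative \<rho> (at q) v = n q \<bullet> v" if "q \<in> U" for q v
  proof -
    have "linear (frechet_derivative \<rho> (at q))"
      using \<rho>_der[OF that] by (simp add: has_derivative_def bounded_linear.linear)
    then have "frechet_derivative \<rho> (at q) (\<Sum>b\<in>Basis. (v \<bullet> b) *\<^sub>R b) = n q \<bullet> v"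
      unfolding n_def by (simp add: linear_sum linear_scale inner_sum_left inner_commute[of v] mult.commute)
    then show ?thesis
      by (simp add: euclidean_representation)
  qed
  have \<rho>_grad: "(\<rho> has_derivative (\<lambda>v. n q \<bullet> v)) (at q)" if "q \<in> U" for q
  proof -
    have "frechet_derivative \<rho> (at q) = (\<lambda>v. n q \<bullet> v)"
      using n[OF that] by blast
    with \<rho>_der[OF that] show ?thesis
      by simp
  qed
  have n_smooth: "ck_on k n U" for k
  proof -
    have "ck_on k (\<lambda>q. frechet_derivative \<rho> (at q) b) U" for b
      using \<rho>_smooth[of "Suc k"] by simp
    then show ?thesis
      unfolding n_def by (intro ck_on_sum ck_on_scaleR ck_on_const c(1) finite_Basis)
  qed
  have tangent: "tangent_space ?a q = {v. n q \<bullet> v = 0}" if "q \<in> ?a" "q \<in> U" for q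
  proof -
    obtain \<phi>' where \<phi>': "(\<phi> has_derivative \<phi>') (at q)"
      using smooth_on_differentiable[OF c(2) \<open>q \<in> U\<close>] unfolding differentiable_def by blast
    have "(\<rho> has_derivative (\<lambda>v. w \<bullet> \<phi>' v)) (at q)"
      unfolding \<rho>_def by (rule bounded_linear.has_derivative[OF bounded_linear_inner_right \<phi>'])
    then have "(\<lambda>v. w \<bullet> \<phi>' v) = (\<lambda>v. n q \<bullet> v)"
      using \<rho>_grad[OF that(2)] by (rule has_derivative_unique)
    from fun_cong[OF this] have "\<And>v. w \<bullet> \<phi>' v = n q \<bullet> v" .
    moreover have "q \<in> ?a \<inter> U"
      using that by blast
    ultimately show ?thesis
      using tangent_space_chart[OF chart _ \<phi>'] unfolding w(2) by simp
  qed
  have n_nz: "n q \<noteq> 0" if "q \<in> U" for q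
  proof
    assume "n q = 0"
    obtain \<phi>' \<psi>' where \<phi>': "(\<phi> has_derivative \<phi>') (at q)" and "(inv_into U \<phi> has_derivative \<psi>') (at (\<phi> q))"
      and "\<forall>v. \<psi>' (\<phi>' v) = v" and \<psi>': "\<forall>w. \<phi>' (\<psi>' w) = w"
      using slice_chart_derivative[OF chart \<open>q \<in> U\<close>] .
    have "(\<rho> has_derivative (\<lambda>v. w \<bullet> \<phi>' v)) (at q)"
      unfolding \<rho>_def by (rule bounded_linear.has_derivative[OF bounded_linear_inner_right \<phi>'])
    then have "(\<lambda>v. w \<bullet> \<phi>' v) = (\<lambda>v. n q \<bullet> v)"
      using \<rho>_grad[OF that] by (rule has_derivative_unique)
    \<comment> \<open>The derivative of the chart is onto, so some vector is mapped to
      \<open>w\<close> itself.\<close>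
    from fun_cong[OF this, of "\<psi>' w"] show False
      using w(1) \<psi>' \<open>n q = 0\<close> by simp
  qed
  obtain u V where u: "u \<in> Basis" and V: "open V" "p \<in> V" "?s ` (?a \<inter> V) \<subseteq> PT_dom u"
    and sms: "smooth_on_subset (PT_chart u \<circ> ?s) (?a \<inter> V)"
    using sm p unfolding smooth_into_PT_def by blast
  have "p \<in> ?a \<inter> V"
    using p V(2) by blast
  then obtain V' g where V': "open V'" "p \<in> V'" and g': "smooth_on g V'" "\<forall>q\<in>?a \<inter> V \<inter> V'. g q = (PT_chart u \<circ> ?s) q"
    using sms unfolding smooth_on_subset_def by blast
  then have g: "smooth_on g V'" "\<And>q. q \<in> ?a \<inter> V \<inter> V' \<Longrightarrow> g q = PT_chart u (?s q)"
    by simp_all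
  define m where "m q = snd (g q)" for q
  have m_smooth: "ck_on k m V'" for k
    unfolding m_def using g(1) unfolding smooth_on_def
    by (intro ck_on_bounded_linear_comp[OF bounded_linear_snd V'(1)]) auto
  have m: "direction q L = span {m q}" if "(q, L) \<in> \<alpha>" "q \<in> V" "q \<in> V'" for q L
  proof -
    have "?s q = (q, L)"
      using inv_into_f_f[OF inj that(1)] by simp
    moreover have "q \<in> ?a"
      using that(1) by force
    ultimately have "(q, L) \<in> PT_dom u" "m q = snd (PT_chart u (q, L))"
      using V(3) g(2)[of q] that(2,3) unfolding m_def by (metis IntI image_subset_iff, metis IntI)
    then show ?thesis
      using PT_chart_direction by simp
  qed
  define W where "W = U \<inter> V \<inter> V'"
  have W: "open W" "p \<in> W" "W \<subseteq> U" "W \<subseteq> V" "W \<subseteq> V'"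
    using c(1) U V V' by (auto simp: W_def)
  \<comment> \<open>Transversality puts \<open>p\<close> into this open set, on which the frame can
    be scaled to have value 1 on the normal.\<close>
  define W' where "W' = {q \<in> W. n q \<bullet> m q \<noteq> 0}"
  have nm: "ck_on k (\<lambda>q. n q \<bullet> m q) W" for k
    using ck_on_subset[OF n_smooth W(3)] ck_on_subset[OF m_smooth W(5)] by (intro ck_on_inner W(1))
  have "W' = W \<inter> (\<lambda>q. n q \<bullet> m q) -` (- {0})"
    by (auto simp: W'_def)
  then have "open W'"
    using continuous_open_preimage[OF ck_on_continuous[OF nm] W(1)] by (simp add: open_Compl)
  have "p \<in> W'"
  proof -
    obtain L where L: "(p, L) \<in> \<alpha>"
      using p by force
    have "n p \<bullet> m p \<noteq> 0"
    proof
      assume 0: "n p \<bullet> m p = 0"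
      have "transverse (span {m p}) {v. n p \<bullet> v = 0}"
        using tr[OF L] m[OF L] tangent[OF p U] V V' by simp
      moreover have "span (span {m p} \<union> {v. n p \<bullet> v = 0}) \<subseteq> {v. n p \<bullet> v = 0}"
        by (rule span_minimal) (use 0 in \<open>auto simp: subspace_hyperplane span_singleton\<close>)
      ultimately have "n p \<in> {v. n p \<bullet> v = 0}"
        unfolding transverse_def by blast
      then have "n p \<bullet> n p = 0"
        by simp
      then show False
        using n_nz[OF U] by simp
    qed
    then show ?thesis
      using W(2) by (simp add: W'_def)
  qed
  have W': "W' \<subseteq> W" "W' \<subseteq> U"
    using W by (auto simp: W'_def)
  define M where "M q = inverse (n q \<bullet> m q) *\<^sub>R m q" for q
  have "ck_on 2 M W'"
    unfolding M_def
    by (intro ck_on_scaleR ck_on_inverse \<open>open W'\<close> ck_on_subset[OF nm] ck_on_subset[OF m_smooth])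
      (use W W' in \<open>auto simp: W'_def\<close>)
  moreover have "direction q L = span {M q} \<and> n q \<bullet> M q = 1" if "(q, L) \<in> \<alpha>" "q \<in> W'" for q L
  proof -
    have nz: "n q \<bullet> m q \<noteq> 0"
      using that(2) by (simp add: W'_def)
    then have "span {M q} = span {m q}"
      using span_image_scale[of "{m q}" "\<lambda>_. inverse (n q \<bullet> m q)"] by (simp add: M_def)
    moreover have "direction q L = span {m q}"
      using m[OF that(1)] that(2) W W' by blast
    ultimately show ?thesis
      using nz by (simp add: M_def)
  qed
  moreover have "\<rho> q = 0" if "q \<in> ?a" "q \<in> W'" for q
  proof -
    have "\<phi> q \<in> T"
      using that W' c(5) by blast
    then show ?thesis
      by (simp add: \<rho>_def w(2))
  qed
  moreover have "\<forall>q\<in>W'. (\<rho> has_derivative (\<lambda>v. n q \<bullet> v)) (at q)" "\<forall>q\<in>W'. n q \<noteq> 0"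
    "\<forall>q\<in>?a \<inter> W'. tangent_space ?a q = {v. n q \<bullet> v = 0}"
    using \<rho>_grad n_nz tangent W'(2) by blast+
  moreover have "ck_on 2 n W'"
    by (rule ck_on_subset[OF n_smooth W'(2)])
  ultimately have "adapted \<alpha> W' \<rho> n M"
    unfolding adapted_def using \<open>open W'\<close> by (intro conjI; blast)
  with \<open>p \<in> W'\<close> show ?thesis
    by (rule that)
qed

section \<open>The reflection law in coordinates\<close>

lemma in_span_pairE:
  fixes a b y :: "'a::real_vector"
  assumes "y \<in> span {a, b}"
  obtains k l where "y = k *\<^sub>R a + l *\<^sub>R b"
proof -
  obtain k where "y - k *\<^sub>R a \<in> span {b}"
    using assms by (auto simp: span_breakdown_eq)
  then obtain l where "y - k *\<^sub>R a = l *\<^sub>R b"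
    by (auto simp: span_singleton)
  then show ?thesis
    using that[of k l] by (simp add: algebra_simps)
qed

text \<open>The involution preserves the line of \<open>M\<close> and, if \<open>v\<close> is not
  along \<open>M\<close>, the line of the tangential part \<open>t\<close> of \<open>v\<close>. Its
  eigenvalues there have equal squares and are distinct, since otherwise it would be scalar; so they
  are opposite, and \<open>a M + t\<close> goes to a multiple of \<open>a M - t\<close>. The
  orientation clause decides the sign of the factor.\<close>

lemma reflects_formula:
  assumes refl: "reflects \<alpha> p v w" and inj: "inj_on fst \<alpha>" and L: "(p, L) \<in> \<alpha>"
    and dir: "direction p L = span {M}" and nM: "n \<bullet> M = 1" and H: "tangent_space (fst ` \<alpha>) p = {x. n \<bullet> x = 0}"
  obtains k where "k > 0" "w = k *\<^sub>R (v - (2 * (n \<bullet> v)) *\<^sub>R M)" "n \<bullet> v \<noteq> 0"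
proof -
  let ?H = "{x. n \<bullet> x = 0}"
  have "(\<exists>L P. (p, L) \<in> \<alpha> \<and> subspace P \<and> dim P = 2 \<and> v \<in> P \<and> w \<in> P \<and> direction p L \<subseteq> P \<and>
      harmonic_lines P (span {v}) (span {w}) (direction p L) (?H \<inter> P)) \<and> opposite_sides ?H v w"
    using refl unfolding reflects_def H Let_def by blast
  then obtain L' P where "(p, L') \<in> \<alpha>" and P: "subspace P" "dim P = 2" "v \<in> P" "w \<in> P" "direction p L' \<subseteq> P"
    and harm: "harmonic_lines P (span {v}) (span {w}) (direction p L') (?H \<inter> P)" and side: "opposite_sides ?H v w"
    by (elim conjE exE)
  obtain f where f: "pencil_involution P f" "f ` span {v} = span {w}" "f ` direction p L' = direction p L'" "f ` (?H \<inter> P) = ?H \<inter> P"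
    using harm unfolding harmonic_lines_def by (elim conjE exE)
  have "L' = L"
    using inj_onD[OF inj _ \<open>(p, L') \<in> \<alpha>\<close> L] by simp
  then have MP: "M \<in> P" and fM: "f ` span {M} = span {M}"
    using P(5) f(3) dir span_base[of M "{M}"] by auto
  define a where "a = n \<bullet> v"
  \<comment> \<open>\<open>opposite_sides\<close> provides some normal of the hyperplane; it is a
    multiple of \<open>n\<close>, and the factor enters the sign condition as a square.\<close>
  have neg: "a * (n \<bullet> w) < 0"
  proof -
    obtain n' where n': "?H = {x. n' \<bullet> x = 0}" "(n' \<bullet> v) * (n' \<bullet> w) < 0"
      using side unfolding opposite_sides_def by blast
    have n'x: "n' \<bullet> x = (n' \<bullet> M) * (n \<bullet> x)" for x
    proof -
      have "x - (n \<bullet> x) *\<^sub>R M \<in> ?H"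
        using nM by (simp add: inner_diff_right)
      then have "n' \<bullet> (x - (n \<bullet> x) *\<^sub>R M) = 0"
        unfolding n'(1) by simp
      then show ?thesis
        by (simp add: inner_diff_right)
    qed
    have "(n' \<bullet> M)\<^sup>2 * (a * (n \<bullet> w)) < 0"
      using n'(2) unfolding n'x[of v] n'x[of w] a_def by (simp add: power2_eq_square algebra_simps)
    then show ?thesis
      by (simp add: mult_less_0_iff not_less[symmetric])
  qed
  then have a: "a \<noteq> 0"
    by auto
  define t where "t = v - a *\<^sub>R M"
  have nt: "n \<bullet> t = 0"
    using nM by (simp add: t_def a_def inner_diff_right)
  have tP: "t \<in> P"
    unfolding t_def using P MP by (simp add: subspace_diff subspace_scale)
  have v: "v = a *\<^sub>R M + t"
    by (simp add: t_def)
  have lin: "linear f"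
    using f(1) by (simp add: pencil_involution_def)
  obtain m where m: "f M = m *\<^sub>R M"
    using fM span_base[of M "{M}"] by (auto simp: span_singleton)
  obtain s where s: "f v = s *\<^sub>R w"
    using f(2) span_base[of v "{v}"] by (auto simp: span_singleton)
  obtain k where k: "w = k *\<^sub>R (v - (2 * a) *\<^sub>R M)"
  proof (cases "t = 0")
    \<comment> \<open>Here \<open>v\<close> lies along \<open>M\<close>, and so does its
      image.\<close>
    case True
    have "w \<in> f ` span {v}"
      using f(2) span_base[of w "{w}"] by blast
    then obtain y where "w = f (y *\<^sub>R v)"
      by (auto simp: span_singleton)
    then have "w = (y * a * m) *\<^sub>R M"
      using v True m by (simp add: linear_scale[OF lin])
    moreover have "v - (2 * a) *\<^sub>R M = (- a) *\<^sub>R M"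
      using v True scaleR_left_diff_distrib[of a "2 * a" M] by simp
    ultimately have "w = (- (y * m)) *\<^sub>R (v - (2 * a) *\<^sub>R M)"
      by simp
    then show ?thesis
      using that by blast
  next
    case False
    have M0: "M \<noteq> 0"
      using nM by auto
    have indep: "x = 0 \<and> y = 0" if "x *\<^sub>R M + y *\<^sub>R t = 0" for x y
    proof -
      have "n \<bullet> (x *\<^sub>R M + y *\<^sub>R t) = 0"
        using that by simp
      then have "x = 0"
        using nM nt by (simp add: inner_add_right)
      then show ?thesis
        using that False by simp
    qed
    have Mt: "M \<noteq> t"
      using nM nt by auto
    have "independent {M, t}"
    proof (rule independent_insertI)
      show "M \<notin> span {t}"
        using indep[of 1 "- x" for x] by (auto simp: span_singleton)
      show "independent {t}"
        using False by simp
    qed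
    then have P_span: "P \<subseteq> span {M, t}"
      using card_ge_dim_independent[of "{M, t}" P] MP tP P(2) Mt by simp
    have HP: "y \<in> span {t}" if y: "y \<in> ?H \<inter> P" for y
    proof -
      obtain x z where xz: "y = x *\<^sub>R M + z *\<^sub>R t"
        using in_span_pairE[of y M t] P_span y by blast
      then have "x = 0"
        using y nM nt by (simp add: inner_add_right)
      then show ?thesis
        using xz by (simp add: span_base span_scale)
    qed
    have "f t \<in> ?H \<inter> P"
      using f(4) nt tP by blast
    then obtain r where r: "f t = r *\<^sub>R t"
      using HP by (auto simp: span_singleton)
    obtain c where c: "\<forall>x\<in>P. f (f x) = c *\<^sub>R x" and nonscalar: "\<not> (\<exists>c. \<forall>x\<in>P. f x = c *\<^sub>R x)"
      using f(1) by (auto simp: pencil_involution_def)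
    have "m * m = c" "r * r = c"
      using bspec[OF c MP] bspec[OF c tP] M0 False by (simp_all add: m r linear_scale[OF lin])
    moreover have "m \<noteq> r"
    proof
      assume "m = r"
      have "f x = m *\<^sub>R x" if "x \<in> P" for x
      proof -
        obtain b d where "x = b *\<^sub>R M + d *\<^sub>R t"
          using in_span_pairE[of x M t] P_span \<open>x \<in> P\<close> by blast
        then show ?thesis
          using m r \<open>m = r\<close> by (simp add: linear_add[OF lin] linear_scale[OF lin] scaleR_add_right mult.commute)
      qed
      then show False
        using nonscalar by blast
    qed
    ultimately have r': "r = - m" "m \<noteq> 0"
      by (metis square_eq_iff, metis mult_eq_0_iff)
    have fv: "f v = m *\<^sub>R (a *\<^sub>R M - t)"
      unfolding v by (simp add: linear_add[OF lin] linear_scale[OF lin] m r r' algebra_simps)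
    have "f v \<noteq> 0"
      using indep[of "m * a" "- m"] r' unfolding fv by (auto simp: algebra_simps)
    then have "s \<noteq> 0"
      using s by auto
    then have "w = (1 / s) *\<^sub>R f v"
      using s by simp
    also have "\<dots> = (- m / s) *\<^sub>R (t - a *\<^sub>R M)"
      unfolding fv by (simp add: algebra_simps)
    also have "t - a *\<^sub>R M = v - (2 * a) *\<^sub>R M"
      using scaleR_left_distrib[of a a M] by (simp add: t_def)
    finally show ?thesis
      using that by blast
  qed
  have "n \<bullet> w = - k * a"
    unfolding k using nM by (simp add: inner_diff_right a_def)
  then have "k * a\<^sup>2 > 0"
    using neg by (simp add: mult.left_commute[of a k] power2_eq_square[symmetric])
  then have "k > 0"
    by (simp add: zero_less_mult_iff)
  then show ?thesis
    using that k a by (simp add: a_def)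
qed

text \<open>With \<open>- v\<close> pointing back to the previous vertex the law becomes symmetric
  in the two neighbours. Positivity of the product says that both lie on the same side of the
  tangent hyperplane.\<close>

lemma reflection_equation:
  fixes v w :: "'a::real_inner"
  assumes k: "k > 0" "w = k *\<^sub>R (v - (2 * (n \<bullet> v)) *\<^sub>R M)" "n \<bullet> v \<noteq> 0" and nM: "n \<bullet> M = 1"
  shows "(n \<bullet> w) * (n \<bullet> - v) > 0" "2 *\<^sub>R M = (1 / (n \<bullet> w)) *\<^sub>R w + (1 / (n \<bullet> - v)) *\<^sub>R (- v)"
proof -
  define a where "a = n \<bullet> v"
  have nw: "n \<bullet> w = - (k * a)"
    unfolding k(2) using nM by (simp add: inner_diff_right a_def)
  have a: "a \<noteq> 0"
    using k(3) by (simp add: a_def)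
  show "(n \<bullet> w) * (n \<bullet> - v) > 0"
    using k(1) a unfolding nw by (auto simp: a_def[symmetric] mult.assoc zero_less_mult_iff linorder_neq_iff)
  have "(1 / (n \<bullet> w)) *\<^sub>R w = (- 1 / a) *\<^sub>R v + 2 *\<^sub>R M"
    unfolding nw unfolding k(2) a_def[symmetric] using k(1) a by (simp add: algebra_simps)
  then show "2 *\<^sub>R M = (1 / (n \<bullet> w)) *\<^sub>R w + (1 / (n \<bullet> - v)) *\<^sub>R (- v)"
    by (simp add: a_def[symmetric])
qed

lemma reflects_equation:
  assumes "reflects \<alpha> p (p - r) (q - p)" "inj_on fst \<alpha>" "(p, L) \<in> \<alpha>"
    "direction p L = span {M}" "n \<bullet> M = 1" "tangent_space (fst ` \<alpha>) p = {x. n \<bullet> x = 0}"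
  shows "(n \<bullet> (q - p)) * (n \<bullet> (r - p)) > 0"
    "2 *\<^sub>R M = (1 / (n \<bullet> (q - p))) *\<^sub>R (q - p) + (1 / (n \<bullet> (r - p))) *\<^sub>R (r - p)"
proof -
  obtain k where k: "k > 0" "q - p = k *\<^sub>R (p - r - (2 * (n \<bullet> (p - r))) *\<^sub>R M)" "n \<bullet> (p - r) \<noteq> 0"
    using reflects_formula[OF assms] .
  show "(n \<bullet> (q - p)) * (n \<bullet> (r - p)) > 0"
    "2 *\<^sub>R M = (1 / (n \<bullet> (q - p))) *\<^sub>R (q - p) + (1 / (n \<bullet> (r - p))) *\<^sub>R (r - p)"
    using reflection_equation[OF k assms(5)] by simp_all
qed

text \<open>At the middle one of three collinear vertices the two sides would leave on opposite sides of the
  tangent hyperplane.\<close>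

lemma orbit_nondegenerate:
  fixes A B C :: "'a::real_inner"
  assumes A: "(nA \<bullet> (B - A)) * (nA \<bullet> (C - A)) > 0" and B: "(nB \<bullet> (C - B)) * (nB \<bullet> (A - B)) > 0"
    and C: "(nC \<bullet> (A - C)) * (nC \<bullet> (B - C)) > 0" and eq: "a *\<^sub>R (B - A) + b *\<^sub>R (C - A) = 0"
  shows "a = 0 \<and> b = 0"
proof -
  have "b = 0"
  proof (rule ccontr)
    assume "b \<noteq> 0"
    define r where "r = - a / b"
    have "b *\<^sub>R (C - A) = (- a) *\<^sub>R (B - A)"
      using eq by (simp add: eq_neg_iff_add_eq_0 add.commute)
    then have "(1 / b) *\<^sub>R (b *\<^sub>R (C - A)) = (1 / b) *\<^sub>R ((- a) *\<^sub>R (B - A))"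
      by simp
    then have CA: "C - A = r *\<^sub>R (B - A)"
      using \<open>b \<noteq> 0\<close> by (simp add: r_def)
    have CB: "C - B = (1 - r) *\<^sub>R (A - B)" and AC: "A - C = (- r) *\<^sub>R (B - A)" and BC: "B - C = (1 - r) *\<^sub>R (B - A)"
      using CA by (simp_all add: algebra_simps)
    have pos: "y * z > 0" if "(y * x) * (z * x) > 0" for x y z :: real
    proof -
      have "(y * z) * (x * x) > 0"
        using that by (simp add: algebra_simps)
      then show ?thesis
        using zero_le_square[of x] by (auto simp: zero_less_mult_iff)
    qed
    have "r > 0" "1 - r > 0" "(- r) * (1 - r) > 0"
      using pos[of 1 "nA \<bullet> (B - A)" r] pos[of "1 - r" "nB \<bullet> (A - B)" 1] pos[of "- r" "nC \<bullet> (B - A)" "1 - r"] A B C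
      unfolding CA CB AC BC inner_scaleR_right by simp_all
    then show False
      using mult_pos_pos[of r "1 - r"] by linarith
  qed
  moreover have "B - A \<noteq> 0"
    using A by auto
  ultimately show ?thesis
    using eq by simp
qed

lemma periodic_orbitD:
  assumes "periodic_orbit \<alpha> p"
  shows "p j \<in> fst ` \<alpha> j"
    "reflects (\<alpha> 1) (p 1) (p 1 - p 0) (p 2 - p 1)" "reflects (\<alpha> 2) (p 2) (p 2 - p 1) (p 0 - p 2)"
    "reflects (\<alpha> 0) (p 0) (p 0 - p 2) (p 1 - p 0)"
proof -
  have r: "p j \<in> fst ` \<alpha> j \<and> reflects (\<alpha> j) (p j) (p j - p (j - 1)) (p (j + 1) - p j)" for j
    using assms unfolding periodic_orbit_def by blast
  show "p j \<in> fst ` \<alpha> j"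
    using r by blast
  have [simp]: "(3::3) = 0" "(- 1 :: 3) = 2"
    by simp_all
  show "reflects (\<alpha> 1) (p 1) (p 1 - p 0) (p 2 - p 1)" "reflects (\<alpha> 2) (p 2) (p 2 - p 1) (p 0 - p 2)"
    "reflects (\<alpha> 0) (p 0) (p 0 - p 2) (p 1 - p 0)"
    using r[of 1] r[of 2] r[of 0] by simp_all
qed

section \<open>The family of triangular orbits\<close>

definition boundary_tangents :: "(3 \<Rightarrow> ('a::euclidean_space \<times> 'a set) set) \<Rightarrow> 'a \<times> 'a \<Rightarrow> ('a \<times> 'a) set" where
  "boundary_tangents \<alpha> x = tangent_space (fst ` \<alpha> 1) (fst x) \<times> tangent_space (fst ` \<alpha> 2) (snd x)"

lemma adaptedD:
  assumes "adapted \<alpha> U \<rho> n M"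
  shows "open U" "q \<in> U \<Longrightarrow> (\<rho> has_derivative (\<lambda>v. n q \<bullet> v)) (at q)" "q \<in> fst ` \<alpha> \<Longrightarrow> q \<in> U \<Longrightarrow> \<rho> q = 0"
    "ck_on 2 n U" "ck_on 2 M U" "q \<in> fst ` \<alpha> \<Longrightarrow> q \<in> U \<Longrightarrow> tangent_space (fst ` \<alpha>) q = {v. n q \<bullet> v = 0}"
    "q \<in> U \<Longrightarrow> n q \<noteq> 0" "(q, L) \<in> \<alpha> \<Longrightarrow> q \<in> U \<Longrightarrow> direction q L = span {M q}"
    "(q, L) \<in> \<alpha> \<Longrightarrow> q \<in> U \<Longrightarrow> n q \<bullet> M q = 1" "q \<in> U \<Longrightarrow> n differentiable (at q)" "q \<in> U \<Longrightarrow> M differentiable (at q)"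
  using assms ck_on_2D(1)[of n U q] ck_on_2D(1)[of M U q] unfolding adapted_def differentiable_def by blast+

text \<open>The third vertex is \<open>p 0\<close>, since \<open>3 = 0\<close> in the type \<open>3\<close>.\<close>

lemma periodic_orbit_equations:
  assumes orb: "periodic_orbit \<alpha> p" and bil: "smooth_projective_billiard \<alpha>"
    and 1: "adapted (\<alpha> 1) U1 \<rho>1 n1 M1" "p 1 \<in> U1" and 2: "adapted (\<alpha> 2) U2 \<rho>2 n2 M2" "p 2 \<in> U2"
  shows "(n1 (p 1) \<bullet> (p 2 - p 1)) * (n1 (p 1) \<bullet> (p 0 - p 1)) > 0"
    "2 *\<^sub>R M1 (p 1) = (1 / (n1 (p 1) \<bullet> (p 2 - p 1))) *\<^sub>R (p 2 - p 1) + (1 / (n1 (p 1) \<bullet> (p 0 - p 1))) *\<^sub>R (p 0 - p 1)"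
    "(n2 (p 2) \<bullet> (p 0 - p 2)) * (n2 (p 2) \<bullet> (p 1 - p 2)) > 0"
    "2 *\<^sub>R M2 (p 2) = (1 / (n2 (p 2) \<bullet> (p 0 - p 2))) *\<^sub>R (p 0 - p 2) + (1 / (n2 (p 2) \<bullet> (p 1 - p 2))) *\<^sub>R (p 1 - p 2)"
    "a *\<^sub>R (p 2 - p 1) + b *\<^sub>R (p 0 - p 1) = 0 \<Longrightarrow> a = 0 \<and> b = 0"
    "adapted (\<alpha> 0) U0 \<rho>0 n0 M0 \<Longrightarrow> p 0 \<in> U0 \<Longrightarrow> (n0 (p 0) \<bullet> (p 1 - p 0)) * (n0 (p 0) \<bullet> (p 2 - p 0)) > 0"
    "adapted (\<alpha> 0) U0 \<rho>0 n0 M0 \<Longrightarrow> p 0 \<in> U0 \<Longrightarrow>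
      2 *\<^sub>R M0 (p 0) = (1 / (n0 (p 0) \<bullet> (p 1 - p 0))) *\<^sub>R (p 1 - p 0) + (1 / (n0 (p 0) \<bullet> (p 2 - p 0))) *\<^sub>R (p 2 - p 0)"
proof -
  note D = periodic_orbitD[OF orb]
  have lf: "line_framed_hypersurface (\<alpha> j)" for j
    using bil by (simp add: smooth_projective_billiard_def)
  have inj: "inj_on fst (\<alpha> j)" for j
    using lf[of j] by (simp add: line_framed_hypersurface_def)
  have law: "(n (p j) \<bullet> (q - p j)) * (n (p j) \<bullet> (r - p j)) > 0 \<and>
      2 *\<^sub>R M (p j) = (1 / (n (p j) \<bullet> (q - p j))) *\<^sub>R (q - p j) + (1 / (n (p j) \<bullet> (r - p j))) *\<^sub>R (r - p j)"
    if "adapted (\<alpha> j) U \<rho> n M" "p j \<in> U" "reflects (\<alpha> j) (p j) (p j - r) (q - p j)" for j U \<rho> n M q r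
  proof -
    obtain L where L: "(p j, L) \<in> \<alpha> j"
      using D(1)[of j] by force
    note a = adaptedD[OF that(1)]
    show ?thesis
      using reflects_equation[OF that(3) inj L a(8)[OF L that(2)] a(9)[OF L that(2)] a(6)[OF D(1) that(2)]] by blast
  qed
  show A: "(n1 (p 1) \<bullet> (p 2 - p 1)) * (n1 (p 1) \<bullet> (p 0 - p 1)) > 0"
    "2 *\<^sub>R M1 (p 1) = (1 / (n1 (p 1) \<bullet> (p 2 - p 1))) *\<^sub>R (p 2 - p 1) + (1 / (n1 (p 1) \<bullet> (p 0 - p 1))) *\<^sub>R (p 0 - p 1)"
    using law[OF 1 D(2)] by blast+
  show B: "(n2 (p 2) \<bullet> (p 0 - p 2)) * (n2 (p 2) \<bullet> (p 1 - p 2)) > 0"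
    "2 *\<^sub>R M2 (p 2) = (1 / (n2 (p 2) \<bullet> (p 0 - p 2))) *\<^sub>R (p 0 - p 2) + (1 / (n2 (p 2) \<bullet> (p 1 - p 2))) *\<^sub>R (p 1 - p 2)"
    using law[OF 2 D(3)] by blast+
  show "(n0 (p 0) \<bullet> (p 1 - p 0)) * (n0 (p 0) \<bullet> (p 2 - p 0)) > 0"
    "2 *\<^sub>R M0 (p 0) = (1 / (n0 (p 0) \<bullet> (p 1 - p 0))) *\<^sub>R (p 1 - p 0) + (1 / (n0 (p 0) \<bullet> (p 2 - p 0))) *\<^sub>R (p 2 - p 0)"
    if "adapted (\<alpha> 0) U0 \<rho>0 n0 M0" "p 0 \<in> U0"
    using law[OF that D(4)] by blast+
  obtain U \<rho> n M where "p 0 \<in> U" "adapted (\<alpha> 0) U \<rho> n M"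
    using adapted_exists[OF lf D(1)] .
  then have C: "(n (p 0) \<bullet> (p 1 - p 0)) * (n (p 0) \<bullet> (p 2 - p 0)) > 0"
    using law[OF _ _ D(4)] by blast
  show "a = 0 \<and> b = 0" if "a *\<^sub>R (p 2 - p 1) + b *\<^sub>R (p 0 - p 1) = 0"
    by (rule orbit_nondegenerate[OF A(1) B(1) C that])
qed

text \<open>The determinant of \<open>x\<close> and \<open>y\<close> in the two linear coordinates
  given by pairing with \<open>g1\<close> and \<open>g2\<close>; for independent \<open>g1\<close>,
  \<open>g2\<close> it is, up to a constant, the determinant of the projections to their
  plane.\<close>

definition det2 :: "'a::real_inner \<Rightarrow> 'a \<Rightarrow> 'a \<Rightarrow> 'a \<Rightarrow> real" where
  "det2 g1 g2 x y = (x \<bullet> g1) * (y \<bullet> g2) - (x \<bullet> g2) * (y \<bullet> g1)"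

lemma det2_linear: "det2 g1 g2 (a *\<^sub>R x) y = a * det2 g1 g2 x y" "det2 g1 g2 x (a *\<^sub>R y) = a * det2 g1 g2 x y"
    "det2 g1 g2 (x - z) y = det2 g1 g2 x y - det2 g1 g2 z y" "det2 g1 g2 x (y - z) = det2 g1 g2 x y - det2 g1 g2 x z"
    "det2 g1 g2 x x = 0"
  by (simp_all add: det2_def inner_diff_left algebra_simps)

lemma ck_on_det2:
  assumes "open S" "ck_on k f S" "ck_on k g S"
  shows "ck_on k (\<lambda>x. det2 g1 g2 (f x) (g x)) S"
  unfolding det2_def by (intro ck_on_diff ck_on_mult ck_on_inner ck_on_const assms)

text \<open>The third vertex is the intersection of the lines reflected at the first two; the two lines are
  projected to a fixed plane so that the intersection point is smooth even where they do not meet.\<close>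

lemma orbit_family_near:
  assumes bil: "smooth_projective_billiard \<alpha>"
    and E: "E \<subseteq> fst ` \<alpha> 1 \<times> fst ` \<alpha> 2" "\<And>x. x \<in> E \<Longrightarrow> \<exists>p. periodic_orbit \<alpha> p \<and> p 1 = fst x \<and> p 2 = snd x"
    and p: "periodic_orbit \<alpha> p" "(p 1, p 2) \<in> E"
    and 1: "adapted (\<alpha> 1) U1 \<rho>1 n1 M1" "p 1 \<in> U1" and 2: "adapted (\<alpha> 2) U2 \<rho>2 n2 M2" "p 2 \<in> U2"
    and 0: "adapted (\<alpha> 0) U0 \<rho>0 n0 M0" "p 0 \<in> U0"
  obtains C W where "(p 1, p 2) \<in> W" "orbit_family n1 n2 n0 M1 M2 M0 \<rho>0 C (E \<inter> W) W (boundary_tangents \<alpha>)"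
    "C (p 1, p 2) = p 0" "\<And>x. x \<in> W \<Longrightarrow> fst x \<in> U1 \<and> snd x \<in> U2 \<and> C x \<in> U0"
    "\<And>x. x \<in> E \<inter> W \<Longrightarrow> C x \<in> fst ` \<alpha> 0"
proof -
  define g1 g2 where "g1 = p 2 - p 1" and "g2 = p 0 - p 1"
  \<comment> \<open>The direction from A to B reflected at A; on an orbit it is a multiple of the
    direction to the third vertex. \<open>R2\<close> is its counterpart at B.\<close>
  define R1 where "R1 x = (2 * (n1 (fst x) \<bullet> (snd x - fst x))) *\<^sub>R M1 (fst x) - (snd x - fst x)" for x
  define R2 where "R2 x = (2 * (n2 (snd x) \<bullet> (fst x - snd x))) *\<^sub>R M2 (snd x) - (fst x - snd x)" for x
  let ?det = "det2 g1 g2"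
  \<comment> \<open>Cramer's rule: after projection, \<open>t R1 - s R2 = B - A\<close> is solved
    for \<open>t\<close>.\<close>
  define C where "C x = fst x + (?det (snd x - fst x) (R2 x) * inverse (?det (R1 x) (R2 x))) *\<^sub>R R1 x" for x
  define V where "V = U1 \<times> U2"
  have "open V"
    unfolding V_def using adaptedD(1)[OF 1(1)] adaptedD(1)[OF 2(1)] by (rule open_Times)
  have comp1: "ck_on 2 (\<lambda>x. f (fst x)) V" if "ck_on 2 f U1" for f :: "'a \<Rightarrow> 'a"
  proof -
    have "ck_on 2 (\<lambda>x. f (0 + fst x)) {x :: 'a \<times> 'a. 0 + fst x \<in> U1}"
      by (rule ck_on_comp_affine[OF bounded_linear_fst adaptedD(1)[OF 1(1)] that])
    then show ?thesis
      by (auto simp: V_def intro: ck_on_subset)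
  qed
  have comp2: "ck_on 2 (\<lambda>x. f (snd x)) V" if "ck_on 2 f U2" for f :: "'a \<Rightarrow> 'a"
  proof -
    have "ck_on 2 (\<lambda>x. f (0 + snd x)) {x :: 'a \<times> 'a. 0 + snd x \<in> U2}"
      by (rule ck_on_comp_affine[OF bounded_linear_snd adaptedD(1)[OF 2(1)] that])
    then show ?thesis
      by (auto simp: V_def intro: ck_on_subset)
  qed
  have fs: "ck_on 2 fst V" "ck_on 2 snd V"
    using ck_on_bounded_linear[OF bounded_linear_fst \<open>open V\<close>] ck_on_bounded_linear[OF bounded_linear_snd \<open>open V\<close>] by blast+
  note ck = ck_on_diff ck_on_scaleR ck_on_mult ck_on_inner ck_on_const fs \<open>open V\<close>
  have R1: "ck_on 2 R1 V"
    unfolding R1_def[abs_def] by (intro ck comp1 adaptedD(4,5)[OF 1(1)])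
  have R2: "ck_on 2 R2 V"
    unfolding R2_def[abs_def] by (intro ck comp2 adaptedD(4,5)[OF 2(1)])
  define V' where "V' = V \<inter> (\<lambda>x. ?det (R1 x) (R2 x)) -` (- {0})"
  have "open V'"
    unfolding V'_def
    by (rule continuous_open_preimage[OF ck_on_continuous[OF ck_on_det2[OF \<open>open V\<close> R1 R2]] \<open>open V\<close>]) (simp add: open_Compl)
  have V': "V' \<subseteq> V"
    by (auto simp: V'_def)
  have C2: "ck_on 2 C V'"
    unfolding C_def[abs_def]
    by (intro ck_on_add ck_on_scaleR ck_on_mult ck_on_inverse ck_on_det2 ck_on_diff \<open>open V'\<close>
        R1[THEN ck_on_subset] R2[THEN ck_on_subset] fs[THEN ck_on_subset] V') (auto simp: V'_def)
  define W where "W = V' \<inter> C -` U0"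
  have "open W"
    unfolding W_def by (rule continuous_open_preimage[OF ck_on_continuous[OF C2] \<open>open V'\<close> adaptedD(1)[OF 0(1)]])
  have W: "W \<subseteq> V'" "W \<subseteq> V" "\<And>x. x \<in> W \<Longrightarrow> fst x \<in> U1 \<and> snd x \<in> U2 \<and> C x \<in> U0"
    using V' by (auto simp: W_def V_def)
  have legs: "q 0 - q 1 = t *\<^sub>R R1 (q 1, q 2) \<and> t \<noteq> 0 \<and> q 0 - q 2 = s *\<^sub>R R2 (q 1, q 2) \<and> s \<noteq> 0"
    if q: "periodic_orbit \<alpha> q" "q 1 \<in> U1" "q 2 \<in> U2"
      and t: "t = n1 (q 1) \<bullet> (q 0 - q 1) / (n1 (q 1) \<bullet> (q 2 - q 1))" and s: "s = n2 (q 2) \<bullet> (q 0 - q 2) / (n2 (q 2) \<bullet> (q 1 - q 2))" for q s t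
  proof -
    note e = periodic_orbit_equations[OF q(1) bil 1(1) q(2) 2(1) q(3)]
    have nz: "n1 (q 1) \<bullet> (q 2 - q 1) \<noteq> 0" "n1 (q 1) \<bullet> (q 0 - q 1) \<noteq> 0" "n2 (q 2) \<bullet> (q 0 - q 2) \<noteq> 0" "n2 (q 2) \<bullet> (q 1 - q 2) \<noteq> 0"
      using e(1,3) by auto
    \<comment> \<open>The additive law \<open>2 M = b / h + c / k\<close>, solved for
      \<open>c\<close>.\<close>
    have gen: "c = (k / h) *\<^sub>R (h *\<^sub>R ((1 / h) *\<^sub>R b + (1 / k) *\<^sub>R c) - b)" if "h \<noteq> 0" "k \<noteq> 0" for h k :: real and b c :: 'a
      using that by (simp add: algebra_simps)
    have e4: "2 *\<^sub>R M2 (q 2) = (1 / (n2 (q 2) \<bullet> (q 1 - q 2))) *\<^sub>R (q 1 - q 2) + (1 / (n2 (q 2) \<bullet> (q 0 - q 2))) *\<^sub>R (q 0 - q 2)"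
      using e(4) by (simp only: add.commute)
    have "R1 (q 1, q 2) = (n1 (q 1) \<bullet> (q 2 - q 1)) *\<^sub>R (2 *\<^sub>R M1 (q 1)) - (q 2 - q 1)"
      "R2 (q 1, q 2) = (n2 (q 2) \<bullet> (q 1 - q 2)) *\<^sub>R (2 *\<^sub>R M2 (q 2)) - (q 1 - q 2)"
      by (simp_all add: R1_def R2_def mult.commute)
    then have "q 0 - q 1 = t *\<^sub>R R1 (q 1, q 2)" "q 0 - q 2 = s *\<^sub>R R2 (q 1, q 2)"
      unfolding t s e(2) e4 using gen[where b = "q 2 - q 1" and c = "q 0 - q 1", OF nz(1,2)]
        gen[where b = "q 1 - q 2" and c = "q 0 - q 2", OF nz(4,3)] by simp_all
    then show ?thesis
      using nz by (simp add: t s)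
  qed
  have C_eq: "C (q 1, q 2) = q 0"
    if q: "periodic_orbit \<alpha> q" "q 1 \<in> U1" "q 2 \<in> U2" "?det (R1 (q 1, q 2)) (R2 (q 1, q 2)) \<noteq> 0" for q
  proof -
    obtain s t where st: "q 0 - q 1 = t *\<^sub>R R1 (q 1, q 2)" "q 0 - q 2 = s *\<^sub>R R2 (q 1, q 2)"
      using legs[OF q(1-3)] by blast
    have "q 2 - q 1 = t *\<^sub>R R1 (q 1, q 2) - s *\<^sub>R R2 (q 1, q 2)"
      unfolding st[symmetric] by simp
    then have "?det (q 2 - q 1) (R2 (q 1, q 2)) = t * ?det (R1 (q 1, q 2)) (R2 (q 1, q 2))"
      by (simp add: det2_linear)
    then have "C (q 1, q 2) = q 1 + t *\<^sub>R R1 (q 1, q 2)"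
      using q(4) by (simp add: C_def)
    then show ?thesis
      unfolding st(1)[symmetric] by simp
  qed
  have det_p: "?det (R1 (p 1, p 2)) (R2 (p 1, p 2)) \<noteq> 0"
  proof
    assume 0: "?det (R1 (p 1, p 2)) (R2 (p 1, p 2)) = 0"
    obtain s t where st: "p 0 - p 1 = t *\<^sub>R R1 (p 1, p 2)" "p 0 - p 2 = s *\<^sub>R R2 (p 1, p 2)"
      using legs[OF p(1) 1(2) 2(2)] by blast
    \<comment> \<open>If the reflected directions were dependent after projection, so would be the
      two sides at the third vertex, against the positive Gram determinant of the triangle.\<close>
    have "?det g2 (g2 - g1) = ?det (p 0 - p 1) (p 0 - p 2)"
      by (simp add: g1_def g2_def)
    also have "\<dots> = 0"
      unfolding st using 0 by (simp add: det2_linear)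
    finally have "?det g2 g1 = 0"
      by (simp add: det2_linear)
    moreover have "(g1 \<bullet> g1) * (g2 \<bullet> g2) - (g1 \<bullet> g2) * (g2 \<bullet> g1) > 0"
      unfolding g1_def g2_def by (rule gram_pos[OF periodic_orbit_equations(5)[OF p(1) bil 1 2]])
    ultimately show False
      by (simp add: det2_def algebra_simps)
  qed
  have Cp: "C (p 1, p 2) = p 0"
    by (rule C_eq[OF p(1) 1(2) 2(2) det_p])
  have pW: "(p 1, p 2) \<in> W"
    using det_p 1(2) 2(2) 0(2) Cp by (simp add: W_def V'_def V_def)
  have orbit: "\<exists>q. periodic_orbit \<alpha> q \<and> q 1 = fst x \<and> q 2 = snd x \<and> q 0 = C x" if x: "x \<in> E \<inter> W" for x
  proof -
    obtain q where q: "periodic_orbit \<alpha> q" "q 1 = fst x" "q 2 = snd x"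
      using E(2) x by blast
    have "x \<in> V'"
      using x W(1) by blast
    then have "C (q 1, q 2) = q 0"
      using C_eq[OF q(1)] q(2,3) x W(3) by (simp add: V'_def)
    then show ?thesis
      using q by auto
  qed
  have fam: "orbit_family n1 n2 n0 M1 M2 M0 \<rho>0 C (E \<inter> W) W (boundary_tangents \<alpha>)"
  proof
    show "open W" "E \<inter> W \<subseteq> W" "ck_on 2 C W"
      using \<open>open W\<close> ck_on_subset[OF C2 W(1)] by auto
    fix x assume x: "x \<in> W"
    then have U: "fst x \<in> U1" "snd x \<in> U2" "C x \<in> U0"
      using W(3) by blast+
    show "n1 differentiable (at (fst x))" "n2 differentiable (at (snd x))" "n0 differentiable (at (C x))"
      "M1 differentiable (at (fst x))" "M2 differentiable (at (snd x))" "M0 differentiable (at (C x))"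
      "(\<rho>0 has_derivative (\<lambda>v. n0 (C x) \<bullet> v)) (at (C x))"
      using U adaptedD(2,10,11)[OF 1(1)] adaptedD(2,10,11)[OF 2(1)] adaptedD(2,10,11)[OF 0(1)] by blast+
  next
    fix x assume x: "x \<in> E \<inter> W"
    then have U: "fst x \<in> U1" "snd x \<in> U2" "C x \<in> U0"
      using W(3) by blast+
    obtain q where q: "periodic_orbit \<alpha> q" "q 1 = fst x" "q 2 = snd x" "q 0 = C x"
      using orbit[OF x] by blast
    have qU: "q 1 \<in> U1" "q 2 \<in> U2" "q 0 \<in> U0"
      using U q by simp_all
    note e = periodic_orbit_equations[OF q(1) bil 1(1) qU(1) 2(1) qU(2)]
    note e0 = e(6,7)[OF 0(1) qU(3)]
    show "\<rho>0 (C x) = 0"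
      using adaptedD(3)[OF 0(1)] periodic_orbitD(1)[OF q(1), of 0] qU(3) q(4) by simp
    show "boundary_tangents \<alpha> x = {v. n1 (fst x) \<bullet> fst v = 0 \<and> n2 (snd x) \<bullet> snd v = 0}"
      using adaptedD(6)[OF 1(1) periodic_orbitD(1)[OF q(1)] qU(1)] adaptedD(6)[OF 2(1) periodic_orbitD(1)[OF q(1)] qU(2)]
      by (auto simp: boundary_tangents_def q)
    show "n1 (fst x) \<bullet> (snd x - fst x) \<noteq> 0" "n1 (fst x) \<bullet> (C x - fst x) \<noteq> 0"
      "n2 (snd x) \<bullet> (fst x - snd x) \<noteq> 0" "n2 (snd x) \<bullet> (C x - snd x) \<noteq> 0"
      "n0 (C x) \<bullet> (fst x - C x) \<noteq> 0" "n0 (C x) \<bullet> (snd x - C x) \<noteq> 0"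
      using e(1,3) e0(1) unfolding q by auto
    show "2 *\<^sub>R M1 (fst x) = (1 / (n1 (fst x) \<bullet> (snd x - fst x))) *\<^sub>R (snd x - fst x) + (1 / (n1 (fst x) \<bullet> (C x - fst x))) *\<^sub>R (C x - fst x)"
      using e(2) unfolding q .
    show "2 *\<^sub>R M2 (snd x) = (1 / (n2 (snd x) \<bullet> (fst x - snd x))) *\<^sub>R (fst x - snd x) + (1 / (n2 (snd x) \<bullet> (C x - snd x))) *\<^sub>R (C x - snd x)"
      using e(4) unfolding q by (simp only: add.commute)
    show "2 *\<^sub>R M0 (C x) = (1 / (n0 (C x) \<bullet> (fst x - C x))) *\<^sub>R (fst x - C x) + (1 / (n0 (C x) \<bullet> (snd x - C x))) *\<^sub>R (snd x - C x)"
      using e0(2) unfolding q .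
    show "a = 0 \<and> b = 0" if "a *\<^sub>R (snd x - fst x) + b *\<^sub>R (C x - fst x) = 0" for a b
      using e(5) that unfolding q .
  qed
  have "C x \<in> fst ` \<alpha> 0" if "x \<in> E \<inter> W" for x
    using orbit[OF that] periodic_orbitD(1) by metis
  with pW fam Cp W(3) show ?thesis
    by (rule that)
qed

section \<open>Pseudo-reflective billiards\<close>

lemma cylinder_preimage:
  assumes "subspace T" "A \<subseteq> T" "linear \<pi>" "\<And>x. \<pi> x \<in> T" "\<And>x. x - \<pi> x \<in> T\<^sup>\<bottom>" "\<And>x. x \<in> T \<Longrightarrow> \<pi> x = x"
    "\<And>x. x \<in> T\<^sup>\<bottom> \<Longrightarrow> \<pi> x = 0"
  shows "cylinder T A = {x. \<pi> x \<in> A}"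
proof (intro equalityI subsetI)
  fix x assume "x \<in> cylinder T A"
  then obtain y z where "x = y + z" "y \<in> A" "z \<in> T\<^sup>\<bottom>"
    by (auto simp: cylinder_def)
  then show "x \<in> {x. \<pi> x \<in> A}"
    using assms(2,6,7) by (auto simp: linear_add[OF assms(3)] subset_eq)
next
  fix x assume "x \<in> {x. \<pi> x \<in> A}"
  moreover have "x = \<pi> x + (x - \<pi> x)"
    by simp
  ultimately show "x \<in> cylinder T A"
    unfolding cylinder_def using assms(5) by blast
qed

lemma orthogonal_projection:
  fixes T :: "'a::euclidean_space set"
  assumes "subspace T"
  obtains \<pi> where "linear \<pi>" "\<And>x. \<pi> x \<in> T" "\<And>x. x - \<pi> x \<in> T\<^sup>\<bottom>" "\<And>x. x \<in> T \<Longrightarrow> \<pi> x = x" "\<And>x. x \<in> T\<^sup>\<bottom> \<Longrightarrow> \<pi> x = 0"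
proof -
  obtain B where B: "B \<subseteq> T" "pairwise orthogonal B" "\<And>x. x \<in> B \<Longrightarrow> norm x = 1" "independent B" "span B = T"
    using orthonormal_basis_subspace[OF assms] by metis
  have "finite B"
    using B(4) independent_imp_finite by blast
  define \<pi> where "\<pi> x = (\<Sum>b\<in>B. (x \<bullet> b) *\<^sub>R b)" for x
  have "linear \<pi>"
    unfolding \<pi>_def by (intro linearI) (simp_all add: inner_add_left scaleR_add_left sum.distrib scaleR_sum_right)
  moreover have in_T: "\<pi> x \<in> T" for x
    unfolding \<pi>_def using B(1) assms by (intro subspace_sum) (auto intro: subspace_scale)
  moreover have perp: "x - \<pi> x \<in> T\<^sup>\<bottom>" for x
  proof -
    have "(x - \<pi> x) \<bullet> b = 0" if "b \<in> B" for b
    proof -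
      have "\<pi> x \<bullet> b = (\<Sum>c\<in>B. if c = b then x \<bullet> b else 0)"
        unfolding \<pi>_def inner_sum_left
        using B(2,3) that by (intro sum.cong) (auto simp: pairwise_def orthogonal_def norm_eq_1)
      also have "\<dots> = x \<bullet> b"
        using \<open>finite B\<close> that by simp
      finally show ?thesis
        by (simp add: inner_diff_left)
    qed
    then have "orthogonal (x - \<pi> x) y" if "y \<in> span B" for y
      using orthogonal_to_span[OF that, of "x - \<pi> x"] by (simp add: orthogonal_def)
    then show ?thesis
      unfolding orthogonal_comp_def B(5) by (simp add: orthogonal_commute)
  qed
  moreover have zero: "y = 0" if "y \<in> T" "y \<in> T\<^sup>\<bottom>" for y
    using that unfolding orthogonal_comp_def orthogonal_def by force
  moreover have "\<pi> x = x" if "x \<in> T" for x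
    using zero[of "x - \<pi> x"] perp[of x] in_T[of x] that assms by (simp add: subspace_diff)
  moreover have "\<pi> x = 0" if "x \<in> T\<^sup>\<bottom>" for x
  proof -
    have "x - (x - \<pi> x) \<in> T\<^sup>\<bottom>"
      by (rule subspace_diff[OF subspace_orthogonal_comp that perp])
    then show ?thesis
      using zero[of "\<pi> x"] in_T[of x] by simp
  qed
  ultimately show ?thesis
    using that by blast
qed

text \<open>The cylinder \<open>K\<close> over the chart image of \<open>E\<close> is a non-null set
  of the ambient Euclidean space, where non-flat points are negligible; removing them twice leaves a
  point. The map \<open>F\<close>, projection followed by the inverse chart, carries it into
  \<open>E\<close>, and the range of its derivative contains \<open>N (F x)\<close>.\<close>

lemma flat_nonempty:
  fixes S :: "'a::euclidean_space set"
  assumes null: "\<not> null_in_submanifold k S E" and ES: "E \<subseteq> S"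
    and N: "\<And>x v. x \<in> S \<Longrightarrow> v \<in> N x \<Longrightarrow> \<exists>\<gamma> e. e > 0 \<and> \<gamma> 0 = x \<and> (\<forall>t\<in>{-e<..<e::real}. \<gamma> t \<in> S) \<and> (\<gamma> has_vector_derivative v) (at 0)"
  shows "flat N (flat N E) \<noteq> {}"
proof -
  obtain U \<phi> T where chart: "slice_chart S k U \<phi> T" and nn: "cylinder T (\<phi> ` (E \<inter> U)) \<notin> null_sets lebesgue"
    using null ES unfolding null_in_submanifold_def by blast
  have c: "open U" "open (\<phi> ` U)" "inj_on \<phi> U" "subspace T" "\<phi> ` (S \<inter> U) = \<phi> ` U \<inter> T"
    using chart by (auto simp: slice_chart_def)
  obtain \<pi> where \<pi>: "linear \<pi>" "\<And>x. \<pi> x \<in> T" "\<And>x. x - \<pi> x \<in> T\<^sup>\<bottom>" "\<And>x. x \<in> T \<Longrightarrow> \<pi> x = x" "\<And>x. x \<in> T\<^sup>\<bottom> \<Longrightarrow> \<pi> x = 0"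
    using orthogonal_projection[OF c(4)] by blast
  define K where "K = {x. \<pi> x \<in> \<phi> ` (E \<inter> U)}"
  have "\<phi> ` (E \<inter> U) \<subseteq> T"
    using ES c(5) by blast
  then have "\<not> negligible K"
    using nn cylinder_preimage[OF c(4) _ \<pi>] by (simp add: K_def negligible_iff_null_sets)
  define F where "F x = inv_into U \<phi> (\<pi> x)" for x
  have FK: "F x \<in> E \<inter> U \<and> \<phi> (F x) = \<pi> x" if "x \<in> K" for x
    using that inv_into_f_f[OF c(3)] by (auto simp: K_def F_def)
  have F': "\<exists>F'. (F has_derivative F') (at x) \<and> N (F x) \<subseteq> range F'" if "x \<in> K" for x
  proof -
    have Fx: "F x \<in> E" "F x \<in> U" "\<phi> (F x) = \<pi> x"
      using FK[OF that] by auto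
    obtain \<phi>' \<psi>' where d: "(\<phi> has_derivative \<phi>') (at (F x))" "(inv_into U \<phi> has_derivative \<psi>') (at (\<phi> (F x)))"
      "\<forall>v. \<psi>' (\<phi>' v) = v" "\<forall>w. \<phi>' (\<psi>' w) = w"
      using slice_chart_derivative[OF chart Fx(2)] .
    have "(\<pi> has_derivative \<pi>) (at x)"
      by (rule bounded_linear_imp_has_derivative) (simp add: \<pi>(1) linear_conv_bounded_linear[symmetric])
    then have "(F has_derivative (\<lambda>v. \<psi>' (\<pi> v))) (at x)"
      unfolding F_def[abs_def] using has_derivative_compose d(2) unfolding Fx(3) by blast
    moreover have "N (F x) \<subseteq> range (\<lambda>v. \<psi>' (\<pi> v))"
    proof
      fix v assume "v \<in> N (F x)"
      then obtain \<gamma> e where \<gamma>: "e > 0" "\<gamma> 0 = F x" "\<forall>t\<in>{-e<..<e::real}. \<gamma> t \<in> S" "(\<gamma> has_vector_derivative v) (at 0)"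
        using N[of "F x" v] Fx(1) ES by blast
      have "\<phi>' v \<in> T"
        using slice_chart_velocity[OF chart Fx(2) d(1) \<gamma>(1) _ \<gamma>(2,4)] \<gamma>(3) by blast
      then have "v = \<psi>' (\<pi> (\<phi>' v))"
        using \<pi>(4) d(3) by simp
      then show "v \<in> range (\<lambda>v. \<psi>' (\<pi> v))"
        by blast
    qed
    ultimately show ?thesis
      by blast
  qed
  let ?U = "\<lambda>_::'a. UNIV :: 'a set"
  have 1: "F ` flat ?U K \<subseteq> flat N E"
    by (rule flat_image) (use FK F' in auto)
  have 2: "F ` flat ?U (flat ?U K) \<subseteq> flat N (flat N E)"
    by (rule flat_image[OF 1]) (use F' flat_subset in blast)
  have "negligible ((K - flat ?U K) \<union> (flat ?U K - flat ?U (flat ?U K)))"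
    using negligible_nonflat by (intro negligible_Un)
  then have "\<not> K \<subseteq> (K - flat ?U K) \<union> (flat ?U K - flat ?U (flat ?U K))"
    using \<open>\<not> negligible K\<close> negligible_subset by blast
  then show ?thesis
    using 2 by blast
qed

lemma boundary_tangents_curve:
  fixes \<alpha> :: "3 \<Rightarrow> ('a::euclidean_space \<times> 'a set) set"
  assumes "v \<in> boundary_tangents \<alpha> x"
  shows "\<exists>\<gamma> e. e > 0 \<and> \<gamma> 0 = x \<and> (\<forall>t\<in>{-e<..<e::real}. \<gamma> t \<in> fst ` \<alpha> 1 \<times> fst ` \<alpha> 2) \<and> (\<gamma> has_vector_derivative v) (at 0)"
proof -
  obtain \<gamma>1 e1 where 1: "e1 > 0" "\<forall>t\<in>{-e1<..<e1::real}. \<gamma>1 t \<in> fst ` \<alpha> 1" "\<gamma>1 0 = fst x" "(\<gamma>1 has_vector_derivative fst v) (at 0)"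
    using assms unfolding boundary_tangents_def tangent_space_def by auto
  obtain \<gamma>2 e2 where 2: "e2 > 0" "\<forall>t\<in>{-e2<..<e2::real}. \<gamma>2 t \<in> fst ` \<alpha> 2" "\<gamma>2 0 = snd x" "(\<gamma>2 has_vector_derivative snd v) (at 0)"
    using assms unfolding boundary_tangents_def tangent_space_def by auto
  have "((\<lambda>t. (\<gamma>1 t, \<gamma>2 t)) has_vector_derivative v) (at 0)"
    using has_vector_derivative_Pair[OF 1(4) 2(4)] by simp
  then show ?thesis
    using 1 2 by (intro exI[of _ "\<lambda>t. (\<gamma>1 t, \<gamma>2 t)"] exI[of _ "min e1 e2"]) auto
qed

lemma flat2_Int_open:
  assumes "open W"
  shows "flat N (flat N E) \<inter> W \<subseteq> flat N (flat N (E \<inter> W))"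
  using flat_Int_open[OF assms, of N "flat N E"] flat_mono[OF flat_Int_open[OF assms], of N N E] by blast

theorem no_pseudo_reflective:
  fixes \<alpha> :: "3 \<Rightarrow> ('a::euclidean_space \<times> 'a set) set"
  assumes bil: "smooth_projective_billiard \<alpha>" and refl: "pseudo_reflective \<alpha>"
  shows "DIM('a) \<le> 2"
proof -
  obtain E where E: "E \<subseteq> fst ` \<alpha> 1 \<times> fst ` \<alpha> 2"
    and null: "\<not> null_in_submanifold (2 * (DIM('a) - 1)) (fst ` \<alpha> 1 \<times> fst ` \<alpha> 2) E"
    and orb: "\<forall>(p1, p2)\<in>E. \<exists>p. periodic_orbit \<alpha> p \<and> p 1 = p1 \<and> p 2 = p2"
    using refl unfolding pseudo_reflective_def by (elim exE conjE)
  have orb': "\<exists>p. periodic_orbit \<alpha> p \<and> p 1 = fst x \<and> p 2 = snd x" if "x \<in> E" for x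
    using orb that by (cases x) auto
  let ?N = "boundary_tangents \<alpha>"
  have "flat ?N (flat ?N E) \<noteq> {}"
    by (rule flat_nonempty[OF null E boundary_tangents_curve])
  then obtain x where x: "x \<in> flat ?N (flat ?N E)"
    by blast
  then have "x \<in> E"
    using flat_subset by blast
  then obtain p where p: "periodic_orbit \<alpha> p" "p 1 = fst x" "p 2 = snd x"
    using orb' by blast
  then have px: "(p 1, p 2) = x"
    by simp
  have lf: "line_framed_hypersurface (\<alpha> j)" for j
    using bil by (simp add: smooth_projective_billiard_def)
  obtain U1 \<rho>1 n1 M1 where 1: "p 1 \<in> U1" "adapted (\<alpha> 1) U1 \<rho>1 n1 M1"
    using adapted_exists[OF lf periodic_orbitD(1)[OF p(1)]] .
  obtain U2 \<rho>2 n2 M2 where 2: "p 2 \<in> U2" "adapted (\<alpha> 2) U2 \<rho>2 n2 M2"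
    using adapted_exists[OF lf periodic_orbitD(1)[OF p(1)]] .
  obtain U0 \<rho>0 n0 M0 where 0: "p 0 \<in> U0" "adapted (\<alpha> 0) U0 \<rho>0 n0 M0"
    using adapted_exists[OF lf periodic_orbitD(1)[OF p(1)]] .
  have pE: "(p 1, p 2) \<in> E"
    using px \<open>x \<in> E\<close> by simp
  obtain C W where W: "(p 1, p 2) \<in> W" "orbit_family n1 n2 n0 M1 M2 M0 \<rho>0 C (E \<inter> W) W ?N"
    using orbit_family_near[OF bil E orb' p(1) pE 1(2,1) 2(2,1) 0(2,1)] by metis
  interpret orbit_family n1 n2 n0 M1 M2 M0 \<rho>0 C "E \<inter> W" W ?N
    by (fact W(2))
  have "x \<in> flat ?N (flat ?N (E \<inter> W))"
    using flat2_Int_open[OF open_W] x W(1) unfolding px by blast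
  moreover have "snd x \<in> U2"
    using 2(1) p(3) by simp
  ultimately show ?thesis
    using dim_le_2 adaptedD(1,5)[OF 2(2)] by blast
qed

section \<open>Planar curves of zero curvature\<close>

definition rot :: "real^2 \<Rightarrow> real^2" where
  "rot g = vector [- g $ 2, g $ 1]"

lemma inner_real2: "(x::real^2) \<bullet> y = x $ 1 * y $ 1 + x $ 2 * y $ 2"
  by (simp add: inner_vec_def sum_2)

lemma real2_eq_iff: "(x::real^2) = y \<longleftrightarrow> x $ 1 = y $ 1 \<and> x $ 2 = y $ 2"
  by (simp add: vec_eq_iff forall_2)

lemma inner_rot: "g \<bullet> rot g = 0" "rot g \<bullet> rot g = g \<bullet> g"
  by (simp_all add: inner_real2 rot_def)

lemma rot_nonzero: "g \<noteq> 0 \<Longrightarrow> rot g \<noteq> 0"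
  using inner_rot(2)[of g] by auto

lemma perp_rot:
  fixes g x :: "real^2"
  assumes "g \<bullet> x = 0"
  shows "(g \<bullet> g) *\<^sub>R x = (rot g \<bullet> x) *\<^sub>R rot g"
proof -
  have 0: "g $ 1 * x $ 1 = - (g $ 2 * x $ 2)"
    using assms by (simp add: inner_real2)
  have "(g $ 1 * g $ 1) * x $ 1 = - (g $ 1 * (g $ 2 * x $ 2))" "(g $ 2 * g $ 2) * x $ 2 = - (g $ 2 * (g $ 1 * x $ 1))"
    using 0 by (simp_all add: mult.assoc)
  then show ?thesis
    unfolding real2_eq_iff by (simp add: inner_real2 rot_def algebra_simps)
qed

lemma perp_parallel:
  fixes g x y :: "real^2"
  assumes "g \<noteq> 0" "g \<bullet> x = 0" "g \<bullet> y = 0" "y \<noteq> 0"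
  obtains c where "x = c *\<^sub>R y"
proof -
  have gg: "g \<bullet> g \<noteq> 0"
    using assms(1) by simp
  have px: "x = ((rot g \<bullet> x) / (g \<bullet> g)) *\<^sub>R rot g" and py: "y = ((rot g \<bullet> y) / (g \<bullet> g)) *\<^sub>R rot g"
    using perp_rot[OF assms(2)] perp_rot[OF assms(3)] gg by (simp_all add: field_simps divide_inverse_commute[symmetric] eq_vector_fraction_iff)
  have "rot g \<bullet> y \<noteq> 0"
    using py assms(4) by auto
  then have "x = ((rot g \<bullet> x) / (rot g \<bullet> y)) *\<^sub>R y"
    using px gg by (subst py) simp
  then show ?thesis
    by (rule that)
qed

text \<open>A curve in \<open>S\<close> that passes \<open>p\<close> with non-zero speed in the
  coordinate \<open>y\<close> takes all values of \<open>y\<close> near \<open>y p\<close>, by the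
  intermediate value theorem; injectivity of \<open>y\<close> on \<open>S\<close> leaves no room for
  other points of \<open>S\<close>. It is applied to boundaries, to straight lines, and to the third
  vertex as a function of the second.\<close>

lemma curve_covers:
  fixes c :: "real \<Rightarrow> 'a::euclidean_space" and y :: "'a \<Rightarrow> real"
  assumes U: "open U" "p \<in> U" "continuous_on U y" "inj_on y (S \<inter> U)"
    and c: "e > 0" "\<And>t. t \<in> {-e<..<e} \<Longrightarrow> c t \<in> S" "continuous_on {-e<..<e} c" "c 0 = p"
      "(c has_vector_derivative v) (at 0)" "(y has_derivative y') (at p)" "y' v \<noteq> 0"
  obtains G where "open G" "p \<in> G" "S \<inter> G \<subseteq> c ` {-e<..<e}"
proof -
  have "open ({-e<..<e} \<inter> c -` U)"
    by (rule continuous_open_preimage[OF c(3) open_greaterThanLessThan U(1)])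
  moreover have "0 \<in> {-e<..<e} \<inter> c -` U"
    using c(1,4) U(2) by simp
  ultimately obtain d where d: "d > 0" "cball 0 d \<subseteq> {-e<..<e} \<inter> c -` U"
    using open_contains_cball by blast
  have in_U: "c t \<in> U" "t \<in> {-e<..<e}" if "\<bar>t\<bar> \<le> d" for t
    using d(2) that by (auto simp: subset_eq)
  define f where "f t = y (c t)" for t
  have "(f has_derivative (\<lambda>r. y' (r *\<^sub>R v))) (at 0)"
    unfolding f_def using has_derivative_compose[where f = c and x = 0] c(4-6) by (simp add: has_vector_derivative_def)
  moreover have "y' (r *\<^sub>R v) = y' v * r" for r
    using c(6) by (simp add: has_derivative_def bounded_linear.linear linear_scale)
  ultimately have df: "(f has_real_derivative y' v) (at 0)"
    by (simp add: has_field_derivative_def)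
  obtain t1 t2 where t: "\<bar>t1\<bar> \<le> d" "\<bar>t2\<bar> \<le> d" "f t1 < f 0" "f 0 < f t2"
  proof (cases "y' v > 0")
    case True
    obtain d1 where d1: "d1 > 0" "\<forall>h>0. h < d1 \<longrightarrow> f (0 - h) < f 0"
      using DERIV_pos_inc_left[OF df True] by blast
    obtain d2 where d2: "d2 > 0" "\<forall>h>0. h < d2 \<longrightarrow> f 0 < f (0 + h)"
      using DERIV_pos_inc_right[OF df True] by blast
    define h where "h = min d (min d1 d2) / 2"
    have "h > 0" "h < d" "h < d1" "h < d2"
      using d(1) d1(1) d2(1) by (auto simp: h_def)
    then show ?thesis
      using that[of "- h" h] d1(2) d2(2) by simp
  next
    case False
    then have neg: "y' v < 0"
      using c(7) by simp
    obtain d1 where d1: "d1 > 0" "\<forall>h>0. h < d1 \<longrightarrow> f 0 < f (0 - h)"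
      using DERIV_neg_dec_left[OF df neg] by blast
    obtain d2 where d2: "d2 > 0" "\<forall>h>0. h < d2 \<longrightarrow> f (0 + h) < f 0"
      using DERIV_neg_dec_right[OF df neg] by blast
    define h where "h = min d (min d1 d2) / 2"
    have "h > 0" "h < d" "h < d1" "h < d2"
      using d(1) d1(1) d2(1) by (auto simp: h_def)
    then show ?thesis
      using that[of h "- h"] d1(2) d2(2) by simp
  qed
  define G where "G = U \<inter> y -` {f t1<..<f t2}"
  have "open G"
    unfolding G_def by (rule continuous_open_preimage[OF U(3,1) open_greaterThanLessThan])
  moreover have "p \<in> G"
    using t(3,4) c(4) U(2) by (simp add: G_def f_def)
  moreover have "S \<inter> G \<subseteq> c ` {-e<..<e}"
  proof
    fix q assume q: "q \<in> S \<inter> G"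
    have "continuous_on (cball 0 d) f"
      unfolding f_def
      by (rule continuous_on_compose2[OF U(3) continuous_on_subset[OF c(3)]]) (use in_U in auto)
    then have "connected (f ` cball 0 d)"
      by (rule connected_continuous_image) simp
    moreover have "f t1 \<in> f ` cball 0 d" "f t2 \<in> f ` cball 0 d"
      using t(1,2) by auto
    ultimately have "{f t1..f t2} \<subseteq> f ` cball 0 d"
      by (rule connected_contains_Icc)
    moreover have "y q \<in> {f t1..f t2}"
      using q by (auto simp: G_def)
    ultimately obtain s where s: "s \<in> cball 0 d" "y q = f s"
      by blast
    then have "\<bar>s\<bar> \<le> d"
      by simp
    then have "c s \<in> S \<inter> U"
      using in_U c(2) by blast
    moreover have "q \<in> S \<inter> U"
      using q by (auto simp: G_def)
    ultimately have "q = c s"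
      using s(2) inj_onD[OF U(4)] unfolding f_def by blast
    then show "q \<in> c ` {-e<..<e}"
      using in_U(2)[OF \<open>\<bar>s\<bar> \<le> d\<close>] by blast
  qed
  ultimately show ?thesis
    by (rule that)
qed

text \<open>Supplies the coordinate for \<open>curve_covers\<close>: the position along the line
  \<open>T\<close> of a slice chart. The last clause gives non-zero tangent vectors a non-zero speed
  in it.\<close>

lemma curve_chart:
  assumes "submanifold 1 S" "p \<in> S"
  obtains U y y' where "open U" "p \<in> U" "continuous_on U y" "inj_on y (S \<inter> U)" "(y has_derivative y') (at p)"
    "\<forall>v\<in>tangent_space S p. y' v = (0::real) \<longrightarrow> v = 0"
proof -
  obtain U \<phi> T where U: "p \<in> U" and chart: "slice_chart S 1 U \<phi> T"
    using assms unfolding submanifold_def by blast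
  have c: "open U" "inj_on \<phi> U" "smooth_on \<phi> U" "subspace T" "dim T = 1" "\<phi> ` (S \<inter> U) = \<phi> ` U \<inter> T"
    using chart by (auto simp: slice_chart_def)
  obtain B where B: "B \<subseteq> T" "independent B" "T \<subseteq> span B" "card B = 1"
    using basis_exists[of T] c(5) by metis
  then obtain w where w: "B = {w}"
    by (auto simp: card_1_singleton_iff)
  have "w \<noteq> 0"
    using B(2) w dependent_zero by auto
  have T: "\<exists>k. x = k *\<^sub>R w" if "x \<in> T" for x
    using that B(3) unfolding w span_singleton by blast
  obtain \<phi>' \<psi>' where d: "(\<phi> has_derivative \<phi>') (at p)" "(inv_into U \<phi> has_derivative \<psi>') (at (\<phi> p))"
    "\<forall>v. \<psi>' (\<phi>' v) = v" "\<forall>w. \<phi>' (\<psi>' w) = w"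
    using slice_chart_derivative[OF chart U] .
  define y where "y q = w \<bullet> \<phi> q" for q
  have "continuous_on U \<phi>"
    using c(3) ck_on_continuous unfolding smooth_on_def by blast
  then have "continuous_on U y"
    unfolding y_def by (intro continuous_intros)
  moreover have "inj_on y (S \<inter> U)"
  proof (rule inj_onI)
    fix q r assume qr: "q \<in> S \<inter> U" "r \<in> S \<inter> U" "y q = y r"
    have "\<phi> q \<in> T" "\<phi> r \<in> T"
      using qr(1,2) c(6) by blast+
    then obtain k l where "\<phi> q = k *\<^sub>R w" "\<phi> r = l *\<^sub>R w"
      using T by metis
    with qr(3) \<open>w \<noteq> 0\<close> have "\<phi> q = \<phi> r"
      by (simp add: y_def)
    then show "q = r"
      using inj_onD[OF c(2)] qr(1,2) by blast
  qed
  moreover have "(y has_derivative (\<lambda>v. w \<bullet> \<phi>' v)) (at p)"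
    unfolding y_def by (rule bounded_linear.has_derivative[OF bounded_linear_inner_right d(1)])
  moreover have "\<forall>v\<in>tangent_space S p. w \<bullet> \<phi>' v = 0 \<longrightarrow> v = 0"
  proof (intro ballI impI)
    fix v assume v: "v \<in> tangent_space S p" "w \<bullet> \<phi>' v = 0"
    have "\<phi>' v \<in> T"
      using v(1) tangent_space_chart[OF chart _ d(1)] U assms(2) by blast
    then obtain k where "\<phi>' v = k *\<^sub>R w"
      using T by metis
    with v(2) \<open>w \<noteq> 0\<close> have "\<phi>' v = 0"
      by simp
    moreover have "linear \<psi>'"
      using d(2) by (simp add: has_derivative_def bounded_linear.linear)
    ultimately show "v = 0"
      using d(3) linear_0 by metis
  qed
  ultimately show ?thesis
    using that[OF c(1) U] by blast
qed

text \<open>The normal and its derivative along the curve are both orthogonal to the velocity, hence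
  parallel in the plane. \<open>(F t)\<^sup>2 / G t\<close> is, up to a constant, the squared sine
  of the angle between the normal and its initial value; it has derivative 0 and starts at 0. The
  quotient replaces solving \<open>n' = \<mu> n\<close>, about whose coefficient nothing else is
  known.\<close>

lemma zero_curvature_straight:
  fixes \<gamma> \<gamma>' :: "real \<Rightarrow> real^2" and n :: "real^2 \<Rightarrow> real^2"
  assumes e: "e > 0" and \<gamma>: "\<And>t. t \<in> {-e<..<e} \<Longrightarrow> (\<gamma> has_vector_derivative \<gamma>' t) (at t)" "\<And>t. t \<in> {-e<..<e} \<Longrightarrow> \<gamma>' t \<noteq> 0"
    and n: "\<And>t. t \<in> {-e<..<e} \<Longrightarrow> n differentiable (at (\<gamma> t))" "\<And>t. t \<in> {-e<..<e} \<Longrightarrow> n (\<gamma> t) \<noteq> 0"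
      "\<And>t. t \<in> {-e<..<e} \<Longrightarrow> n (\<gamma> t) \<bullet> \<gamma>' t = 0"
      "\<And>t. t \<in> {-e<..<e} \<Longrightarrow> frechet_derivative n (at (\<gamma> t)) (\<gamma>' t) \<bullet> \<gamma>' t = 0"
    and t: "t \<in> {-e<..<e}"
  shows "n (\<gamma> 0) \<bullet> (\<gamma> t - \<gamma> 0) = 0" "\<exists>c. c \<noteq> 0 \<and> n (\<gamma> t) = c *\<^sub>R n (\<gamma> 0)"
proof -
  define F where "F t = n (\<gamma> t) \<bullet> rot (n (\<gamma> 0))" for t
  define G where "G t = n (\<gamma> t) \<bullet> n (\<gamma> t)" for t
  have zero: "0 \<in> {-e<..<e}"
    using e by simp
  have dN: "((\<lambda>t. n (\<gamma> t)) has_vector_derivative frechet_derivative n (at (\<gamma> t)) (\<gamma>' t)) (at t)" if "t \<in> {-e<..<e}" for t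
    using vector_derivative_diff_chain_within[OF \<gamma>(1)[OF that], of n "frechet_derivative n (at (\<gamma> t))"] n(1)[OF that]
    by (simp add: frechet_derivative_works has_derivative_at_withinI o_def)
  have const: "((\<lambda>t. (F t)\<^sup>2 / G t) has_real_derivative 0) (at t)" if t: "t \<in> {-e<..<e}" for t
  proof -
    let ?N' = "frechet_derivative n (at (\<gamma> t)) (\<gamma>' t)"
    obtain \<mu> where \<mu>: "?N' = \<mu> *\<^sub>R n (\<gamma> t)"
      using perp_parallel[OF \<gamma>(2)[OF t], of ?N' "n (\<gamma> t)"] n(2-4)[OF t] by (metis inner_commute)
    have "G t \<noteq> 0"
      using n(2)[OF t] by (simp add: G_def)
    have dF: "(F has_real_derivative \<mu> * F t) (at t)"
      using bounded_linear.has_vector_derivative[OF bounded_linear_inner_left dN[OF t], of "rot (n (\<gamma> 0))"]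
      unfolding \<mu> F_def by (simp add: has_real_derivative_iff_has_vector_derivative)
    have dG: "(G has_real_derivative 2 * \<mu> * G t) (at t)"
      using bounded_bilinear.has_vector_derivative[OF bounded_bilinear_inner dN[OF t] dN[OF t]]
      unfolding \<mu> G_def by (simp add: has_real_derivative_iff_has_vector_derivative mult.assoc)
    show ?thesis
      using \<open>G t \<noteq> 0\<close> by (auto intro!: derivative_eq_intros dF dG simp: power2_eq_square)
  qed
  have FG: "(F s)\<^sup>2 / G s = (F 0)\<^sup>2 / G 0" if "s \<in> {-e<..<e}" for s
    by (rule has_field_derivative_zero_constant[THEN exE, of "{-e<..<e}" "\<lambda>t. (F t)\<^sup>2 / G t"])
      (use const zero that in \<open>auto intro: has_field_derivative_at_within\<close>)
  have F0: "F s = 0" if "s \<in> {-e<..<e}" for s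
  proof -
    have "F 0 = 0" "G s \<noteq> 0"
      using n(2)[OF that] by (simp_all add: F_def G_def inner_rot)
    then show ?thesis
      using FG[OF that] by simp
  qed
  have par: "\<exists>c. c \<noteq> 0 \<and> n (\<gamma> s) = c *\<^sub>R n (\<gamma> 0)" if s: "s \<in> {-e<..<e}" for s
  proof -
    have "rot (n (\<gamma> 0)) \<bullet> n (\<gamma> s) = 0" "rot (n (\<gamma> 0)) \<bullet> n (\<gamma> 0) = 0"
      using F0[OF s] inner_rot(1) by (simp_all add: F_def inner_commute)
    then obtain c where "n (\<gamma> s) = c *\<^sub>R n (\<gamma> 0)"
      using perp_parallel[OF rot_nonzero[OF n(2)[OF zero]]] n(2)[OF zero] by metis
    then show ?thesis
      using n(2)[OF s] by auto
  qed
  show "\<exists>c. c \<noteq> 0 \<and> n (\<gamma> t) = c *\<^sub>R n (\<gamma> 0)"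
    by (rule par[OF t])
  have d0: "((\<lambda>t. n (\<gamma> 0) \<bullet> \<gamma> t) has_real_derivative 0) (at s)" if s: "s \<in> {-e<..<e}" for s
  proof -
    obtain c where c: "c \<noteq> 0" "n (\<gamma> s) = c *\<^sub>R n (\<gamma> 0)"
      using par[OF s] by blast
    have "c * (n (\<gamma> 0) \<bullet> \<gamma>' s) = 0"
      using n(3)[OF s] unfolding c(2) by simp
    then have "n (\<gamma> 0) \<bullet> \<gamma>' s = 0"
      using c(1) by simp
    then show ?thesis
      using bounded_linear.has_vector_derivative[OF bounded_linear_inner_right \<gamma>(1)[OF s], of "n (\<gamma> 0)"]
      by (simp add: has_real_derivative_iff_has_vector_derivative)
  qed
  have "n (\<gamma> 0) \<bullet> \<gamma> t = n (\<gamma> 0) \<bullet> \<gamma> 0"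
    by (rule has_field_derivative_zero_constant[THEN exE, of "{-e<..<e}" "\<lambda>t. n (\<gamma> 0) \<bullet> \<gamma> t"])
      (use zero t d0 in \<open>auto intro: has_field_derivative_at_within\<close>)
  then show "n (\<gamma> 0) \<bullet> (\<gamma> t - \<gamma> 0) = 0"
    by (simp add: inner_diff_right)
qed

text \<open>A curve realising one tangent vector is straight, so it runs in the boundary and in the
  line at once. By \<open>curve_covers\<close> it fills a neighbourhood of \<open>p\<close> in
  either set, so the two agree there.\<close>

lemma zero_curvature_line:
  fixes \<alpha> :: "((real^2) \<times> (real^2) set) set"
  assumes \<alpha>: "line_framed_hypersurface \<alpha>" and ad: "adapted \<alpha> U \<rho> n M" and p: "p \<in> fst ` \<alpha>" "p \<in> U"
    and G: "open G" "p \<in> G"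
    and curv: "\<And>q v. q \<in> fst ` \<alpha> \<inter> G \<Longrightarrow> n q \<bullet> v = 0 \<Longrightarrow> frechet_derivative n (at q) v \<bullet> v = 0"
  obtains V where "open V" "p \<in> V" "V \<subseteq> U" "fst ` \<alpha> \<inter> V = {q. n p \<bullet> (q - p) = 0} \<inter> V"
    "\<And>q. q \<in> fst ` \<alpha> \<inter> V \<Longrightarrow> \<exists>c. c \<noteq> 0 \<and> n q = c *\<^sub>R n p"
proof -
  let ?a = "fst ` \<alpha>"
  note a = adapted_def[of \<alpha> U \<rho> n M, THEN iffD1, OF ad]
  have oU: "open U" and grad: "\<And>q. q \<in> U \<Longrightarrow> (\<rho> has_derivative (\<lambda>v. n q \<bullet> v)) (at q)"
    and \<rho>0: "\<And>q. q \<in> ?a \<Longrightarrow> q \<in> U \<Longrightarrow> \<rho> q = 0" and n2: "ck_on 2 n U"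
    and tan: "tangent_space ?a p = {v. n p \<bullet> v = 0}" and nz: "\<And>q. q \<in> U \<Longrightarrow> n q \<noteq> 0"
    using a p by blast+
  define v0 where "v0 = rot (n p)"
  have v0: "v0 \<noteq> 0" "n p \<bullet> v0 = 0"
    using rot_nonzero[OF nz[OF p(2)]] inner_rot(1) by (simp_all add: v0_def)
  then have v0T: "v0 \<in> tangent_space ?a p"
    using tan by simp
  then obtain \<gamma> e where \<gamma>: "e > 0" "smooth_on \<gamma> {-e<..<e::real}" "\<forall>t\<in>{-e<..<e}. \<gamma> t \<in> ?a" "\<gamma> 0 = p" "(\<gamma> has_vector_derivative v0) (at 0)"
    unfolding tangent_space_def by blast
  define \<gamma>' where "\<gamma>' t = frechet_derivative \<gamma> (at t) 1" for t
  have c1: "ck_on (Suc 0) \<gamma> {-e<..<e}"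
    using \<gamma>(2) unfolding smooth_on_def by blast
  have d\<gamma>: "(\<gamma> has_vector_derivative \<gamma>' t) (at t)" if "t \<in> {-e<..<e}" for t
  proof -
    have "(\<gamma> has_derivative frechet_derivative \<gamma> (at t)) (at t)"
      by (rule ck_on_SucD[OF c1 that])
    moreover have "frechet_derivative \<gamma> (at t) r = r *\<^sub>R \<gamma>' t" for r
      using linear_scale[of "frechet_derivative \<gamma> (at t)" r 1] calculation
      by (simp add: \<gamma>'_def has_derivative_def bounded_linear.linear)
    ultimately show ?thesis
      unfolding has_vector_derivative_def by (metis (no_types, lifting) ext)
  qed
  have cont': "continuous_on {-e<..<e} \<gamma>'"
    using c1 unfolding \<gamma>'_def by simp
  have cont: "continuous_on {-e<..<e} \<gamma>"
    by (rule ck_on_continuous[OF c1])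
  have "\<gamma>' 0 = v0"
    using vector_derivative_unique_at[OF d\<gamma>[of 0] \<gamma>(5)] \<gamma>(1) by simp
  \<comment> \<open>Shrinks the parameter interval so that the curve stays regular and inside the
    region where the normal and the curvature hypothesis are available.\<close>
  define I where "I = ({-e<..<e} \<inter> \<gamma> -` (U \<inter> G)) \<inter> ({-e<..<e} \<inter> \<gamma>' -` (- {0}))"
  have "open I"
    unfolding I_def
    by (intro open_Int continuous_open_preimage[OF cont open_greaterThanLessThan] continuous_open_preimage[OF cont' open_greaterThanLessThan])
      (use oU G in \<open>auto simp: open_Compl\<close>)
  moreover have "0 \<in> I"
    using \<gamma>(1,4) p(2) G(2) v0(1) \<open>\<gamma>' 0 = v0\<close> by (simp add: I_def)
  ultimately obtain d where d: "d > 0" "ball 0 d \<subseteq> I"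
    using open_contains_ball by blast
  have I: "t \<in> {-e<..<e}" "\<gamma> t \<in> U" "\<gamma> t \<in> G" "\<gamma>' t \<noteq> 0" "\<gamma> t \<in> ?a" if "t \<in> {-d<..<d}" for t
  proof -
    have "t \<in> I"
      using d(2) that by (auto simp: subset_eq dist_real_def abs_less_iff)
    then show "t \<in> {-e<..<e}" "\<gamma> t \<in> U" "\<gamma> t \<in> G" "\<gamma>' t \<noteq> 0" "\<gamma> t \<in> ?a"
      using \<gamma>(3) by (auto simp: I_def)
  qed
  have n\<gamma>: "n (\<gamma> t) \<bullet> \<gamma>' t = 0" if t: "t \<in> {-d<..<d}" for t
  proof -
    have "((\<lambda>t. \<rho> (\<gamma> t)) has_derivative (\<lambda>r. n (\<gamma> t) \<bullet> (r *\<^sub>R \<gamma>' t))) (at t)"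
      using has_derivative_compose[OF d\<gamma>[OF I(1)[OF t], unfolded has_vector_derivative_def] grad[OF I(2)[OF t]]] .
    moreover have "((\<lambda>t. \<rho> (\<gamma> t)) has_derivative (\<lambda>r. 0)) (at t)"
      by (rule has_derivative_transform_within_open[OF has_derivative_const[where c = 0] open_greaterThanLessThan t])
        (use I \<rho>0 in auto)
    ultimately have "(\<lambda>r. n (\<gamma> t) \<bullet> (r *\<^sub>R \<gamma>' t)) = (\<lambda>r. 0)"
      by (rule has_derivative_unique)
    from fun_cong[OF this, of 1] show ?thesis
      by simp
  qed
  have straight: "n p \<bullet> (\<gamma> t - p) = 0" "\<exists>c. c \<noteq> 0 \<and> n (\<gamma> t) = c *\<^sub>R n p" if t: "t \<in> {-d<..<d}" for t
  proof -
    have diff: "n differentiable (at (\<gamma> t))" if "t \<in> {-d<..<d}" for t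
      using ck_on_2D(1)[OF n2 I(2)[OF that]] by (auto simp: differentiable_def)
    have k: "frechet_derivative n (at (\<gamma> t)) (\<gamma>' t) \<bullet> \<gamma>' t = 0" if "t \<in> {-d<..<d}" for t
      using curv[OF _ n\<gamma>[OF that]] I(3,5)[OF that] by blast
    show "n p \<bullet> (\<gamma> t - p) = 0" "\<exists>c. c \<noteq> 0 \<and> n (\<gamma> t) = c *\<^sub>R n p"
      using zero_curvature_straight[where \<gamma> = \<gamma> and \<gamma>' = \<gamma>' and n = n, OF d(1) d\<gamma>[OF I(1)] I(4) diff nz[OF I(2)] n\<gamma> k t]
      unfolding \<gamma>(4) by blast+
  qed
  have cont_d: "continuous_on {-d<..<d} \<gamma>"
    by (rule continuous_on_subset[OF cont]) (use I in auto)
  have "submanifold 1 ?a"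
    using \<alpha> by (simp add: line_framed_hypersurface_def)
  then obtain U1 y y' where y: "open U1" "p \<in> U1" "continuous_on U1 y" "inj_on y (?a \<inter> U1)" "(y has_derivative y') (at p)"
    "\<forall>v\<in>tangent_space ?a p. y' v = (0::real) \<longrightarrow> v = 0"
    using curve_chart[OF _ p(1)] by metis
  have "y' v0 \<noteq> 0"
    using y(6) v0T v0(1) by blast
  then obtain G1 where G1: "open G1" "p \<in> G1" "?a \<inter> G1 \<subseteq> \<gamma> ` {-d<..<d}"
    using curve_covers[OF y(1-4) d(1) I(5) cont_d \<gamma>(4,5) y(5)] by blast
  let ?S = "{q. n p \<bullet> (q - p) = 0}"
  have "inj_on ((\<bullet>) v0) (?S \<inter> UNIV)"
  proof (rule inj_onI)
    fix q r assume qr: "q \<in> ?S \<inter> UNIV" "r \<in> ?S \<inter> UNIV" "v0 \<bullet> q = v0 \<bullet> r"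
    have "n p \<bullet> ((q - p) - (r - p)) = 0"
      using qr(1,2) by (simp only: inner_diff_right) simp
    then have "n p \<bullet> (q - r) = 0"
      by simp
    then obtain c where "q - r = c *\<^sub>R v0"
      using perp_parallel[OF nz[OF p(2)] _ v0(2,1)] by metis
    moreover have "v0 \<bullet> (q - r) = 0"
      using qr(3) by (simp add: inner_diff_right)
    ultimately show "q = r"
      using v0(1) by simp
  qed
  moreover have "((\<bullet>) v0 has_derivative (\<bullet>) v0) (at p)"
    by (rule bounded_linear_imp_has_derivative[OF bounded_linear_inner_right])
  moreover have "continuous_on UNIV ((\<bullet>) v0)"
    by (intro continuous_intros)
  moreover have "v0 \<bullet> v0 \<noteq> 0"
    using v0(1) by simp
  moreover have "\<gamma> t \<in> ?S" if "t \<in> {-d<..<d}" for t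
    using straight(1)[OF that] by simp
  ultimately obtain G2 where G2: "open G2" "p \<in> G2" "?S \<inter> G2 \<subseteq> \<gamma> ` {-d<..<d}"
    using curve_covers[of UNIV p "(\<bullet>) v0" ?S d \<gamma> v0 "(\<bullet>) v0"] d(1) cont_d \<gamma>(4,5) by blast
  show ?thesis
  proof (rule that[of "G1 \<inter> G2 \<inter> U"])
    show "open (G1 \<inter> G2 \<inter> U)" "p \<in> G1 \<inter> G2 \<inter> U" "G1 \<inter> G2 \<inter> U \<subseteq> U"
      using G1 G2 oU p by auto
    have "q \<in> ?S" if q: "q \<in> ?a \<inter> (G1 \<inter> G2 \<inter> U)" for q
    proof -
      obtain t where "t \<in> {-d<..<d}" "q = \<gamma> t"
        using G1(3) q by blast
      then show ?thesis
        using straight(1) by simp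
    qed
    moreover have "q \<in> ?a" if q: "q \<in> ?S \<inter> (G1 \<inter> G2 \<inter> U)" for q
    proof -
      obtain t where "t \<in> {-d<..<d}" "q = \<gamma> t"
        using G2(3) q by blast
      then show ?thesis
        using I(5) by simp
    qed
    ultimately show "?a \<inter> (G1 \<inter> G2 \<inter> U) = ?S \<inter> (G1 \<inter> G2 \<inter> U)"
      by blast
    show "\<exists>c. c \<noteq> 0 \<and> n q = c *\<^sub>R n p" if q: "q \<in> ?a \<inter> (G1 \<inter> G2 \<inter> U)" for q
    proof -
      obtain t where "t \<in> {-d<..<d}" "q = \<gamma> t"
        using G1(3) q by blast
      then show ?thesis
        using straight(2) by simp
    qed
  qed
qed

section \<open>Lines in the projective plane\<close>

text \<open>The homogeneous equation of the affine line through \<open>p\<close> with normal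
  \<open>n\<close>, as a covector.\<close>

definition line_form :: "real^2 \<Rightarrow> real^2 \<Rightarrow> real^3" where
  "line_form n p = vector [n $ 1, n $ 2, - (n \<bullet> p)]"

lemma inner_line_form: "line_form n p \<bullet> homogeneous q = n \<bullet> (q - p)"
  by (simp add: line_form_def homogeneous_def inner_vec_def sum_3 sum_2 inner_diff_right algebra_simps)

text \<open>Cramer's rule: up to the determinant, the cross products are the basis dual to
  \<open>a, b, c\<close>. Projectively, they are the vertices of the triangle with sides
  \<open>a, b, c\<close>.\<close>

lemma triple_product_expansion:
  fixes a b c x :: "real^3"
  shows "(a \<bullet> cross3 b c) *\<^sub>R x = (x \<bullet> a) *\<^sub>R cross3 b c + (x \<bullet> b) *\<^sub>R cross3 c a + (x \<bullet> c) *\<^sub>R cross3 a b"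
  by (simp add: vec_eq_iff forall_3 inner_vec_def sum_3 cross3_def algebra_simps)

text \<open>Multiplicativity of the determinant: on the right stands the determinant of the matrix
  of pairings.\<close>

lemma triple_product_mult:
  fixes a b c x y z :: "real^3"
  shows "(a \<bullet> cross3 b c) * (x \<bullet> cross3 y z) =
    (a \<bullet> x) * ((b \<bullet> y) * (c \<bullet> z) - (b \<bullet> z) * (c \<bullet> y)) -
    (a \<bullet> y) * ((b \<bullet> x) * (c \<bullet> z) - (b \<bullet> z) * (c \<bullet> x)) +
    (a \<bullet> z) * ((b \<bullet> x) * (c \<bullet> y) - (b \<bullet> y) * (c \<bullet> x))"
  by (simp add: inner_vec_def sum_3 cross3_def algebra_simps)

lemma triple_product_rotate: "a \<bullet> cross3 b c = b \<bullet> cross3 c a"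
  by (simp add: inner_vec_def sum_3 cross3_def algebra_simps)

lemma rp2_join_span: "rp2_join (span {x}) (span {y}) = span {x, y}"
  unfolding rp2_join_def
proof (intro equalityI span_minimal subspace_span)
  show "span {x} \<union> span {y} \<subseteq> span {x, y}"
    by (simp add: span_mono)
  show "{x, y} \<subseteq> span (span {x} \<union> span {y})"
    by (auto intro!: span_base)
qed

lemma rp2_join_vertices:
  fixes a b c :: "real^3"
  assumes D: "a \<bullet> cross3 b c \<noteq> 0"
  shows "rp2_join (span {cross3 c a}) (span {cross3 a b}) = {x. a \<bullet> x = 0}"
  unfolding rp2_join_span
proof (intro equalityI subsetI)
  fix x assume "x \<in> span {cross3 c a, cross3 a b}"
  then obtain k l where "x = k *\<^sub>R cross3 c a + l *\<^sub>R cross3 a b"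
    by (rule in_span_pairE)
  then show "x \<in> {x. a \<bullet> x = 0}"
    by (simp add: inner_add_right dot_cross_self)
next
  fix x assume "x \<in> {x. a \<bullet> x = 0}"
  then have "(a \<bullet> cross3 b c) *\<^sub>R x = (x \<bullet> b) *\<^sub>R cross3 c a + (x \<bullet> c) *\<^sub>R cross3 a b"
    using triple_product_expansion[of a b c x] by (simp add: inner_commute)
  then have "(a \<bullet> cross3 b c) *\<^sub>R x \<in> span {cross3 c a, cross3 a b}"
    by (simp add: span_add span_scale span_base)
  then have "(1 / (a \<bullet> cross3 b c)) *\<^sub>R ((a \<bullet> cross3 b c) *\<^sub>R x) \<in> span {cross3 c a, cross3 a b}"
    by (rule span_scale)
  then show "x \<in> span {cross3 c a, cross3 a b}"
    using D by simp
qed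

lemma affine_part_vertices:
  assumes "line_form n p \<bullet> cross3 b c \<noteq> 0"
  shows "affine_part (rp2_join (span {cross3 c (line_form n p)}) (span {cross3 (line_form n p) b})) = {q. n \<bullet> (q - p) = 0}"
  unfolding affine_part_def rp2_join_vertices[OF assms] by (simp add: inner_line_form)

text \<open>\<open>m\<close> is the point at infinity of the line through \<open>q\<close> along
  \<open>M\<close>. The combination \<open>V\<close> of \<open>m\<close> and
  \<open>homogeneous q\<close> that the second line annihilates is, by \<open>cev\<close>,
  annihilated by the third one too; so it represents their intersection, which may itself be at
  infinity.\<close>

lemma framing_through_vertex:
  assumes D: "line_form n1 p1 \<bullet> cross3 (line_form n2 p2) (line_form n3 p3) \<noteq> 0"
    and q: "n1 \<bullet> (q - p1) = 0" and M: "n1 \<bullet> M \<noteq> 0" and nz: "n2 \<bullet> (q - p2) \<noteq> 0"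
    and cev: "(n2 \<bullet> (q - p2)) * (n3 \<bullet> M) = (n3 \<bullet> (q - p3)) * (n2 \<bullet> M)"
  shows "affine_part (rp2_join (span {homogeneous q}) (span {cross3 (line_form n2 p2) (line_form n3 p3)})) =
    {q + v | v. v \<in> span {M}}"
proof -
  define a b c where "a = line_form n1 p1" and "b = line_form n2 p2" and "c = line_form n3 p3"
  define m :: "real^3" where "m = vector [M $ 1, M $ 2, 0]"
  have im: "line_form n p \<bullet> m = n \<bullet> M" for n p
    by (simp add: line_form_def m_def inner_vec_def sum_3 sum_2)
  let ?h = "homogeneous q" and ?Q = "cross3 b c"
  define V where "V = (b \<bullet> ?h) *\<^sub>R m - (b \<bullet> m) *\<^sub>R ?h"
  have bh: "b \<bullet> ?h \<noteq> 0"
    using nz by (simp add: b_def inner_line_form)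
  have "V \<bullet> b = 0"
    unfolding inner_commute[of V b] by (simp add: V_def inner_diff_right)
  moreover have "V \<bullet> c = 0"
    using cev unfolding inner_commute[of V c]
    by (simp add: V_def inner_diff_right b_def c_def im inner_line_form mult.commute)
  moreover define k where "k = V \<bullet> a"
  ultimately have V: "(a \<bullet> ?Q) *\<^sub>R V = k *\<^sub>R ?Q"
    using triple_product_expansion[of a b c V] by simp
  have k: "k \<noteq> 0"
    using q M bh unfolding k_def inner_commute[of V a]
    by (simp add: V_def inner_diff_right a_def im inner_line_form)
  have Da: "a \<bullet> ?Q \<noteq> 0"
    using D by (simp add: a_def b_def c_def)
  have "span {?h, ?Q} = span {?h, m}"
  proof (intro equalityI span_minimal subspace_span)
    have "?Q = (1 / k) *\<^sub>R (k *\<^sub>R ?Q)"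
      using k by simp
    also have "\<dots> = (1 / k) *\<^sub>R ((a \<bullet> ?Q) *\<^sub>R V)"
      unfolding V ..
    also have "\<dots> \<in> span {?h, m}"
      unfolding V_def by (intro span_scale span_diff span_base) auto
    finally show "{?h, ?Q} \<subseteq> span {?h, m}"
      by (simp add: span_base)
    have "V = (1 / (a \<bullet> ?Q)) *\<^sub>R ((a \<bullet> ?Q) *\<^sub>R V)"
      using Da by simp
    also have "\<dots> = (1 / (a \<bullet> ?Q)) *\<^sub>R (k *\<^sub>R ?Q)"
      unfolding V ..
    also have "\<dots> \<in> span {?h, ?Q}"
      by (intro span_scale span_base) auto
    finally have VQ: "V \<in> span {?h, ?Q}" .
    have "m = (1 / (b \<bullet> ?h)) *\<^sub>R (V + (b \<bullet> m) *\<^sub>R ?h)"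
      using bh by (simp add: V_def)
    also have "\<dots> \<in> span {?h, ?Q}"
      by (intro span_scale span_add VQ span_base) auto
    finally show "{?h, m} \<subseteq> span {?h, ?Q}"
      by (simp add: span_base)
  qed
  moreover have "affine_part (span {?h, m}) = {q + v | v. v \<in> span {M}}"
  proof (intro equalityI subsetI)
    fix r assume "r \<in> affine_part (span {?h, m})"
    then have "homogeneous r \<in> span {?h, m}"
      by (simp add: affine_part_def)
    then obtain k l where kl: "homogeneous r = k *\<^sub>R ?h + l *\<^sub>R m"
      by (rule in_span_pairE)
    then have "k = 1" "r = q + l *\<^sub>R M"
      by (simp_all add: homogeneous_def m_def vec_eq_iff forall_3 forall_2)
    then show "r \<in> {q + v | v. v \<in> span {M}}"
      by (auto simp: span_singleton)
  next
    fix r assume "r \<in> {q + v | v. v \<in> span {M}}"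
    then obtain l where "r = q + l *\<^sub>R M"
      by (auto simp: span_singleton)
    then have "homogeneous r = ?h + l *\<^sub>R m"
      by (simp add: homogeneous_def m_def vec_eq_iff forall_3)
    also have "\<dots> \<in> span {?h, m}"
      by (intro span_scale span_add span_base) auto
    finally show "r \<in> affine_part (span {?h, m})"
      by (simp add: affine_part_def)
  qed
  ultimately show ?thesis
    unfolding rp2_join_span b_def c_def by simp
qed

lemma numerals_3: "(3::3) = 0" "(4::3) = 1"
  by simp_all

lemma three_cases: "(j::3) = 0 \<or> j = 1 \<or> j = 2"
proof -
  have "j \<in> {1, 2, 3}"
    unfolding UNIV_3[symmetric] by simp
  then show ?thesis
    unfolding numerals_3 by blast
qed

text \<open>The intersection of the lines \<open>j - 1\<close> and \<open>j\<close>, since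
  \<open>j + 2 = j - 1\<close> modulo 3. Line \<open>j\<close> then joins the vertices
  \<open>j\<close> and \<open>j + 1\<close>, and its framing points to vertex \<open>j + 2\<close>,
  as in \<open>right_spherical_boundary\<close>.\<close>

definition vertex :: "(3 \<Rightarrow> real^3) \<Rightarrow> 3 \<Rightarrow> (real^3) set" where
  "vertex l j = span {cross3 (l (j + 2)) (l j)}"

lemma triple_product_shift:
  fixes l :: "3 \<Rightarrow> real^3"
  shows "l j \<bullet> cross3 (l (j + 1)) (l (j + 2)) = l 0 \<bullet> cross3 (l 1) (l 2)"
  using three_cases[of j] triple_product_rotate[of "l 0" "l 1" "l 2"] triple_product_rotate[of "l 1" "l 2" "l 0"]
  by (auto simp: numerals_3)

lemma vertices_noncollinear:
  assumes D: "l 0 \<bullet> cross3 (l 1) (l 2) \<noteq> 0"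
  shows "rp2_point (vertex l j)" "non_collinear (vertex l)"
proof -
  have s: "j + 1 + 2 = j" "j + 2 + 2 = j + 1" for j :: 3
    using three_cases[of j] by (auto simp: numerals_3)
  have nz: "cross3 (l (j + 2)) (l j) \<noteq> 0" for j
  proof
    assume "cross3 (l (j + 2)) (l j) = 0"
    then have "l (j + 1) \<bullet> cross3 (l (j + 1 + 1)) (l (j + 1 + 2)) = 0"
      unfolding s by (simp add: add.assoc)
    then show False
      using D triple_product_shift[of l "j + 1"] by simp
  qed
  show "rp2_point (vertex l j)"
    unfolding rp2_point_def vertex_def using nz[of j] by (simp add: dim_singleton)
  show "non_collinear (vertex l)"
    unfolding non_collinear_def
  proof (rule notI, elim exE conjE)
    fix L assume L: "rp2_line L" "\<forall>j. vertex l j \<subseteq> L"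
    have sub: "subspace L"
      using L(1) by (simp add: rp2_line_def)
    have Q: "cross3 (l (j + 2)) (l j) \<in> L" for j
      using L(2) span_base[of _ "{cross3 (l (j + 2)) (l j)}"] unfolding vertex_def by blast
    have "x \<in> L" for x
    proof -
      have "(l 0 \<bullet> cross3 (l 1) (l 2)) *\<^sub>R x \<in> L"
        unfolding triple_product_expansion[of "l 0" "l 1" "l 2" x]
        using Q[of 0] Q[of 1] Q[of 2] sub by (simp add: subspace_add subspace_scale numerals_3)
      then have "(1 / (l 0 \<bullet> cross3 (l 1) (l 2))) *\<^sub>R ((l 0 \<bullet> cross3 (l 1) (l 2)) *\<^sub>R x) \<in> L"
        by (rule subspace_scale[OF sub])
      then show ?thesis
        using D by simp
    qed
    then have "L = UNIV"
      by blast
    then show False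
      using L(1) by (simp add: rp2_line_def)
  qed
qed

lemma right_sphericalI:
  fixes \<alpha> :: "3 \<Rightarrow> ((real^2) \<times> (real^2) set) set"
  assumes bil: "smooth_projective_billiard \<alpha>" and orb: "periodic_orbit \<alpha> p"
    and D: "line_form (n 0) (p 0) \<bullet> cross3 (line_form (n 1) (p 1)) (line_form (n 2) (p 2)) \<noteq> 0"
    and loc: "\<And>j. \<exists>V. open V \<and> p j \<in> V \<and> fst ` \<alpha> j \<inter> V = {q. n j \<bullet> (q - p j) = 0} \<inter> V \<and>
      (\<forall>q L. (q, L) \<in> \<alpha> j \<and> q \<in> V \<longrightarrow> (\<exists>M. direction q L = span {M} \<and> n j \<bullet> M \<noteq> 0 \<and> n (j + 1) \<bullet> (q - p (j + 1)) \<noteq> 0 \<and>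
        (n (j + 1) \<bullet> (q - p (j + 1))) * (n (j + 2) \<bullet> M) = (n (j + 2) \<bullet> (q - p (j + 2))) * (n (j + 1) \<bullet> M)))"
  shows "right_spherical \<alpha>"
proof -
  define l where "l j = line_form (n j) (p j)" for j
  have Dl: "l 0 \<bullet> cross3 (l 1) (l 2) \<noteq> 0"
    using D by (simp add: l_def)
  have s: "j + 1 + 2 = j" "j + 2 + 2 = j + 1" for j :: 3
    using three_cases[of j] by (auto simp: numerals_3)
  have Dj: "l j \<bullet> cross3 (l (j + 1)) (l (j + 2)) \<noteq> 0" for j
    using triple_product_shift[of l j] Dl by simp
  have "\<exists>L N. (p j, L) \<in> \<alpha> j \<and> openin PT_topology N \<and> (p j, L) \<in> N \<and>
      \<alpha> j \<inter> N = right_spherical_boundary (vertex l) j \<inter> N" for j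
  proof -
    obtain V where V: "open V" "p j \<in> V" "fst ` \<alpha> j \<inter> V = {q. n j \<bullet> (q - p j) = 0} \<inter> V"
      and fr: "\<forall>q L. (q, L) \<in> \<alpha> j \<and> q \<in> V \<longrightarrow> (\<exists>M. direction q L = span {M} \<and> n j \<bullet> M \<noteq> 0 \<and> n (j + 1) \<bullet> (q - p (j + 1)) \<noteq> 0 \<and>
        (n (j + 1) \<bullet> (q - p (j + 1))) * (n (j + 2) \<bullet> M) = (n (j + 2) \<bullet> (q - p (j + 2))) * (n (j + 1) \<bullet> M))"
      using loc[of j] by blast
    have PT: "\<alpha> j \<subseteq> PT"
      using bil by (simp add: smooth_projective_billiard_def line_framed_hypersurface_def PT_submanifold_def)
    \<comment> \<open>All lines through points of \<open>V\<close>: both line fields are determined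
      by their base points, so localising the base point suffices.\<close>
    define N where "N = {(q, L). (q, L) \<in> PT \<and> q \<in> V}"
    have line: "affine_part (rp2_join (vertex l j) (vertex l (j + 1))) = {q. n j \<bullet> (q - p j) = 0}"
      using affine_part_vertices[OF Dj[of j, unfolded l_def[of j]]] unfolding vertex_def s l_def[of j] by simp
    have frame: "affine_part (rp2_join (span {homogeneous q}) (vertex l (j + 2))) = L" if qL: "(q, L) \<in> \<alpha> j" "q \<in> V" for q L
    proof -
      obtain M where M: "direction q L = span {M}" "n j \<bullet> M \<noteq> 0" "n (j + 1) \<bullet> (q - p (j + 1)) \<noteq> 0"
        "(n (j + 1) \<bullet> (q - p (j + 1))) * (n (j + 2) \<bullet> M) = (n (j + 2) \<bullet> (q - p (j + 2))) * (n (j + 1) \<bullet> M)"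
        using fr qL by blast
      have "q \<in> fst ` \<alpha> j \<inter> V"
        using qL by force
      then have "n j \<bullet> (q - p j) = 0"
        using V(3) by blast
      from framing_through_vertex[OF Dj[of j, unfolded l_def] this M(2-4)]
      have "affine_part (rp2_join (span {homogeneous q}) (vertex l (j + 2))) = {q + v | v. v \<in> direction q L}"
        unfolding vertex_def s l_def M(1) .
      also have "\<dots> = L"
      proof (intro equalityI subsetI)
        fix r assume "r \<in> L"
        then have "r - q \<in> direction q L" "r = q + (r - q)"
          by (simp_all add: direction_def)
        then show "r \<in> {q + v | v. v \<in> direction q L}"
          by blast
      qed (auto simp: direction_def)
      finally show ?thesis .
    qed
    have "open_in_PT N"
      unfolding open_in_PT_def
    proof
      show "N \<subseteq> PT"
        by (auto simp: N_def)
      have "(q, line_through q (q + v)) \<in> PT" if "v \<noteq> 0" for q v :: "real^2"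
        using that by (simp add: PT_def is_line_def line_through_def affine_affine_hull aff_dim_affine_hull aff_dim_2 hull_inc)
      then have "{(q, v). v \<noteq> 0 \<and> (q, line_through q (q + v)) \<in> N} = V \<times> (- {0})"
        by (auto simp: N_def)
      then show "open {(q, v). v \<noteq> 0 \<and> (q, line_through q (q + v)) \<in> N}"
        using V(1) by (simp add: open_Times open_Compl)
    qed
    obtain L where L: "(p j, L) \<in> \<alpha> j"
      using periodic_orbitD(1)[OF orb, of j] by force
    have "\<alpha> j \<inter> N = right_spherical_boundary (vertex l) j \<inter> N"
    proof (intro equalityI subsetI)
      fix z assume z: "z \<in> \<alpha> j \<inter> N"
      obtain q L where qL: "z = (q, L)"
        by (cases z)
      then have "q \<in> fst ` \<alpha> j \<inter> V" "(q, L) \<in> \<alpha> j" "q \<in> V"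
        using z by (force simp: N_def)+
      then have "n j \<bullet> (q - p j) = 0" "L = affine_part (rp2_join (span {homogeneous q}) (vertex l (j + 2)))"
        using V(3) frame by blast+
      then show "z \<in> right_spherical_boundary (vertex l) j \<inter> N"
        using z unfolding right_spherical_boundary_def line qL by blast
    next
      fix z assume z: "z \<in> right_spherical_boundary (vertex l) j \<inter> N"
      then obtain q where q: "z = (q, affine_part (rp2_join (span {homogeneous q}) (vertex l (j + 2))))" "n j \<bullet> (q - p j) = 0"
        unfolding right_spherical_boundary_def line by blast
      then have "q \<in> V"
        using z by (simp add: N_def)
      then have "q \<in> fst ` \<alpha> j"
        using q(2) V(3) by blast
      then obtain L where "(q, L) \<in> \<alpha> j"
        by force
      then show "z \<in> \<alpha> j \<inter> N"
        using frame[OF _ \<open>q \<in> V\<close>] q(1) z by simp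
    qed
    moreover have "(p j, L) \<in> N"
      using L PT V(2) by (auto simp: N_def)
    moreover have "openin PT_topology N"
      using \<open>open_in_PT N\<close> by (simp add: openin_PT_topology)
    ultimately show ?thesis
      using L by blast
  qed
  then show ?thesis
    unfolding right_spherical_def using orb vertices_noncollinear[of l, OF Dl] by blast
qed

context orbit_family
begin

text \<open>In the plane each equation says that the framing line at one vertex passes through the
  common point of the tangents at the other two, in the form used by
  \<open>framing_through_vertex\<close>. Eliminating \<open>hCB\<close> by Ceva's condition turns
  all three into identities.\<close>

lemma cevians_through_vertices:
  assumes x: "x \<in> flat N E"
  shows "hBA x * (n3 (C x) \<bullet> M1 (fst x)) = hCA x * (n2 (snd x) \<bullet> M1 (fst x))"
    "hCB x * (n1 (fst x) \<bullet> M2 (snd x)) = hAB x * (n3 (C x) \<bullet> M2 (snd x))"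
    "hAC x * (n2 (snd x) \<bullet> M3 (C x)) = hBC x * (n1 (fst x) \<bullet> M3 (C x))"
proof -
  have E: "x \<in> E"
    using x flat_subset by blast
  note nz = h_nonzero[OF E]
  define e1 e2 where "e1 = snd x - fst x" and "e2 = C x - fst x"
  have e: "snd x - fst x = e1" "C x - fst x = e2" "fst x - snd x = - e1" "C x - snd x = e2 - e1" "fst x - C x = - e2" "snd x - C x = e1 - e2"
    by (simp_all add: e1_def e2_def)
  have M: "M1 (fst x) = (1 / 2) *\<^sub>R ((1 / hAB x) *\<^sub>R e1 + (1 / hAC x) *\<^sub>R e2)"
    "M2 (snd x) = (1 / 2) *\<^sub>R ((1 / hBA x) *\<^sub>R (- e1) + (1 / hBC x) *\<^sub>R (e2 - e1))"
    "M3 (C x) = (1 / 2) *\<^sub>R ((1 / hCA x) *\<^sub>R (- e2) + (1 / hCB x) *\<^sub>R (e1 - e2))"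
  proof -
    have half: "y = (1 / 2) *\<^sub>R z" if "2 *\<^sub>R y = z" for y z :: 'v
      using that by auto
    show "M1 (fst x) = (1 / 2) *\<^sub>R ((1 / hAB x) *\<^sub>R e1 + (1 / hAC x) *\<^sub>R e2)"
      using reflection(1)[OF E] by (intro half) (simp only: h_defs e)
    show "M2 (snd x) = (1 / 2) *\<^sub>R ((1 / hBA x) *\<^sub>R (- e1) + (1 / hBC x) *\<^sub>R (e2 - e1))"
      using reflection(2)[OF E] by (intro half) (simp only: h_defs e)
    show "M3 (C x) = (1 / 2) *\<^sub>R ((1 / hCA x) *\<^sub>R (- e2) + (1 / hCB x) *\<^sub>R (e1 - e2))"
      using reflection(3)[OF E] by (intro half) (simp only: h_defs e)
  qed
  have hu: "hCB x = hAB x * hBC x * hCA x / (hAC x * hBA x)"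
    using menelaus[OF x] nz by (simp add: field_simps)
  note i = inner_edges[of x, unfolded e]
  show "hBA x * (n3 (C x) \<bullet> M1 (fst x)) = hCA x * (n2 (snd x) \<bullet> M1 (fst x))"
    "hCB x * (n1 (fst x) \<bullet> M2 (snd x)) = hAB x * (n3 (C x) \<bullet> M2 (snd x))"
    "hAC x * (n2 (snd x) \<bullet> M3 (C x)) = hBC x * (n1 (fst x) \<bullet> M3 (C x))"
    unfolding M inner_scaleR_right inner_add_right inner_diff_right inner_minus_right i
    using nz unfolding hu by (simp_all add: field_simps)
qed

end

section \<open>Reflective planar billiards\<close>

text \<open>Every tangent vector at a point of an open piece of the product is the velocity of a
  curve inside the piece. So all its points are flat and, unlike in the measurable case, none is
  discarded.\<close>

lemma flat_product_open:
  fixes \<alpha> :: "3 \<Rightarrow> ('a::euclidean_space \<times> 'a set) set"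
  assumes "open G1" "open G2" and x: "x \<in> (fst ` \<alpha> 1 \<inter> G1) \<times> (fst ` \<alpha> 2 \<inter> G2)"
  shows "x \<in> flat (boundary_tangents \<alpha>) ((fst ` \<alpha> 1 \<inter> G1) \<times> (fst ` \<alpha> 2 \<inter> G2))"
proof (rule flatI_curves[OF x])
  fix v assume "v \<in> boundary_tangents \<alpha> x"
  then obtain \<gamma> e where \<gamma>: "e > 0" "\<gamma> 0 = x" "\<forall>t\<in>{-e<..<e::real}. \<gamma> t \<in> fst ` \<alpha> 1 \<times> fst ` \<alpha> 2" "(\<gamma> has_vector_derivative v) (at 0)"
    using boundary_tangents_curve by blast
  have "isCont \<gamma> 0"
    using \<gamma>(4) has_vector_derivative_continuous by blast
  moreover have "open (G1 \<times> G2)" "x \<in> G1 \<times> G2"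
    using assms by (auto intro: open_Times)
  ultimately have "\<forall>\<^sub>F t in at 0. \<gamma> t \<in> G1 \<times> G2"
    using \<gamma>(2) unfolding continuous_at by (simp add: topological_tendstoD)
  then obtain d where d: "d > 0" "\<And>t. t \<noteq> 0 \<Longrightarrow> dist t 0 < d \<Longrightarrow> \<gamma> t \<in> G1 \<times> G2"
    by (auto simp: eventually_at)
  have "\<gamma> t \<in> (fst ` \<alpha> 1 \<inter> G1) \<times> (fst ` \<alpha> 2 \<inter> G2)" if t: "t \<in> {- min d e<..<min d e}" for t
  proof (cases "t = 0")
    case True
    then show ?thesis
      using x \<gamma>(2) by simp
  next
    case False
    have "\<gamma> t \<in> G1 \<times> G2"
      using d(2)[OF False] t by (auto simp: dist_real_def abs_less_iff)
    moreover have "\<gamma> t \<in> fst ` \<alpha> 1 \<times> fst ` \<alpha> 2"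
      using \<gamma>(3) t by auto
    ultimately show ?thesis
      by (simp add: mem_Times_iff)
  qed
  then show "\<exists>\<gamma> e. e > 0 \<and> \<gamma> 0 = x \<and> (\<forall>t\<in>{-e<..<e::real}. \<gamma> t \<in> (fst ` \<alpha> 1 \<inter> G1) \<times> (fst ` \<alpha> 2 \<inter> G2)) \<and> (\<gamma> has_vector_derivative v) (at 0)"
    using \<gamma>(1,2,4) d(1) by (intro exI[of _ \<gamma>] exI[of _ "min d e"]) auto
qed

lemma (in orbit_family) tA_nonzero: "x \<in> E \<Longrightarrow> tA x \<noteq> 0"
  using nondegenerate[of x] h_nonzero(1)[of x] unfolding in_plane by fastforce

lemma quadratic_on_line:
  fixes n0 t v :: "real^2"
  assumes "linear D" "D t \<bullet> t = 0" "n0 \<noteq> 0" "n0 \<bullet> t = 0" "t \<noteq> 0" "n0 \<bullet> v = 0"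
  shows "D v \<bullet> v = 0"
proof -
  obtain c where "v = c *\<^sub>R t"
    using perp_parallel[OF assms(3,6,4,5)] .
  then show ?thesis
    using assms(2) by (simp add: linear_scale[OF assms(1)])
qed

text \<open>Moves the orbit data from the varying normal and vertex to the fixed normal and point of
  a straight boundary; the factors cancel in the concurrency equations.\<close>

lemma inner_rescale:
  fixes n N :: "'a::real_inner"
  assumes "n = c *\<^sub>R N" "c \<noteq> 0" "N \<bullet> (X - X0) = 0"
  shows "N \<bullet> (q - X0) = (n \<bullet> (q - X)) / c" "N \<bullet> M = (n \<bullet> M) / c"
proof -
  have "N \<bullet> (q - X0) = N \<bullet> (q - X) + N \<bullet> (X - X0)"
    by (simp add: inner_diff_right)
  then show "N \<bullet> (q - X0) = (n \<bullet> (q - X)) / c" "N \<bullet> M = (n \<bullet> M) / c"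
    using assms by simp_all
qed

theorem reflective_imp_right_spherical:
  fixes \<alpha> :: "3 \<Rightarrow> ((real^2) \<times> (real^2) set) set"
  assumes bil: "smooth_projective_billiard \<alpha>" and refl: "reflective \<alpha>"
  shows "right_spherical \<alpha>"
proof -
  obtain A B where A: "openin (top_of_set (fst ` \<alpha> 1)) A" and B: "openin (top_of_set (fst ` \<alpha> 2)) B" and ne: "A \<times> B \<noteq> {}"
    and orb: "\<forall>(p1, p2)\<in>A \<times> B. \<exists>p. periodic_orbit \<alpha> p \<and> p 1 = p1 \<and> p 2 = p2"
    using refl unfolding reflective_def by (elim exE conjE)
  obtain G1 G2 where G: "open G1" "A = fst ` \<alpha> 1 \<inter> G1" "open G2" "B = fst ` \<alpha> 2 \<inter> G2"
    using A B unfolding openin_open by metis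
  define E where "E = (fst ` \<alpha> 1 \<inter> G1) \<times> (fst ` \<alpha> 2 \<inter> G2)"
  let ?N = "boundary_tangents \<alpha>"
  have E: "E \<subseteq> fst ` \<alpha> 1 \<times> fst ` \<alpha> 2"
    by (auto simp: E_def)
  have orb': "\<exists>p. periodic_orbit \<alpha> p \<and> p 1 = fst x \<and> p 2 = snd x" if "x \<in> E" for x
    using orb that unfolding E_def G(2,4) by (cases x) auto
  obtain x0 where "x0 \<in> E"
    using ne unfolding E_def G(2,4) by blast
  then obtain p where p: "periodic_orbit \<alpha> p" "p 1 = fst x0" "p 2 = snd x0"
    using orb' by blast
  have pE: "(p 1, p 2) \<in> E"
    using p \<open>x0 \<in> E\<close> by simp
  have lf: "line_framed_hypersurface (\<alpha> j)" for j
    using bil by (simp add: smooth_projective_billiard_def)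
  note pa = periodic_orbitD(1)[OF p(1)]
  obtain U1 \<rho>1 n1 M1 where 1: "p 1 \<in> U1" "adapted (\<alpha> 1) U1 \<rho>1 n1 M1"
    using adapted_exists[OF lf pa] .
  obtain U2 \<rho>2 n2 M2 where 2: "p 2 \<in> U2" "adapted (\<alpha> 2) U2 \<rho>2 n2 M2"
    using adapted_exists[OF lf pa] .
  obtain U0 \<rho>0 n0 M0 where 0: "p 0 \<in> U0" "adapted (\<alpha> 0) U0 \<rho>0 n0 M0"
    using adapted_exists[OF lf pa] .
  obtain C W where pW: "(p 1, p 2) \<in> W" and fam: "orbit_family n1 n2 n0 M1 M2 M0 \<rho>0 C (E \<inter> W) W ?N"
    and Cp: "C (p 1, p 2) = p 0" and WU: "\<And>x. x \<in> W \<Longrightarrow> fst x \<in> U1 \<and> snd x \<in> U2 \<and> C x \<in> U0"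
    and Ca: "\<And>x. x \<in> E \<inter> W \<Longrightarrow> C x \<in> fst ` \<alpha> 0"
    using orbit_family_near[OF bil E orb' p(1) pE 1(2,1) 2(2,1) 0(2,1)] by metis
  interpret orbit_family n1 n2 n0 M1 M2 M0 \<rho>0 C "E \<inter> W" W ?N
    by (fact fam)
  have flatE: "flat ?N E = E"
    using flat_product_open[OF G(1,3), of _ \<alpha>] flat_subset unfolding E_def by blast
  have f2: "x \<in> flat ?N (flat ?N (E \<inter> W))" if "x \<in> E \<inter> W" for x
    using flat2_Int_open[OF open_W, of ?N E] that unfolding flatE by blast
  then have f1: "x \<in> flat ?N (E \<inter> W)" if "x \<in> E \<inter> W" for x
    using that flat_subset by blast
  let ?x = "(p 1, p 2)"
  have x0: "?x \<in> E \<inter> W"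
    using pE pW by blast
  have pG: "p 1 \<in> G1" "p 2 \<in> G2"
    using pE by (auto simp: E_def)
  have slice: "open ((\<lambda>q. (q, p 2)) -` Z)" "open ((\<lambda>q. (p 1, q)) -` Z)" if "open Z" for Z :: "((real^2) \<times> (real^2)) set"
    by (intro open_vimage[OF that] continuous_intros)+
  have inE: "(q, p 2) \<in> E \<inter> W" if "q \<in> fst ` \<alpha> 1" "q \<in> G1" "(q, p 2) \<in> W" for q
    using that pG(2) pa[of 2] by (simp add: E_def)
  have inE': "(p 1, q) \<in> E \<inter> W" if "q \<in> fst ` \<alpha> 2" "q \<in> G2" "(p 1, q) \<in> W" for q
    using that pG(1) pa[of 1] by (simp add: E_def)

  \<comment> \<open>Every point of the first boundary near \<open>p 1\<close> belongs to an orbit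
    with second vertex \<open>p 2\<close>, so the curvature vanishes on a neighbourhood and not only
    at \<open>p 1\<close>.\<close>
  have curv1: "frechet_derivative n1 (at q) v \<bullet> v = 0"
    if q: "q \<in> fst ` \<alpha> 1 \<inter> (G1 \<inter> (\<lambda>q. (q, p 2)) -` W)" and v: "n1 q \<bullet> v = 0" for q v
  proof -
    have x: "(q, p 2) \<in> E \<inter> W"
      using inE q by blast
    then have W: "(q, p 2) \<in> W"
      by blast
    have "n1 q \<noteq> 0"
      using adaptedD(7)[OF 1(2)] WU[OF W] by simp
    then show ?thesis
      using quadratic_on_line[OF linear_frechet_derivative[OF n_diff(1)[OF W]] _ _ _ tA_nonzero[OF x], of "n1 q" v]
        curvature_zero(1)[OF f2[OF x]] n_tangent(1)[OF x] v by (simp add: kA_def)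
  qed
  have curv2: "frechet_derivative n2 (at q) v \<bullet> v = 0"
    if q: "q \<in> fst ` \<alpha> 2 \<inter> (G2 \<inter> (\<lambda>q. (p 1, q)) -` W)" and v: "n2 q \<bullet> v = 0" for q v
  proof -
    have x: "(p 1, q) \<in> E \<inter> W"
      using inE' q by blast
    then have W: "(p 1, q) \<in> W"
      by blast
    have "n2 q \<noteq> 0"
      using adaptedD(7)[OF 2(2)] WU[OF W] by simp
    then show ?thesis
      using quadratic_on_line[OF linear_frechet_derivative[OF n_diff(2)[OF W]] _ _ _ tB_nonzero[OF x], of "n2 q" v]
        curvature_zero(2)[OF f2[OF x]] n_tangent(2)[OF x] v by (simp add: kB_def)
  qed
  obtain V1 where V1: "open V1" "p 1 \<in> V1" "fst ` \<alpha> 1 \<inter> V1 = {q. n1 (p 1) \<bullet> (q - p 1) = 0} \<inter> V1"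
    "\<And>q. q \<in> fst ` \<alpha> 1 \<inter> V1 \<Longrightarrow> \<exists>c. c \<noteq> 0 \<and> n1 q = c *\<^sub>R n1 (p 1)"
  proof (rule zero_curvature_line[OF lf 1(2) pa 1(1) _ _ curv1])
    show "open (G1 \<inter> (\<lambda>q. (q, p 2)) -` W)" "p 1 \<in> G1 \<inter> (\<lambda>q. (q, p 2)) -` W"
      using G(1) slice open_W pG pW by auto
  qed blast+
  obtain V2 where V2: "open V2" "p 2 \<in> V2" "fst ` \<alpha> 2 \<inter> V2 = {q. n2 (p 2) \<bullet> (q - p 2) = 0} \<inter> V2"
    "\<And>q. q \<in> fst ` \<alpha> 2 \<inter> V2 \<Longrightarrow> \<exists>c. c \<noteq> 0 \<and> n2 q = c *\<^sub>R n2 (p 2)"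
  proof (rule zero_curvature_line[OF lf 2(2) pa 2(1) _ _ curv2])
    show "open (G2 \<inter> (\<lambda>q. (p 1, q)) -` W)" "p 2 \<in> G2 \<inter> (\<lambda>q. (p 1, q)) -` W"
      using G(3) slice open_W pG pW by auto
  qed blast+

  \<comment> \<open>Points of the third boundary are not given in advance as vertices of orbits.
    With the first vertex fixed and the second moving along \<open>tB\<close>, the third has the
    non-zero velocity \<open>- c2 tC\<close>, so it sweeps out a neighbourhood of \<open>p 0\<close>
    in its boundary.\<close>
  obtain G0 where G0: "open G0" "p 0 \<in> G0"
    "\<And>q. q \<in> fst ` \<alpha> 0 \<inter> G0 \<Longrightarrow> \<exists>b. b \<in> V2 \<and> (p 1, b) \<in> E \<inter> W \<and> q = C (p 1, b)"
  proof -
    have "tB ?x \<in> tangent_space (fst ` \<alpha> 2) (p 2)"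
      using adaptedD(6)[OF 2(2) pa 2(1)] n_tangent(2)[OF x0] by simp
    then obtain \<gamma> e where \<gamma>: "e > 0" "smooth_on \<gamma> {-e<..<e::real}" "\<forall>t\<in>{-e<..<e}. \<gamma> t \<in> fst ` \<alpha> 2" "\<gamma> 0 = p 2"
      "(\<gamma> has_vector_derivative tB ?x) (at 0)"
      unfolding tangent_space_def by blast
    have cont: "continuous_on {-e<..<e} \<gamma>"
      using \<gamma>(2) ck_on_continuous unfolding smooth_on_def by blast
    let ?Z = "V2 \<inter> G2 \<inter> (\<lambda>q. (p 1, q)) -` W"
    have "open ({-e<..<e} \<inter> \<gamma> -` ?Z)"
      by (rule continuous_open_preimage[OF cont open_greaterThanLessThan]) (use V2(1) G(3) slice open_W in auto)
    moreover have "0 \<in> {-e<..<e} \<inter> \<gamma> -` ?Z"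
      using \<gamma>(1,4) V2(2) pG pW by simp
    ultimately obtain d where d: "d > 0" "ball 0 d \<subseteq> {-e<..<e} \<inter> \<gamma> -` ?Z"
      using open_contains_ball by blast
    have I: "t \<in> {-e<..<e}" "\<gamma> t \<in> V2" "(p 1, \<gamma> t) \<in> E \<inter> W" if t: "t \<in> {-d<..<d}" for t
    proof -
      have "t \<in> {-e<..<e} \<inter> \<gamma> -` ?Z"
        using d(2) t by (auto simp: subset_eq dist_real_def abs_less_iff)
      then show "t \<in> {-e<..<e}" "\<gamma> t \<in> V2" "(p 1, \<gamma> t) \<in> E \<inter> W"
        using inE' \<gamma>(3) by auto
    qed
    have "continuous_on {-d<..<d} (\<lambda>t. C (p 1, \<gamma> t))"
    proof (rule continuous_on_compose2[OF ck_on_continuous[OF C2]])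
      show "continuous_on {-d<..<d} (\<lambda>t. (p 1, \<gamma> t))"
        by (intro continuous_intros continuous_on_subset[OF cont]) (use I in auto)
    qed (use I in auto)
    moreover have "((\<lambda>t. C (p 1, \<gamma> t)) has_vector_derivative - c2 ?x *\<^sub>R tC ?x) (at 0)"
    proof -
      have "((\<lambda>t. (p 1, \<gamma> t)) has_derivative (\<lambda>r. (0, r *\<^sub>R tB ?x))) (at 0)"
        using \<gamma>(5) unfolding has_vector_derivative_def by (intro has_derivative_Pair has_derivative_const)
      moreover have "(C has_derivative DC ?x) (at (p 1, \<gamma> 0))"
        using C_der pW \<gamma>(4) by simp
      ultimately have "((\<lambda>t. C (p 1, \<gamma> t)) has_derivative (\<lambda>r. DC ?x (0, r *\<^sub>R tB ?x))) (at 0)"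
        by (rule has_derivative_compose)
      then show ?thesis
        unfolding has_vector_derivative_def DC_fixed_A[OF f1[OF x0]] by simp
    qed
    moreover have "submanifold 1 (fst ` \<alpha> 0)"
      using lf[of 0] by (simp add: line_framed_hypersurface_def)
    then obtain U y y' where y: "open U" "p 0 \<in> U" "continuous_on U y" "inj_on y (fst ` \<alpha> 0 \<inter> U)" "(y has_derivative y') (at (p 0))"
      "\<forall>v\<in>tangent_space (fst ` \<alpha> 0) (p 0). y' v = (0::real) \<longrightarrow> v = 0"
      using curve_chart[OF _ pa[of 0]] by metis
    moreover have "y' (- c2 ?x *\<^sub>R tC ?x) \<noteq> 0"
    proof -
      have "c2 ?x \<noteq> 0"
        using h_nonzero[OF x0] by (simp add: c2_def)
      moreover have "- c2 ?x *\<^sub>R tC ?x \<in> tangent_space (fst ` \<alpha> 0) (p 0)"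
        using adaptedD(6)[OF 0(2) pa 0(1)] n_tangent(3)[OF x0] Cp by simp
      ultimately show ?thesis
        using y(6) tC_nonzero[OF x0] by auto
    qed
    moreover have "C (p 1, \<gamma> t) \<in> fst ` \<alpha> 0" if "t \<in> {-d<..<d}" for t
      using Ca I(3)[OF that] by blast
    moreover have "C (p 1, \<gamma> 0) = p 0"
      using Cp \<gamma>(4) by simp
    ultimately obtain G0 where "open G0" "p 0 \<in> G0" "fst ` \<alpha> 0 \<inter> G0 \<subseteq> (\<lambda>t. C (p 1, \<gamma> t)) ` {-d<..<d}"
      using curve_covers[OF y(1-4) d(1), of "\<lambda>t. C (p 1, \<gamma> t)" "- c2 ?x *\<^sub>R tC ?x" y'] y(5) by blast
    then show ?thesis
      using that[of G0] I(2,3) by blast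
  qed
  have curv0: "frechet_derivative n0 (at q) v \<bullet> v = 0" if q: "q \<in> fst ` \<alpha> 0 \<inter> G0" and v: "n0 q \<bullet> v = 0" for q v
  proof -
    obtain b where x: "(p 1, b) \<in> E \<inter> W" and qC: "q = C (p 1, b)"
      using G0(3)[OF q] by blast
    then have W: "(p 1, b) \<in> W"
      by blast
    have "n0 q \<noteq> 0"
      using adaptedD(7)[OF 0(2)] WU[OF W] qC by simp
    then show ?thesis
      using quadratic_on_line[OF linear_frechet_derivative[OF n_diff(3)[OF W]] _ _ _ tC_nonzero[OF x], of "n0 q" v]
        curvature_zero(3)[OF f2[OF x]] n_tangent(3)[OF x] v by (simp add: kC_def qC)
  qed
  obtain V0 where V0: "open V0" "p 0 \<in> V0" "fst ` \<alpha> 0 \<inter> V0 = {q. n0 (p 0) \<bullet> (q - p 0) = 0} \<inter> V0"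
    "\<And>q. q \<in> fst ` \<alpha> 0 \<inter> V0 \<Longrightarrow> \<exists>c. c \<noteq> 0 \<and> n0 q = c *\<^sub>R n0 (p 0)"
    by (rule zero_curvature_line[OF lf 0(2) pa 0(1) G0(1,2) curv0]) blast+

  define n where "n j = (if j = 0 then n0 (p 0) else if j = 1 then n1 (p 1) else n2 (p 2))" for j :: 3
  have n: "n 0 = n0 (p 0)" "n 1 = n1 (p 1)" "n 2 = n2 (p 2)"
    by (simp_all add: n_def)

  \<comment> \<open>The equations of \<open>cevians_through_vertices\<close>, transferred to the
    fixed lines through \<open>p 1\<close>, \<open>p 2\<close> and \<open>p 0\<close>.\<close>
  have frames: "n1 (p 1) \<bullet> M1 (fst x) \<noteq> 0 \<and> n2 (p 2) \<bullet> (fst x - p 2) \<noteq> 0 \<and>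
      (n2 (p 2) \<bullet> (fst x - p 2)) * (n0 (p 0) \<bullet> M1 (fst x)) = (n0 (p 0) \<bullet> (fst x - p 0)) * (n2 (p 2) \<bullet> M1 (fst x))"
    "n2 (p 2) \<bullet> M2 (snd x) \<noteq> 0 \<and> n0 (p 0) \<bullet> (snd x - p 0) \<noteq> 0 \<and>
      (n0 (p 0) \<bullet> (snd x - p 0)) * (n1 (p 1) \<bullet> M2 (snd x)) = (n1 (p 1) \<bullet> (snd x - p 1)) * (n0 (p 0) \<bullet> M2 (snd x))"
    "n0 (p 0) \<bullet> M0 (C x) \<noteq> 0 \<and> n1 (p 1) \<bullet> (C x - p 1) \<noteq> 0 \<and>
      (n1 (p 1) \<bullet> (C x - p 1)) * (n2 (p 2) \<bullet> M0 (C x)) = (n2 (p 2) \<bullet> (C x - p 2)) * (n1 (p 1) \<bullet> M0 (C x))"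
    if x: "x \<in> E \<inter> W" and V: "fst x \<in> V1" "snd x \<in> V2" "C x \<in> V0" for x
  proof -
    have a: "fst x \<in> fst ` \<alpha> 1 \<inter> V1" "snd x \<in> fst ` \<alpha> 2 \<inter> V2" "C x \<in> fst ` \<alpha> 0 \<inter> V0"
      using x V E Ca[OF x] by (auto simp: E_def mem_Times_iff)
    obtain k1 where k1: "k1 \<noteq> 0" "n1 (fst x) = k1 *\<^sub>R n1 (p 1)"
      using V1(4)[OF a(1)] by blast
    obtain k2 where k2: "k2 \<noteq> 0" "n2 (snd x) = k2 *\<^sub>R n2 (p 2)"
      using V2(4)[OF a(2)] by blast
    obtain k0 where k0: "k0 \<noteq> 0" "n0 (C x) = k0 *\<^sub>R n0 (p 0)"
      using V0(4)[OF a(3)] by blast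
    have l: "n1 (p 1) \<bullet> (fst x - p 1) = 0" "n2 (p 2) \<bullet> (snd x - p 2) = 0" "n0 (p 0) \<bullet> (C x - p 0) = 0"
      using a V1(3) V2(3) V0(3) by blast+
    note r = inner_rescale(1)[OF k1(2,1) l(1)] inner_rescale(1)[OF k2(2,1) l(2)] inner_rescale(1)[OF k0(2,1) l(3)]
      and r' = inner_rescale(2)[OF k1(2,1) l(1)] inner_rescale(2)[OF k2(2,1) l(2)] inner_rescale(2)[OF k0(2,1) l(3)]
    have U: "fst x \<in> U1" "snd x \<in> U2" "C x \<in> U0"
      using WU x by blast+
    obtain L1 L2 L0 where L: "(fst x, L1) \<in> \<alpha> 1" "(snd x, L2) \<in> \<alpha> 2" "(C x, L0) \<in> \<alpha> 0"
      using a by auto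
    note unit = adaptedD(9)[OF 1(2) L(1) U(1)] adaptedD(9)[OF 2(2) L(2) U(2)] adaptedD(9)[OF 0(2) L(3) U(3)]
    note c = cevians_through_vertices[OF f1[OF x]] and nz = h_nonzero[OF x]
    show "n1 (p 1) \<bullet> M1 (fst x) \<noteq> 0 \<and> n2 (p 2) \<bullet> (fst x - p 2) \<noteq> 0 \<and>
      (n2 (p 2) \<bullet> (fst x - p 2)) * (n0 (p 0) \<bullet> M1 (fst x)) = (n0 (p 0) \<bullet> (fst x - p 0)) * (n2 (p 2) \<bullet> M1 (fst x))"
      unfolding r unfolding r' unit h_defs[symmetric] using c(1) nz k1(1) k2(1) k0(1) by (simp add: mult.commute)
    show "n2 (p 2) \<bullet> M2 (snd x) \<noteq> 0 \<and> n0 (p 0) \<bullet> (snd x - p 0) \<noteq> 0 \<and>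
      (n0 (p 0) \<bullet> (snd x - p 0)) * (n1 (p 1) \<bullet> M2 (snd x)) = (n1 (p 1) \<bullet> (snd x - p 1)) * (n0 (p 0) \<bullet> M2 (snd x))"
      unfolding r unfolding r' unit h_defs[symmetric] using c(2) nz k1(1) k2(1) k0(1) by (simp add: mult.commute)
    show "n0 (p 0) \<bullet> M0 (C x) \<noteq> 0 \<and> n1 (p 1) \<bullet> (C x - p 1) \<noteq> 0 \<and>
      (n1 (p 1) \<bullet> (C x - p 1)) * (n2 (p 2) \<bullet> M0 (C x)) = (n2 (p 2) \<bullet> (C x - p 2)) * (n1 (p 1) \<bullet> M0 (C x))"
      unfolding r unfolding r' unit h_defs[symmetric] using c(3) nz k1(1) k2(1) k0(1) by (simp add: mult.commute)
  qed
  \<comment> \<open>Also keeps the third vertex in the straight part of its boundary.\<close>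
  define W0 where "W0 = W \<inter> C -` V0"
  have W0: "open W0" "?x \<in> W0"
    using continuous_open_preimage[OF ck_on_continuous[OF C2] open_W V0(1)] pW Cp V0(2) by (auto simp: W0_def)
  show ?thesis
  proof (rule right_sphericalI[OF bil p(1), of n])
    have "hAB ?x = n 1 \<bullet> (p 2 - p 1)" "hAC ?x = n 1 \<bullet> (p 0 - p 1)" "hBA ?x = n 2 \<bullet> (p 1 - p 2)"
      "hBC ?x = n 2 \<bullet> (p 0 - p 2)" "hCA ?x = n 0 \<bullet> (p 1 - p 0)" "hCB ?x = n 0 \<bullet> (p 2 - p 0)"
      by (simp_all add: h_defs n Cp)
    \<comment> \<open>Each \<open>p j\<close> lies on its own line, so the matrix of pairings has
      zero diagonal and its determinant is the sum of the two cyclic products. Ceva's condition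
      makes these equal, so they cannot cancel, and the three lines form a genuine triangle.\<close>
    then have "(line_form (n 0) (p 0) \<bullet> cross3 (line_form (n 1) (p 1)) (line_form (n 2) (p 2))) *
        (homogeneous (p 0) \<bullet> cross3 (homogeneous (p 1)) (homogeneous (p 2))) =
        hAB ?x * hBC ?x * hCA ?x + hAC ?x * hCB ?x * hBA ?x"
      unfolding triple_product_mult inner_line_form by simp
    also have "\<dots> = 2 * (hAB ?x * hBC ?x * hCA ?x)"
      using menelaus[OF f1[OF x0]] by simp
    also have "\<dots> \<noteq> 0"
      using h_nonzero[OF x0] by simp
    finally show "line_form (n 0) (p 0) \<bullet> cross3 (line_form (n 1) (p 1)) (line_form (n 2) (p 2)) \<noteq> 0"
      by auto
  next
    fix j :: 3
    let ?goal = "\<lambda>j. \<exists>V. open V \<and> p j \<in> V \<and> fst ` \<alpha> j \<inter> V = {q. n j \<bullet> (q - p j) = 0} \<inter> V \<and>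
      (\<forall>q L. (q, L) \<in> \<alpha> j \<and> q \<in> V \<longrightarrow> (\<exists>M. direction q L = span {M} \<and> n j \<bullet> M \<noteq> 0 \<and> n (j + 1) \<bullet> (q - p (j + 1)) \<noteq> 0 \<and>
        (n (j + 1) \<bullet> (q - p (j + 1))) * (n (j + 2) \<bullet> M) = (n (j + 2) \<bullet> (q - p (j + 2))) * (n (j + 1) \<bullet> M)))"
    have 1: "?goal 1"
    proof (intro exI[of _ "V1 \<inter> G1 \<inter> (\<lambda>q. (q, p 2)) -` W0"] conjI allI impI)
      show "open (V1 \<inter> G1 \<inter> (\<lambda>q. (q, p 2)) -` W0)" "p 1 \<in> V1 \<inter> G1 \<inter> (\<lambda>q. (q, p 2)) -` W0"
        using V1 G slice W0 pG by auto
      show "fst ` \<alpha> 1 \<inter> (V1 \<inter> G1 \<inter> (\<lambda>q. (q, p 2)) -` W0) = {q. n 1 \<bullet> (q - p 1) = 0} \<inter> (V1 \<inter> G1 \<inter> (\<lambda>q. (q, p 2)) -` W0)"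
        using V1(3) unfolding n by blast
      fix q L assume q: "(q, L) \<in> \<alpha> 1 \<and> q \<in> V1 \<inter> G1 \<inter> (\<lambda>q. (q, p 2)) -` W0"
      then have x: "(q, p 2) \<in> E \<inter> W"
        by (intro inE) (force simp: W0_def)+
      have "q \<in> U1"
        using WU x by fastforce
      then have "direction q L = span {M1 q}"
        using adaptedD(8)[OF 1(2)] q by blast
      then show "\<exists>M. direction q L = span {M} \<and> n 1 \<bullet> M \<noteq> 0 \<and> n (1 + 1) \<bullet> (q - p (1 + 1)) \<noteq> 0 \<and>
        (n (1 + 1) \<bullet> (q - p (1 + 1))) * (n (1 + 2) \<bullet> M) = (n (1 + 2) \<bullet> (q - p (1 + 2))) * (n (1 + 1) \<bullet> M)"
        using frames(1)[OF x] q V2(2) by (intro exI[of _ "M1 q"]) (simp add: numerals_3 n W0_def)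
    qed
    have 2: "?goal 2"
    proof (intro exI[of _ "V2 \<inter> G2 \<inter> (\<lambda>q. (p 1, q)) -` W0"] conjI allI impI)
      show "open (V2 \<inter> G2 \<inter> (\<lambda>q. (p 1, q)) -` W0)" "p 2 \<in> V2 \<inter> G2 \<inter> (\<lambda>q. (p 1, q)) -` W0"
        using V2 G slice W0 pG by auto
      show "fst ` \<alpha> 2 \<inter> (V2 \<inter> G2 \<inter> (\<lambda>q. (p 1, q)) -` W0) = {q. n 2 \<bullet> (q - p 2) = 0} \<inter> (V2 \<inter> G2 \<inter> (\<lambda>q. (p 1, q)) -` W0)"
        using V2(3) unfolding n by blast
      fix q L assume q: "(q, L) \<in> \<alpha> 2 \<and> q \<in> V2 \<inter> G2 \<inter> (\<lambda>q. (p 1, q)) -` W0"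
      then have x: "(p 1, q) \<in> E \<inter> W"
        by (intro inE') (force simp: W0_def)+
      have "q \<in> U2"
        using WU x by fastforce
      then have "direction q L = span {M2 q}"
        using adaptedD(8)[OF 2(2)] q by blast
      then show "\<exists>M. direction q L = span {M} \<and> n 2 \<bullet> M \<noteq> 0 \<and> n (2 + 1) \<bullet> (q - p (2 + 1)) \<noteq> 0 \<and>
        (n (2 + 1) \<bullet> (q - p (2 + 1))) * (n (2 + 2) \<bullet> M) = (n (2 + 2) \<bullet> (q - p (2 + 2))) * (n (2 + 1) \<bullet> M)"
        using frames(2)[OF x] q V1(2) by (intro exI[of _ "M2 q"]) (simp add: numerals_3 n W0_def)
    qed
    have 0: "?goal 0"
    proof (intro exI[of _ "V0 \<inter> G0"] conjI allI impI)
      show "open (V0 \<inter> G0)" "p 0 \<in> V0 \<inter> G0"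
        using V0 G0 by auto
      show "fst ` \<alpha> 0 \<inter> (V0 \<inter> G0) = {q. n 0 \<bullet> (q - p 0) = 0} \<inter> (V0 \<inter> G0)"
        using V0(3) unfolding n by blast
      fix q L assume q: "(q, L) \<in> \<alpha> 0 \<and> q \<in> V0 \<inter> G0"
      then have "q \<in> fst ` \<alpha> 0 \<inter> G0"
        by force
      then obtain b where b: "b \<in> V2" "(p 1, b) \<in> E \<inter> W" "q = C (p 1, b)"
        using G0(3) by blast
      have "q \<in> U0"
        using WU b by fastforce
      then have "direction q L = span {M0 q}"
        using adaptedD(8)[OF 0(2)] q by blast
      then show "\<exists>M. direction q L = span {M} \<and> n 0 \<bullet> M \<noteq> 0 \<and> n (0 + 1) \<bullet> (q - p (0 + 1)) \<noteq> 0 \<and>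
        (n (0 + 1) \<bullet> (q - p (0 + 1))) * (n (0 + 2) \<bullet> M) = (n (0 + 2) \<bullet> (q - p (0 + 2))) * (n (0 + 1) \<bullet> M)"
        using frames(3)[OF b(2)] q b V1(2) by (intro exI[of _ "M0 q"]) (simp add: n)
    qed
    show "?goal j"
      using three_cases[of j] 0 1 2 by metis
  qed
qed

theorem theorem3p51:
  shows "(\<forall>\<alpha> :: 3 \<Rightarrow> ((real^2) \<times> (real^2) set) set.
             smooth_projective_billiard \<alpha> \<and> reflective \<alpha> \<longrightarrow> right_spherical \<alpha>) \<and>
         (CARD('n::finite) \<ge> 3 \<longrightarrow>
            \<not> (\<exists>\<alpha> :: 3 \<Rightarrow> ((real^'n) \<times> (real^'n) set) set.
                 smooth_projective_billiard \<alpha> \<and> pseudo_reflective \<alpha>))"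
  using reflective_imp_right_spherical no_pseudo_reflective[where 'a = "real^'n"] by fastforce

end
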